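(* Let $\Lambda$, $M\in\mathbb Z_+$, the intensities, the arrays $\mathrm B,\Theta,\mathrm E,\mathrm T$ and the generator $\mathbf R$ be as in the context. For $\underline y\in\mathbb Z_+^\Lambda$ put $$U_l(\underline y)=\sum_{n\in\mathbb Z_+}\frac{\overline\lambda_l(n;\underline y)}{\overline\mu_l(n;\underline y)},\qquad C_r(\underline y)=\sum_{n\in\mathbb Z_+}\frac{\overline\lambda_r(n;\underline y)}{\overline\mu_r(n;\underline y)}\,[\overline\gamma_r(n)]^{y_r},$$ and assume that for every $\underline y\in\mathbb Z_+^\Lambda$ with $|\underline y|=M$ one has $U_l(\underline y)<\infty$ and $C_r(\underline y)<\infty$ for all $l,r\in\Lambda$ with $y_l=0$ and $y_r\ge1$. Then the continuous-time Markov process on $\{(\underline y,\underline n)\in\mathbb Z_+^\Lambda\times\mathbb Z_+^\Lambda:\ |\underline y|=M\}$ with generator $\mathbf R$ is positive recurrent and reversible. Its stationary probabilities are $$\pi(\underline y,\underline n)=\frac{\mathbf 1(|\underline y|=M)}{\Xi_{\Lambda,M}}\prod_{p\in\Lambda}\frac{\overline\lambda_p(n_p;\underline y)}{\overline\mu_p(n_p;\underline y)}\prod_{q\in\Lambda}[\overline\gamma_q(n_q)]^{y_q},\qquad \Xi_{\Lambda,M}=\sum_{\underline y\in\mathbb Z_+^\Lambda:\,|\underline y|=M}\ \prod_{r:\,y_r\ge1}C_r(\underline y)\prod_{l:\,y_l=0}U_l(\underline y).$$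
   Context: $\Lambda$ is a finite set of sites and $\mathbb Z_+=\{0,1,2,\dots\}$. A state is $(\underline y,\underline n)$ with $\underline y=(y_s)_{s\in\Lambda}\in\mathbb Z_+^\Lambda$ (numbers of distinguished customers at the sites) and $\underline n=(n_i)_{i\in\Lambda}\in\mathbb Z_+^\Lambda$ (numbers of tasks). $|\underline y|=\sum_sy_s$; write $j\in\underline y$ if $y_j\ge1$ and $l\notin\underline y$ if $y_l=0$. $\underline e^i$ is the unit vector at $i$, $\underline e^{i\to k}=\underline e^k-\underline e^i$, and $\mathbf 1$ is the indicator. Intensities. $\lambda_i(n;\underline y)\ge0$ ($n\ge0$) and $\mu_i(n;\underline y)$ ($n\ge1$) satisfy $\sup\lambda_i(n;\underline y)<\infty$ and $\inf\mu_i(n;\underline y)>0$ (over all $i,n,\underline y$), and $\lambda_i(n;\underline y)>0$ whenever $\lambda_i(n+1;\underline y)>0$. The values $\gamma_i(n)\ge0$ satisfy $\gamma_i(0)=1$ and $\gamma_i(n)>0$ whenever $\gamma_i(n+1)>0$. Set $\overline\lambda_i(0;\underline y)=\overline\mu_i(0;\underline y)=\overline\gamma_i(0)=1$ and, for $n\ge1$, $$\overline\lambda_i(n;\underline y)=\prod_{0\le m<n}\lambda_i(m;\underline y),\quad \overline\mu_i(n;\underline y)=\prod_{1\le m\le n}\mu_i(m;\underline y),\quad\overline\gamma_i(n)=\prod_{0\le m<n}\gamma_i(m).$$ It is understood that $\overline\gamma_j(n_j)>0$ wherever its reciprocal appears below. Arrays. The collections $\mathrm B(\underline n;\underline y)=(\beta_{kl}(n_k,n_l;\underline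 y))$, $\Theta(\underline n;\underline y)=(\theta_{kl}(n_k,n_l;\underline y))$, $\mathrm E(\underline n;\underline y)=(\epsilon_{ij}(n_i,n_j;\underline y))$, $\mathrm T(\underline n;\underline y)=(\tau_{jj'}(\underline n;\underline y))$ are irreducible, meaning that their off-diagonal entries are strictly positive. They satisfy: $$\frac{\lambda_k(n_k-1;\underline y)}{\mu_k(n_k;\underline y)}\beta_{kl}(n_k,n_l;\underline y)=\frac{\lambda_l(n_l;\underline y)}{\mu_l(n_l+1;\underline y)}\beta_{lk}(n_l+1,n_k-1;\underline y),\quad k\ne l,\ k,l\notin\underline y,\ n_k\ge1;$$ $$\frac{\lambda_j(n_j-1;\underline y)}{\mu_j(n_j;\underline y)}\theta_{jk}(n_j,n_k;\underline y)=\frac{\lambda_k(n_k;\underline y)}{\mu_k(n_k+1;\underline y)}\theta_{kj}(n_k+1,n_j-1;\underline y),\quad j\in\underline y,\ k\notin\underline y,\ n_j\ge1;$$ $$\frac{\lambda_i(n_i-1;\underline y)[\gamma_i(n_i-1)]^{y_i}}{\mu_i(n_i;\underline y)}\epsilon_{ij}(n_i,n_j;\underline y)=\frac{\lambda_j(n_j;\underline y)[\gamma_j(n_j)]^{y_j}}{\mu_j(n_j+1;\underline y)}\epsilon_{ji}(n_j+1,n_i-1;\underline y),\quad i\ne j,\ i,j\in\underline y,\ n_i\ge1;$$ $$\tau_{jj'}(\underline n;\underline y)\prod_{q\in\Lambda}\frac{\overline\lambda_q(n_q;\underline y)}{\overline\mu_q(n_q;\underline y)}=\tau_{j'j}(\underline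 n;\underline y+\underline e^{j\to j'})\prod_{q\in\Lambda}\frac{\overline\lambda_q(n_q;\underline y+\underline e^{j\to j'})}{\overline\mu_q(n_q;\underline y+\underline e^{j\to j'})},\quad j\in\underline y,\ j'\ne j.$$ The generator $\mathbf R$ has the following off-diagonal entries (all others are zero): - $R[(\underline y,\underline n);(\underline y,\underline n+\underline e^p)]=\lambda_p(n_p;\underline y)[\gamma_p(n_p)]^{y_p}$ and $R[(\underline y,\underline n);(\underline y,\underline n-\underline e^p)]=\mu_p(n_p;\underline y)\mathbf 1(n_p\ge1)$, $p\in\Lambda$; - $R[(\underline y,\underline n);(\underline y,\underline n+\underline e^{k\to l})]=\beta_{kl}(n_k,n_l;\underline y)\mathbf 1(n_k\ge1)$, $k\ne l$, $k,l\notin\underline y$; - $R[(\underline y,\underline n);(\underline y,\underline n+\underline e^{i\to j})]=\epsilon_{ij}(n_i,n_j;\underline y)\mathbf 1(n_i\ge1)$, $i\ne j$, $i,j\in\underline y$; - $R[(\underline y,\underline n);(\underline y,\underline n+\underline e^{j\to l})]=\theta_{jl}(n_j,n_l;\underline y)\mathbf 1(n_j\ge1)$, $j\in\underline y$, $l\notin\underline y$; - $R[(\underline y,\underline n);(\underline y,\underline n+\underline e^{k\to j})]=\theta_{kj}(n_k,n_j;\underline y)[\gamma_j(n_j)]^{y_j}\mathbf 1(n_k\ge1)$, $j\in\underline y$, $k\notin\underline y$; - $R[(\underline y,\underline n);(\underline y+\underline e^{j\to j'},\underline n)]=[\overline\gamma_j(n_j)]^{-y_j}\,\tau_{jj'}(\underline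 n;\underline y)\,[\overline\gamma_{j'}(n_{j'})]^{-y_{j'}}$, $j\in\underline y$, $j'\ne j$.
   Formalization: Added: either the values γ_i(n) are bounded or the process does not explode (otherwise the claim fails, e.g. one site, M=1, λ=1, γ(n)=4^n, μ(n)=2·4^(n-1)); positive recurrence allows inessential states, where π=0, when intensities vanish. *)

theory Defs
  imports "HOL-Probability.Probability"
begin

section \<open>Continuous-time Markov processes on a countable state space\<close>

text \<open>
  A conservative generator on a set \<open>S\<close> of states is a matrix \<open>Q\<close> whose diagonal entries are minus
  the sums of the off-diagonal ones.  The process with generator \<open>Q\<close> is described by its successive
  states \<open>Y\<^sub>0, Y\<^sub>1, \<dots>\<close> and the times \<open>H\<^sub>0, H\<^sub>1, \<dots>\<close> spent in them.
\<close>

definition exit_rate :: "('s \<Rightarrow> 's \<Rightarrow> real) \<Rightarrow> 's \<Rightarrow> real" where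
  "exit_rate Q x = - Q x x"

definition jump_prob :: "('s \<Rightarrow> 's \<Rightarrow> real) \<Rightarrow> 's \<Rightarrow> 's \<Rightarrow> real" where
  "jump_prob Q x z =
     (if exit_rate Q x = 0 then of_bool (z = x)
      else if z = x then 0 else Q x z / exit_rate Q x)"

text \<open>
  \<open>Pr x\<close> is the law of the process started at \<open>x\<close>: the jump chain \<open>Y\<close> has transition matrix
  \<open>jump_prob Q\<close>, and given \<open>Y\<close> the holding times \<open>H\<^sub>i\<close> are independent and exponential with rates
  \<open>exit_rate Q (Y\<^sub>i)\<close> (a rate \<open>0\<close> giving \<open>H\<^sub>i = \<infinity>\<close>).
\<close>

definition markov_process ::
  "'s::countable set \<Rightarrow> ('s \<Rightarrow> 's \<Rightarrow> real) \<Rightarrow> ('s \<Rightarrow> 'w measure) \<Rightarrow>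
   (nat \<Rightarrow> 'w \<Rightarrow> 's) \<Rightarrow> (nat \<Rightarrow> 'w \<Rightarrow> ennreal) \<Rightarrow> bool" where
  "markov_process S Q Pr Y H \<longleftrightarrow>
     (\<forall>x\<in>S. prob_space (Pr x) \<and>
        (\<forall>i. Y i \<in> measurable (Pr x) (count_space UNIV)) \<and>
        (\<forall>i. H i \<in> borel_measurable (Pr x)) \<and>
        (\<forall>m s t. (\<forall>i\<le>m. s i \<in> S \<and> 0 \<le> t i) \<longrightarrow>
           measure (Pr x) {w \<in> space (Pr x). \<forall>i\<le>m. Y i w = s i \<and> ennreal (t i) < H i w} =
             of_bool (s 0 = x) * (\<Prod>i<m. jump_prob Q (s i) (s (Suc i))) *
             (\<Prod>i\<le>m. exp (- exit_rate Q (s i) * t i))))"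

text \<open>
  If the total time is finite, the jump description determines the process only up to that time, so
  a generator determines a process on all of \<open>[0, \<infinity>)\<close> only in the non-explosive case.
\<close>

definition explosion_time :: "(nat \<Rightarrow> 'w \<Rightarrow> ennreal) \<Rightarrow> 'w \<Rightarrow> ennreal" where
  "explosion_time H w = (\<Sum>i. H i w)"

definition non_explosive ::
  "'s set \<Rightarrow> ('s \<Rightarrow> 'w measure) \<Rightarrow> (nat \<Rightarrow> 'w \<Rightarrow> ennreal) \<Rightarrow> bool" where
  "non_explosive S Pr H \<longleftrightarrow> (\<forall>x\<in>S. AE w in Pr x. explosion_time H w = \<infinity>)"

text \<open>The state occupied at time \<open>t\<close>; it is \<open>None\<close> after an explosion.\<close>

definition state_at ::
  "(nat \<Rightarrow> 'w \<Rightarrow> 's) \<Rightarrow> (nat \<Rightarrow> 'w \<Rightarrow> ennreal) \<Rightarrow> real \<Rightarrow> 'w \<Rightarrow> 's option" where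
  "state_at Y H t w =
     (if ennreal t < explosion_time H w
      then Some (Y (LEAST m. ennreal t < (\<Sum>i\<le>m. H i w)) w) else None)"

definition return_time ::
  "(nat \<Rightarrow> 'w \<Rightarrow> 's) \<Rightarrow> (nat \<Rightarrow> 'w \<Rightarrow> ennreal) \<Rightarrow> 's \<Rightarrow> 'w \<Rightarrow> ennreal" where
  "return_time Y H x w =
     Inf {ennreal t |t. 0 \<le> t \<and> H 0 w \<le> ennreal t \<and> state_at Y H t w = Some x}"

definition positive_recurrent_state ::
  "('s \<Rightarrow> 's \<Rightarrow> real) \<Rightarrow> ('s \<Rightarrow> 'w measure) \<Rightarrow> (nat \<Rightarrow> 'w \<Rightarrow> 's) \<Rightarrow>
   (nat \<Rightarrow> 'w \<Rightarrow> ennreal) \<Rightarrow> 's \<Rightarrow> bool" where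
  "positive_recurrent_state Q Pr Y H x \<longleftrightarrow>
     exit_rate Q x = 0 \<or> (\<integral>\<^sup>+ w. return_time Y H x w \<partial>Pr x) < \<infinity>"

definition closed_class :: "'s set \<Rightarrow> ('s \<Rightarrow> 's \<Rightarrow> real) \<Rightarrow> 's set \<Rightarrow> bool" where
  "closed_class S Q D \<longleftrightarrow>
     D \<noteq> {} \<and> D \<subseteq> S \<and> (\<forall>x\<in>D. \<forall>z\<in>S - D. Q x z = 0) \<and>
     (\<forall>x\<in>D. \<forall>z\<in>D. (\<lambda>u v. u \<in> S \<and> v \<in> S \<and> u \<noteq> v \<and> 0 < Q u v)\<^sup>*\<^sup>* x z)"

text \<open>
  For an irreducible generator the only closed class is \<open>S\<close>, and positive recurrence of the process
  means positive recurrence of every state.  In general, inessential states are allowed: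
  there is a closed communicating class, entered with probability one from every initial state,
  all of whose states are positive recurrent.
\<close>

definition positive_recurrent ::
  "'s set \<Rightarrow> ('s \<Rightarrow> 's \<Rightarrow> real) \<Rightarrow> ('s \<Rightarrow> 'w measure) \<Rightarrow> (nat \<Rightarrow> 'w \<Rightarrow> 's) \<Rightarrow>
   (nat \<Rightarrow> 'w \<Rightarrow> ennreal) \<Rightarrow> bool" where
  "positive_recurrent S Q Pr Y H \<longleftrightarrow>
     (\<exists>D. closed_class S Q D \<and>
        (\<forall>x\<in>D. positive_recurrent_state Q Pr Y H x) \<and>
        (\<forall>x\<in>S. AE w in Pr x. \<exists>t\<ge>0. \<exists>z\<in>D. state_at Y H t w = Some z))"

definition transition_prob ::
  "('s \<Rightarrow> 'w measure) \<Rightarrow> (nat \<Rightarrow> 'w \<Rightarrow> 's) \<Rightarrow> (nat \<Rightarrow> 'w \<Rightarrow> ennreal) \<Rightarrow>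
   real \<Rightarrow> 's \<Rightarrow> 's \<Rightarrow> real" where
  "transition_prob Pr Y H t x z =
     measure (Pr x) {w \<in> space (Pr x). state_at Y H t w = Some z}"

definition stationary_distribution ::
  "'s set \<Rightarrow> ('s \<Rightarrow> 'w measure) \<Rightarrow> (nat \<Rightarrow> 'w \<Rightarrow> 's) \<Rightarrow> (nat \<Rightarrow> 'w \<Rightarrow> ennreal) \<Rightarrow>
   ('s \<Rightarrow> real) \<Rightarrow> bool" where
  "stationary_distribution S Pr Y H p \<longleftrightarrow>
     (\<forall>x\<in>S. 0 \<le> p x) \<and> (p has_sum 1) S \<and>
     (\<forall>t\<ge>0. \<forall>z\<in>S. ((\<lambda>x. p x * transition_prob Pr Y H t x z) has_sum p z) S)"

text \<open>
  The probability, for initial distribution \<open>p\<close>, of being in state \<open>s i\<close> at time \<open>t i\<close> for all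
  \<open>i < m\<close>; the times need not be ordered.
\<close>

definition finite_dim_prob ::
  "'s set \<Rightarrow> ('s \<Rightarrow> 'w measure) \<Rightarrow> (nat \<Rightarrow> 'w \<Rightarrow> 's) \<Rightarrow> (nat \<Rightarrow> 'w \<Rightarrow> ennreal) \<Rightarrow>
   ('s \<Rightarrow> real) \<Rightarrow> nat \<Rightarrow> (nat \<Rightarrow> real) \<Rightarrow> (nat \<Rightarrow> 's) \<Rightarrow> real" where
  "finite_dim_prob S Pr Y H p m t s =
     (\<Sum>\<^sub>\<infinity>x\<in>S. p x *
        measure (Pr x) {w \<in> space (Pr x). \<forall>i<m. state_at Y H (t i) w = Some (s i)})"

text \<open>
  Reversibility: the process with initial distribution \<open>p\<close> has the same finite-dimensional
  distributions as its time reversal from any time \<open>T\<close>.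
\<close>

definition reversible ::
  "'s set \<Rightarrow> ('s \<Rightarrow> 'w measure) \<Rightarrow> (nat \<Rightarrow> 'w \<Rightarrow> 's) \<Rightarrow> (nat \<Rightarrow> 'w \<Rightarrow> ennreal) \<Rightarrow>
   ('s \<Rightarrow> real) \<Rightarrow> bool" where
  "reversible S Pr Y H p \<longleftrightarrow>
     (\<forall>T m t s. (\<forall>i<m. 0 \<le> t i \<and> t i \<le> T \<and> s i \<in> S) \<longrightarrow>
        finite_dim_prob S Pr Y H p m t s = finite_dim_prob S Pr Y H p m (\<lambda>i. T - t i) s)"

section \<open>The network\<close>

text \<open>
  Sites are the elements of a finite type \<open>'a\<close>; a state is a pair \<open>(y, n)\<close> of functions
  \<open>'a \<Rightarrow> nat\<close>.
\<close>

type_synonym 'a config = "('a \<Rightarrow> nat) \<times> ('a \<Rightarrow> nat)"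

definition states :: "nat \<Rightarrow> 'a::finite config set" where
  "states M = {(y, n). (\<Sum>s\<in>UNIV. y s) = M}"

text \<open>\<open>v + e\<^sup>p\<close>, \<open>v - e\<^sup>p\<close> and \<open>v + e\<^sup>k - e\<^sup>j\<close>; the subtractions are used only for positive entries.\<close>

definition incr :: "'a \<Rightarrow> ('a \<Rightarrow> nat) \<Rightarrow> 'a \<Rightarrow> nat" where
  "incr p v = v(p := v p + 1)"

definition decr :: "'a \<Rightarrow> ('a \<Rightarrow> nat) \<Rightarrow> 'a \<Rightarrow> nat" where
  "decr p v = v(p := v p - 1)"

definition transfer :: "'a \<Rightarrow> 'a \<Rightarrow> ('a \<Rightarrow> nat) \<Rightarrow> 'a \<Rightarrow> nat" where
  "transfer j k v = incr k (decr j v)"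

type_synonym 'a intensity = "'a \<Rightarrow> nat \<Rightarrow> ('a \<Rightarrow> nat) \<Rightarrow> real"
type_synonym 'a array = "'a \<Rightarrow> 'a \<Rightarrow> nat \<Rightarrow> nat \<Rightarrow> ('a \<Rightarrow> nat) \<Rightarrow> real"

definition lam_bar :: "'a intensity \<Rightarrow> 'a intensity" where
  "lam_bar lam i n y = (\<Prod>m<n. lam i m y)"

definition mu_bar :: "'a intensity \<Rightarrow> 'a intensity" where
  "mu_bar mu i n y = (\<Prod>m=1..n. mu i m y)"

definition gam_bar :: "('a \<Rightarrow> nat \<Rightarrow> real) \<Rightarrow> 'a \<Rightarrow> nat \<Rightarrow> real" where
  "gam_bar gam i n = (\<Prod>m<n. gam i m)"

definition U_term :: "'a intensity \<Rightarrow> 'a intensity \<Rightarrow> ('a \<Rightarrow> nat) \<Rightarrow> 'a \<Rightarrow> nat \<Rightarrow> real" where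
  "U_term lam mu y l n = lam_bar lam l n y / mu_bar mu l n y"

definition C_term ::
  "'a intensity \<Rightarrow> 'a intensity \<Rightarrow> ('a \<Rightarrow> nat \<Rightarrow> real) \<Rightarrow> ('a \<Rightarrow> nat) \<Rightarrow> 'a \<Rightarrow> nat \<Rightarrow> real" where
  "C_term lam mu gam y r n = lam_bar lam r n y / mu_bar mu r n y * gam_bar gam r n ^ y r"

definition Xi ::
  "'a::finite intensity \<Rightarrow> 'a intensity \<Rightarrow> ('a \<Rightarrow> nat \<Rightarrow> real) \<Rightarrow> nat \<Rightarrow> real" where
  "Xi lam mu gam M =
     (\<Sum>y | (\<Sum>s\<in>UNIV. y s) = M.
        (\<Prod>r | 1 \<le> y r. \<Sum>n. C_term lam mu gam y r n) *
        (\<Prod>l | y l = 0. \<Sum>n. U_term lam mu y l n))"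

definition stat_prob ::
  "'a::finite intensity \<Rightarrow> 'a intensity \<Rightarrow> ('a \<Rightarrow> nat \<Rightarrow> real) \<Rightarrow> nat \<Rightarrow> 'a config \<Rightarrow> real" where
  "stat_prob lam mu gam M = (\<lambda>(y, n).
     of_bool ((\<Sum>s\<in>UNIV. y s) = M) / Xi lam mu gam M *
     (\<Prod>p\<in>UNIV. lam_bar lam p (n p) y / mu_bar mu p (n p) y) *
     (\<Prod>q\<in>UNIV. gam_bar gam q (n q) ^ y q))"

text \<open>
  The four kinds of moves of a task from \<open>k\<close> to \<open>l\<close>, according to whether customers are present
  (\<open>1 \<le> y k\<close>, \<open>1 \<le> y l\<close>) at the two sites.
\<close>

definition task_rate ::
  "('a \<Rightarrow> nat \<Rightarrow> real) \<Rightarrow> 'a array \<Rightarrow> 'a array \<Rightarrow> 'a array \<Rightarrow>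
   'a \<Rightarrow> 'a \<Rightarrow> ('a \<Rightarrow> nat) \<Rightarrow> ('a \<Rightarrow> nat) \<Rightarrow> real" where
  "task_rate gam beta theta eps k l y n =
     (if y k = 0 \<and> y l = 0 then beta k l (n k) (n l) y
      else if 1 \<le> y k \<and> 1 \<le> y l then eps k l (n k) (n l) y
      else if 1 \<le> y k then theta k l (n k) (n l) y
      else theta k l (n k) (n l) y * gam l (n l) ^ y l)"

text \<open>
  The off-diagonal entries of the generator.  Distinct summands belong to distinct target states,
  so at most one of them is nonzero.
\<close>

definition rate ::
  "'a::finite intensity \<Rightarrow> 'a intensity \<Rightarrow> ('a \<Rightarrow> nat \<Rightarrow> real) \<Rightarrow>
   'a array \<Rightarrow> 'a array \<Rightarrow> 'a array \<Rightarrow>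
   ('a \<Rightarrow> 'a \<Rightarrow> ('a \<Rightarrow> nat) \<Rightarrow> ('a \<Rightarrow> nat) \<Rightarrow> real) \<Rightarrow> 'a config \<Rightarrow> 'a config \<Rightarrow> real" where
  "rate lam mu gam beta theta eps tau = (\<lambda>(y, n) (y', n').
     (\<Sum>p\<in>UNIV. of_bool (y' = y \<and> n' = incr p n) * (lam p (n p) y * gam p (n p) ^ y p)) +
     (\<Sum>p\<in>UNIV. of_bool (y' = y \<and> 1 \<le> n p \<and> n' = decr p n) * mu p (n p) y) +
     (\<Sum>k\<in>UNIV. \<Sum>l\<in>UNIV - {k}. of_bool (y' = y \<and> 1 \<le> n k \<and> n' = transfer k l n) *
        task_rate gam beta theta eps k l y n) +
     (\<Sum>j\<in>UNIV. \<Sum>j'\<in>UNIV - {j}. of_bool (n' = n \<and> 1 \<le> y j \<and> y' = transfer j j' y) *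
        (inverse (gam_bar gam j (n j) ^ y j) * tau j j' n y *
         inverse (gam_bar gam j' (n j') ^ y j'))))"

definition generator ::
  "'a::finite intensity \<Rightarrow> 'a intensity \<Rightarrow> ('a \<Rightarrow> nat \<Rightarrow> real) \<Rightarrow>
   'a array \<Rightarrow> 'a array \<Rightarrow> 'a array \<Rightarrow>
   ('a \<Rightarrow> 'a \<Rightarrow> ('a \<Rightarrow> nat) \<Rightarrow> ('a \<Rightarrow> nat) \<Rightarrow> real) \<Rightarrow> 'a config \<Rightarrow> 'a config \<Rightarrow> real" where
  "generator lam mu gam beta theta eps tau x z =
     (if z = x then - (\<Sum>\<^sub>\<infinity>u\<in>-{x}. rate lam mu gam beta theta eps tau x u)
      else rate lam mu gam beta theta eps tau x z)"

end

theory Submission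
  imports Defs
begin

text \<open>
  The probability of being in \<open>z\<close> at time \<open>t\<close> after \<open>N\<close> jumps, for the process started
  in \<open>x\<close>, is an \<open>N\<close>-fold convolution of exponential functions, summed over trajectories.  It can be
  decomposed at the last or at the first jump; detailed balance of the weights exchanges the two
  decompositions, so that \<open>w x P\<^sub>t x z = w z P\<^sub>t z x\<close>.  The Markov property at fixed times extends this to
  all finite-dimensional distributions.  The mean return time is bounded by comparing expected
  numbers of visits before the return with the invariant measure \<open>w q\<close> of the jump chain.  If the
  \<open>\<gamma>\<close> are bounded, \<open>1 + |n|\<close> is a Lyapunov function that excludes explosion.
\<close>

section \<open>Exponential times and convolutions\<close>


text \<open>Two obstacles shape the proof. First, the process lives on an arbitrary sample space and
  is known only through probabilities of finite paths with lower bounds on the holding times.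
  Independence of a holding time from the past, and the Markov property at a fixed time, must be
  extracted from these tails. The past enters as a recursive functional, so that a single induction
  serves both the jump times and the event of not having returned. Second, arrival intensities may
  vanish, so the process need not be irreducible and the weights may have zeros. Irreducibility is
  replaced by one reference state, without tasks and with all customers at one site: its
  unnormalised weight is 1 and it is reachable from everywhere. It anchors both the uniqueness of
  the stationary law and the closed class. A state of weight zero lies above a level at which
  arrivals are blocked, so only finitely many states are reachable from it, and repeated trials with
  a uniform chance of success lead to the reference state. Weights and kernels are taken in
  \<open>ennreal\<close>, where sums and integrals may be exchanged freely.\<close>

abbreviation count_sum :: "('s \<Rightarrow> ennreal) \<Rightarrow> ennreal" (binder "\<Sum>\<^sub>c" 10) where
  "count_sum f \<equiv> \<integral>\<^sup>+x. f x \<partial>count_space UNIV"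

text \<open>Open half-lines form a pi-system that generates the Borel sets. None of them contains 0,
  so \<open>UNIV\<close> is added to the generator and the total masses are compared
  separately.\<close>

lemma borel_ennreal_measure_eqI:
  fixes A B :: "ennreal measure"
  assumes sets: "sets A = sets borel" "sets B = sets borel"
    and fin: "emeasure A UNIV \<noteq> \<infinity>" and total: "emeasure A UNIV = emeasure B UNIV"
    and tail: "\<And>t. 0 \<le> t \<Longrightarrow> emeasure A {ennreal t<..} = emeasure B {ennreal t<..}"
  shows "A = B"
proof (rule measure_eqI_generator_eq[where E="insert UNIV (range (\<lambda>a. {a<..}))"
      and \<Omega>=UNIV and A="\<lambda>_. UNIV"])
  have "{a<..} \<inter> {b<..} = {max a b<..}" for a b :: ennreal by auto
  then show "Int_stable (insert UNIV (range (\<lambda>a::ennreal. {a<..})))"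
    by (auto simp: Int_stable_def)
  have "sigma_sets UNIV (insert UNIV (range (\<lambda>a::ennreal. {a<..}))) = sets borel" (is "?L = _")
  proof
    show "?L \<subseteq> sets borel"
      by (rule sets.sigma_sets_subset[of _ borel, simplified]) auto
    have "sets (borel :: ennreal measure) = sigma_sets UNIV (range (\<lambda>a. {a<..}))"
      by (subst borel_Ioi) simp
    also have "\<dots> \<subseteq> ?L" by (intro sigma_sets_mono'') auto
    finally show "sets borel \<subseteq> ?L" .
  qed
  with sets show "sets A = sigma_sets UNIV (insert UNIV (range (\<lambda>a. {a<..})))"
    "sets B = sigma_sets UNIV (insert UNIV (range (\<lambda>a. {a<..})))" by simp_all
  fix X assume "X \<in> insert UNIV (range (\<lambda>a::ennreal. {a<..}))"
  then show "emeasure A X = emeasure B X"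
  proof
    assume "X \<in> range (\<lambda>a. {a<..})"
    then obtain a where X: "X = {a<..}" by auto
    show ?thesis
    proof (cases a)
      case (real r) then show ?thesis using tail X by simp
    next
      case top
      moreover have "{\<top><..} = ({} :: ennreal set)" by auto
      ultimately show ?thesis using X by simp
    qed
  qed (simp add: total)
qed (use fin in auto)

text \<open>\<open>P\<close> is not known to be a product, and \<open>tail\<close> sees the second
  coordinate only through half-lines. For fixed \<open>A\<close> the slice
  \<open>X \<mapsto> emeasure P (A \<times> X)\<close> is a finite measure on
  \<open>ennreal\<close>, to which the one-dimensional criterion applies.\<close>

lemma pair_measure_eqI_tail:
  fixes P :: "('z \<times> ennreal) measure"
  assumes M1: "finite_measure M1" and M2: "finite_measure M2"
    and s2: "sets M2 = sets borel" and P: "finite_measure P"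
    and sets: "sets P = sets (M1 \<Otimes>\<^sub>M borel)"
    and full: "\<And>A. A \<in> sets M1 \<Longrightarrow> emeasure P (A \<times> UNIV) = emeasure M1 A * emeasure M2 UNIV"
    and tail: "\<And>A t. A \<in> sets M1 \<Longrightarrow> 0 \<le> t \<Longrightarrow>
      emeasure P (A \<times> {ennreal t<..}) = emeasure M1 A * emeasure M2 {ennreal t<..}"
  shows "P = M1 \<Otimes>\<^sub>M M2"
proof -
  interpret M1: finite_measure M1 by fact
  interpret M2: finite_measure M2 by fact
  interpret P: finite_measure P by fact
  have "M1 \<Otimes>\<^sub>M M2 = P"
  proof (rule pair_measure_eqI)
    show "sigma_finite_measure M1" "sigma_finite_measure M2" by unfold_locales
    show "sets (M1 \<Otimes>\<^sub>M M2) = sets P"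
      unfolding sets by (rule sets_pair_measure_cong) (simp_all add: s2)
    fix A B assume A: "A \<in> sets M1" and B: "B \<in> sets M2"
    have sp: "space P = space M1 \<times> UNIV"
      using sets_eq_imp_space_eq[OF sets] by (simp add: space_pair_measure)
    have AP: "A \<times> X \<in> sets P" if "X \<in> sets borel" for X
      unfolding sets using A that by (rule pair_measureI)
    have snd [measurable]: "snd \<in> measurable P borel"
      unfolding measurable_cong_sets[OF sets refl] by measurable
    let ?D = "distr (density P (indicator (A \<times> UNIV))) borel snd"
    have D: "emeasure ?D X = emeasure P (A \<times> X)" if X: "X \<in> sets borel" for X
    proof -
      have "emeasure ?D X = emeasure (density P (indicator (A \<times> UNIV))) (space M1 \<times> X)"
        using X by (subst emeasure_distr) (auto simp: sp intro!: arg_cong2[where f=emeasure])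
      also have "\<dots> = (\<integral>\<^sup>+p. indicator (A \<times> UNIV) p * indicator (space M1 \<times> X) p \<partial>P)"
        using AP[of UNIV] X sets.top[of M1]
        by (intro emeasure_density borel_measurable_indicator) (simp_all add: sets)
      also have "\<dots> = (\<integral>\<^sup>+p. indicator (A \<times> X) p \<partial>P)"
        using sets.sets_into_space[OF A]
        by (intro nn_integral_cong) (auto split: split_indicator)
      finally show ?thesis using AP[OF X] by simp
    qed
    let ?S = "scale_measure (emeasure M1 A) M2"
    have "?D = ?S"
    proof (rule borel_ennreal_measure_eqI)
      show "emeasure ?D UNIV \<noteq> \<infinity>" using D[of UNIV] by simp
      show "emeasure ?D UNIV = emeasure ?S UNIV" using D[of UNIV] full[OF A] by simp
      show "emeasure ?D {ennreal t<..} = emeasure ?S {ennreal t<..}" if "0 \<le> t" for t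
        using D[of "{ennreal t<..}"] tail[OF A that] by simp
    qed (use s2 in auto)
    then have "emeasure ?D B = emeasure ?S B" by simp
    then show "emeasure M1 A * emeasure M2 B = emeasure P (A \<times> B)"
      using D[of B] B s2 by simp
  qed
  then show ?thesis by simp
qed

text \<open>Rate 0 gives the point mass at infinity: an absorbing state is held forever, and the
  tail formula covers this case too.\<close>

definition exp_time :: "real \<Rightarrow> ennreal measure" where
  "exp_time r = (if r = 0 then return borel \<infinity>
     else distr (density lborel (exponential_density r)) borel ennreal)"

lemma sets_exp_time [simp, measurable_cong]: "sets (exp_time r) = sets borel"
  by (simp add: exp_time_def)

lemma space_exp_time [simp]: "space (exp_time r) = UNIV"
  by (simp add: exp_time_def)

lemma prob_space_exp_time: "0 \<le> r \<Longrightarrow> prob_space (exp_time r)"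
  unfolding exp_time_def
  by (auto intro!: prob_space_return prob_space.prob_space_distr prob_space_exponential_density)

lemma nn_integral_exp_time_0:
  "f \<in> borel_measurable borel \<Longrightarrow> (\<integral>\<^sup>+h. f h \<partial>exp_time 0) = f \<infinity>"
  unfolding exp_time_def by (simp add: nn_integral_return)

lemma nn_integral_exp_time:
  assumes "0 < r" and [measurable]: "f \<in> borel_measurable borel"
  shows "(\<integral>\<^sup>+h. f h \<partial>exp_time r) =
    (\<integral>\<^sup>+h. ennreal (exponential_density r h) * f (ennreal h) \<partial>lborel)"
  using assms unfolding exp_time_def
  by (simp add: nn_integral_distr nn_integral_density)

lemma emeasure_exp_time_tail:
  assumes r: "0 \<le> r" and t: "0 \<le> t"
  shows "emeasure (exp_time r) {ennreal t<..} = ennreal (exp (- r * t))"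
proof (cases "r = 0")
  case True then show ?thesis by (simp add: exp_time_def)
next
  case False
  with r have r: "0 < r" by simp
  have "emeasure (exp_time r) {ennreal t<..} = (\<integral>\<^sup>+h. indicator {ennreal t<..} h \<partial>exp_time r)"
    by simp
  also have "\<dots> = (\<integral>\<^sup>+h. ennreal (exponential_density r h) * indicator {ennreal t<..} (ennreal h) \<partial>lborel)"
    by (rule nn_integral_exp_time[OF r]) simp
  \<comment> \<open>The point \<open>h = t\<close> is a null set, so the open half-line becomes the
    closed one on which the fundamental theorem is applied.\<close>
  also have "\<dots> = (\<integral>\<^sup>+h. ennreal (r * exp (- r * h)) * indicator {t..} h \<partial>lborel)"
    using t AE_lborel_singleton[of t]
    by (intro nn_integral_cong_AE, elim eventually_mono)
       (auto simp: exponential_density_def ennreal_less_iff mult.commute split: split_indicator)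
  also have "\<dots> = ennreal (0 - (- exp (- r * t)))"
  proof (rule nn_integral_FTC_atLeast)
    show "((\<lambda>h. - exp (- r * h)) has_real_derivative r * exp (- r * x)) (at x)" for x
      by (auto intro!: derivative_eq_intros)
    have "((\<lambda>h. - exp (- r * h)) \<longlongrightarrow> - 0) at_top"
      using r by (intro tendsto_minus filterlim_compose[OF exp_at_bot]
         filterlim_tendsto_neg_mult_at_bot[OF tendsto_const] filterlim_ident) auto
    then show "((\<lambda>h. - exp (- r * h)) \<longlongrightarrow> 0) at_top" by simp
  qed (use r in auto)
  finally show ?thesis by simp
qed

lemma nn_integral_exp_time_mean:
  assumes "0 < r" shows "(\<integral>\<^sup>+h. h \<partial>exp_time r) = ennreal (1 / r)"
proof -
  have "(\<integral>\<^sup>+h. h \<partial>exp_time r) = (\<integral>\<^sup>+h. ennreal (exponential_density r h * h ^ 1) \<partial>lborel)"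
    using assms by (subst nn_integral_exp_time)
      (auto simp: exponential_density_def ennreal_mult' intro!: nn_integral_cong)
  also have "\<dots> = ennreal (1 / r)"
    using nn_integral_erlang_ith_moment[OF assms, of 0 1] by simp
  finally show ?thesis .
qed

text \<open>Infinity needs its own case because \<open>enn2real\<close> sends it to 0. The value 0
  is taken only there, so almost sure infinity of a time amounts to a vanishing integral.\<close>

definition laplace :: "real \<Rightarrow> ennreal \<Rightarrow> ennreal" where
  "laplace a h = (if h = \<infinity> then 0 else ennreal (exp (- a * enn2real h)))"

lemma measurable_laplace [measurable]: "laplace a \<in> borel_measurable borel"
  unfolding laplace_def by measurable

lemma laplace_0 [simp]: "laplace a 0 = 1"
  by (simp add: laplace_def)

lemma laplace_add: "laplace a (u + h) = laplace a u * laplace a h"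
proof (cases u; cases h)
  fix r s assume "u = ennreal r" "h = ennreal s" "0 \<le> r" "0 \<le> s"
  then show ?thesis
    by (simp add: laplace_def ennreal_plus[symmetric] exp_add[symmetric]
        ennreal_mult[symmetric] algebra_simps del: ennreal_plus)
qed (auto simp: laplace_def)

text \<open>Exponential tilting: the discount at rate \<open>a\<close> times the density of rate
  \<open>r\<close> is \<open>r / (a + r)\<close> times the density of rate \<open>a + r\<close>. For
  \<open>r = 0\<close> both sides are 0.\<close>

lemma nn_integral_exp_time_laplace:
  assumes a: "0 < a" and r: "0 \<le> r"
  shows "(\<integral>\<^sup>+h. laplace a h \<partial>exp_time r) = ennreal (r / (a + r))"
proof (cases "r = 0")
  case True then show ?thesis by (simp add: nn_integral_exp_time_0 laplace_def)
next
  case False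
  with r have r: "0 < r" by simp
  have "(\<integral>\<^sup>+h. laplace a h \<partial>exp_time r) =
      (\<integral>\<^sup>+h. ennreal (r / (a + r)) * ennreal (exponential_density (a + r) h) \<partial>lborel)"
  proof (subst nn_integral_exp_time[OF r], simp, intro nn_integral_cong)
    fix h :: real
    have "exp (- (h * r)) * exp (- (a * h)) = exp (- (h * (a + r)))"
      by (simp add: exp_add[symmetric] algebra_simps)
    then have "r * exp (- (h * r)) * exp (- (a * h)) = r / (a + r) * ((a + r) * exp (- (h * (a + r))))"
      using a r by (simp add: mult.assoc)
    then show "ennreal (exponential_density r h) * laplace a (ennreal h) =
        ennreal (r / (a + r)) * ennreal (exponential_density (a + r) h)"
      using a r by (simp add: exponential_density_def laplace_def ennreal_mult[symmetric])
  qed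
  also have "\<dots> = ennreal (r / (a + r)) * 1"
    using prob_space.emeasure_space_1[OF prob_space_exponential_density[of "a + r"]] a r
    by (subst nn_integral_cmult) (auto simp: emeasure_density)
  finally show ?thesis by simp
qed

text \<open>The integral runs over the whole line. The functions convolved below vanish at negative
  times, so this is the usual convolution on \<open>[0, t]\<close>, while commutativity and
  associativity become changes of variable without boundary terms.\<close>

definition conv :: "(real \<Rightarrow> ennreal) \<Rightarrow> (real \<Rightarrow> ennreal) \<Rightarrow> real \<Rightarrow> ennreal" where
  "conv f g t = (\<integral>\<^sup>+v. f v * g (t - v) \<partial>lborel)"

lemma measurable_conv [measurable]:
  assumes [measurable]: "f \<in> borel_measurable borel" "g \<in> borel_measurable borel"
  shows "conv f g \<in> borel_measurable borel"
  unfolding conv_def by measurable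

lemma conv_zero [simp]: "conv (\<lambda>v. 0) g t = 0" "conv f (\<lambda>v. 0) t = 0"
  by (simp_all add: conv_def)

lemma conv_commute:
  assumes [measurable]: "f \<in> borel_measurable borel" "g \<in> borel_measurable borel"
  shows "conv f g = conv g f"
proof
  fix t
  have "conv f g t = ennreal \<bar>-1\<bar> * (\<integral>\<^sup>+v. f (t + (-1) * v) * g (t - (t + (-1) * v)) \<partial>lborel)"
    unfolding conv_def by (rule nn_integral_real_affine) auto
  then show "conv f g t = conv g f t" by (simp add: conv_def mult.commute)
qed

lemma conv_assoc:
  assumes [measurable]: "f \<in> borel_measurable borel" "g \<in> borel_measurable borel"
    "h \<in> borel_measurable borel"
  shows "conv (conv f g) h = conv f (conv g h)"
proof
  fix t
  have "conv (conv f g) h t = (\<integral>\<^sup>+u. (\<integral>\<^sup>+v. f v * g (u - v) * h (t - u) \<partial>lborel) \<partial>lborel)"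
    unfolding conv_def by (simp add: nn_integral_multc)
  also have "\<dots> = (\<integral>\<^sup>+v. (\<integral>\<^sup>+u. f v * g (u - v) * h (t - u) \<partial>lborel) \<partial>lborel)"
    by (rule lborel_pair.Fubini') measurable
  also have "\<dots> = (\<integral>\<^sup>+v. f v * (\<integral>\<^sup>+u. g u * h (t - v - u) \<partial>lborel) \<partial>lborel)"
  proof (rule nn_integral_cong)
    fix v
    have "(\<integral>\<^sup>+u. f v * g (u - v) * h (t - u) \<partial>lborel) =
      ennreal \<bar>1\<bar> * (\<integral>\<^sup>+u. f v * g (v + 1 * u - v) * h (t - (v + 1 * u)) \<partial>lborel)"
      by (rule nn_integral_real_affine) auto
    also have "\<dots> = f v * (\<integral>\<^sup>+u. g u * h (t - v - u) \<partial>lborel)"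
      by (simp add: nn_integral_cmult[symmetric] mult.assoc diff_diff_eq)
    finally show "(\<integral>\<^sup>+u. f v * g (u - v) * h (t - u) \<partial>lborel) =
      f v * (\<integral>\<^sup>+u. g u * h (t - v - u) \<partial>lborel)" .
  qed
  finally show "conv (conv f g) h t = conv f (conv g h) t" by (simp add: conv_def)
qed

lemma conv_cmult_left:
  "f \<in> borel_measurable borel \<Longrightarrow> g \<in> borel_measurable borel \<Longrightarrow>
    conv (\<lambda>v. c * f v) g t = c * conv f g t"
  unfolding conv_def by (simp add: mult.assoc nn_integral_cmult)

lemma conv_cmult_right:
  "f \<in> borel_measurable borel \<Longrightarrow> g \<in> borel_measurable borel \<Longrightarrow>
    conv f (\<lambda>v. c * g v) t = c * conv f g t"
  unfolding conv_def by (simp add: mult.left_commute nn_integral_cmult)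

lemma conv_sum_left:
  fixes f :: "'s::countable \<Rightarrow> real \<Rightarrow> ennreal"
  assumes [measurable]: "\<And>y. f y \<in> borel_measurable borel" "g \<in> borel_measurable borel"
  shows "conv (\<lambda>v. \<Sum>\<^sub>cy. f y v) g t =
    (\<Sum>\<^sub>cy. conv (f y) g t)"
  unfolding conv_def
  by (simp add: nn_integral_multc[symmetric] nn_integral_count_space_nn_integral)

lemma conv_sum_right:
  fixes g :: "'s::countable \<Rightarrow> real \<Rightarrow> ennreal"
  assumes [measurable]: "\<And>y. g y \<in> borel_measurable borel" "f \<in> borel_measurable borel"
  shows "conv f (\<lambda>v. \<Sum>\<^sub>cy. g y v) t =
    (\<Sum>\<^sub>cy. conv f (g y) t)"
  unfolding conv_def
  by (simp add: nn_integral_cmult[symmetric] nn_integral_count_space_nn_integral)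

lemma measurable_count_space_sum [measurable]:
  fixes f :: "'s::countable \<Rightarrow> 'b \<Rightarrow> ennreal"
  assumes [measurable]: "\<And>y. f y \<in> borel_measurable M"
  shows "(\<lambda>v. \<Sum>\<^sub>cy. f y v) \<in> borel_measurable M"
proof -
  interpret sigma_finite_measure "count_space (UNIV :: 's set)"
    by (rule sigma_finite_measure_count_space_countable) simp
  show ?thesis
  proof (rule borel_measurable_nn_integral)
    have "(\<lambda>(y, v). f y v) \<in> borel_measurable (count_space UNIV \<Otimes>\<^sub>M M)"
      by (rule measurable_pair_measure_countable1) auto
    from measurable_pair_swap[OF this]
    show "(\<lambda>(v, y). f y v) \<in> borel_measurable (M \<Otimes>\<^sub>M count_space UNIV)" by simp
  qed
qed

lemma nn_integral_count_space_commute: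
  fixes f :: "'s::countable \<Rightarrow> 'r::countable \<Rightarrow> ennreal"
  shows "(\<Sum>\<^sub>cx. \<Sum>\<^sub>cy. f x y) =
    (\<Sum>\<^sub>cy. \<Sum>\<^sub>cx. f x y)"
  by (rule nn_integral_count_space_nn_integral) auto

lemma nn_integral_count_space_single:
  fixes f :: "'s \<Rightarrow> ennreal"
  shows "(\<And>y. y \<noteq> x \<Longrightarrow> f y = 0) \<Longrightarrow> (\<Sum>\<^sub>cy. f y) = f x"
  by (subst nn_integral_count_space'[where A="{x}"]) auto

section \<open>The jump chain and its holding times\<close>


lemma all_le_Suc_shift: "(\<forall>i\<le>Suc m. p i) \<longleftrightarrow> p 0 \<and> (\<forall>i\<le>m. p (Suc i))"
  by (metis Suc_le_mono le0 not0_implies_Suc)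

text \<open>This is the clause of \<open>markov_process\<close> for one starting state. A process
  restarted at a later time lives under a conditioned measure outside the family \<open>Pr\<close>
  and still satisfies this clause.\<close>

definition jump_law ::
  "'s::countable set \<Rightarrow> ('s \<Rightarrow> 's \<Rightarrow> real) \<Rightarrow> 's \<Rightarrow> 'w measure \<Rightarrow>
   (nat \<Rightarrow> 'w \<Rightarrow> 's) \<Rightarrow> (nat \<Rightarrow> 'w \<Rightarrow> ennreal) \<Rightarrow> bool" where
  "jump_law S Q x P Y H \<longleftrightarrow>
     prob_space P \<and>
     (\<forall>i. Y i \<in> measurable P (count_space UNIV)) \<and>
     (\<forall>i. H i \<in> borel_measurable P) \<and>
     (\<forall>m s t. (\<forall>i\<le>m. s i \<in> S \<and> 0 \<le> t i) \<longrightarrow>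
        measure P {w \<in> space P. \<forall>i\<le>m. Y i w = s i \<and> ennreal (t i) < H i w} =
          of_bool (s 0 = x) * (\<Prod>i<m. jump_prob Q (s i) (s (Suc i))) *
          (\<Prod>i\<le>m. exp (- exit_rate Q (s i) * t i)))"

lemma markov_process_jump_law:
  "markov_process S Q Pr Y H \<Longrightarrow> x \<in> S \<Longrightarrow> jump_law S Q x (Pr x) Y H"
  unfolding markov_process_def jump_law_def by blast

locale conservative_generator =
  fixes S :: "'s::countable set" and Q :: "'s \<Rightarrow> 's \<Rightarrow> real"
  assumes Q_nonneg: "x \<in> S \<Longrightarrow> z \<noteq> x \<Longrightarrow> 0 \<le> Q x z"
    and Q_closed: "x \<in> S \<Longrightarrow> z \<notin> S \<Longrightarrow> Q x z = 0"
    and finite_row: "x \<in> S \<Longrightarrow> finite {z. Q x z \<noteq> 0}"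
    and Q_diag: "x \<in> S \<Longrightarrow> Q x x = - (\<Sum>z\<in>{z. Q x z \<noteq> 0} - {x}. Q x z)"
begin

abbreviation q :: "'s \<Rightarrow> real" where "q \<equiv> exit_rate Q"

abbreviation J :: "'s \<Rightarrow> 's \<Rightarrow> real" where "J \<equiv> jump_prob Q"

text \<open>Removing the diagonal and everything outside \<open>S\<close> lets sums run over the
  whole type, in \<open>ennreal\<close>, without summability conditions.\<close>

definition R :: "'s \<Rightarrow> 's \<Rightarrow> ennreal" where
  "R x z = (if x \<in> S \<and> z \<in> S \<and> z \<noteq> x then ennreal (Q x z) else 0)"

lemma q_eq: "x \<in> S \<Longrightarrow> q x = (\<Sum>z\<in>{z. Q x z \<noteq> 0} - {x}. Q x z)"
  unfolding exit_rate_def by (subst Q_diag) simp_all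

lemma q_nonneg: "x \<in> S \<Longrightarrow> 0 \<le> q x"
  unfolding q_eq by (rule sum_nonneg) (simp add: Q_nonneg)

lemma R_integral:
  assumes x: "x \<in> S" and f: "\<And>z. z \<in> S \<Longrightarrow> 0 \<le> f z"
  shows "(\<Sum>\<^sub>cz. R x z * ennreal (f z)) =
    ennreal (\<Sum>z\<in>{z. Q x z \<noteq> 0} - {x}. Q x z * f z)"
proof -
  let ?A = "{z. Q x z \<noteq> 0} - {x}"
  have "(\<Sum>\<^sub>cz. R x z * ennreal (f z)) = (\<Sum>z\<in>?A. R x z * ennreal (f z))"
    using finite_row[OF x] by (intro nn_integral_count_space') (auto simp: R_def)
  also have "\<dots> = (\<Sum>z\<in>?A. ennreal (Q x z * f z))"
    using x Q_closed[OF x] Q_nonneg[OF x] by (intro sum.cong) (auto simp: R_def ennreal_mult')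
  also have "\<dots> = ennreal (\<Sum>z\<in>?A. Q x z * f z)"
  proof (rule sum_ennreal)
    fix z assume z: "z \<in> ?A"
    then have "z \<in> S" using Q_closed[OF x] by blast
    then show "0 \<le> Q x z * f z" using z f Q_nonneg[OF x] by simp
  qed
  finally show ?thesis .
qed

lemma R_sum: "x \<in> S \<Longrightarrow> (\<Sum>\<^sub>cz. R x z) = ennreal (q x)"
  using R_integral[of x "\<lambda>_. 1"] by (simp add: q_eq)

lemma R_zero: "q x = 0 \<Longrightarrow> R x z = 0"
proof (cases "x \<in> S")
  case True
  assume "q x = 0"
  then have "R x z \<le> 0"
    using R_sum[OF True] nn_integral_ge_point[of z UNIV "R x"] by simp
  then show ?thesis by simp
qed (simp add: R_def)

lemma J_nonneg: "x \<in> S \<Longrightarrow> 0 \<le> J x z"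
  using q_nonneg Q_nonneg by (auto simp: jump_prob_def)

lemma J_R: "x \<in> S \<Longrightarrow> z \<in> S \<Longrightarrow> ennreal (q x) * ennreal (J x z) = R x z"
  using q_nonneg[of x] Q_nonneg[of x z] R_zero[of x z]
  by (auto simp: jump_prob_def R_def ennreal_mult[symmetric])

lemma J_sum:
  assumes x: "x \<in> S"
  shows "(\<Sum>\<^sub>cz. ennreal (J x z) * indicator S z) = 1"
proof (cases "q x = 0")
  case True
  have "(\<Sum>\<^sub>cz. ennreal (J x z) * indicator S z) = ennreal (J x x) * indicator S x"
    by (rule nn_integral_count_space_single) (simp add: jump_prob_def True)
  then show ?thesis using x True by (simp add: jump_prob_def)
next
  case False
  then have q: "0 < q x" using q_nonneg[OF x] by simp
  have "(\<Sum>\<^sub>cz. ennreal (J x z) * indicator S z) =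
      (\<Sum>\<^sub>cz. ennreal (1 / q x) * R x z)"
    using x q Q_nonneg[OF x]
    by (intro nn_integral_cong)
      (auto simp: R_def jump_prob_def ennreal_mult[symmetric] split: split_indicator)
  also have "\<dots> = ennreal (1 / q x) * ennreal (q x)"
    by (subst nn_integral_cmult) (auto simp: R_sum[OF x])
  finally show ?thesis using q by (simp add: ennreal_mult[symmetric])
qed

definition path_weight :: "nat \<Rightarrow> (nat \<Rightarrow> 's) \<Rightarrow> (nat \<Rightarrow> real) \<Rightarrow> real" where
  "path_weight m s t =
     (\<Prod>i<m. J (s i) (s (Suc i))) * (\<Prod>i\<le>m. exp (- q (s i) * t i))"

lemma path_weight_nonneg: "(\<And>i. i \<le> m \<Longrightarrow> s i \<in> S) \<Longrightarrow> 0 \<le> path_weight m s t"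
  unfolding path_weight_def by (auto intro!: mult_nonneg_nonneg prod_nonneg J_nonneg)

lemma path_weight_Cons:
  "path_weight (Suc m) (case_nat y s) (case_nat h t) =
     exp (- q y * h) * (J y (s 0) * path_weight m s t)"
  unfolding path_weight_def prod.atMost_Suc_shift prod.lessThan_Suc_shift by simp

lemma path_weight_0: "path_weight 0 s t = exp (- q (s 0) * t 0)"
  by (simp add: path_weight_def)

end

locale jump_process = conservative_generator S Q
  for S :: "'s::countable set" and Q +
  fixes x :: 's and P :: "'w measure" and Y :: "nat \<Rightarrow> 'w \<Rightarrow> 's" and H :: "nat \<Rightarrow> 'w \<Rightarrow> ennreal"
  assumes start: "x \<in> S" and law: "jump_law S Q x P Y H"
begin

sublocale prob_space P
  using law by (simp add: jump_law_def)

lemma measurable_Y [measurable]: "Y i \<in> measurable P (count_space UNIV)"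
  using law by (simp add: jump_law_def)

lemma measurable_H [measurable]: "H i \<in> borel_measurable P"
  using law by (simp add: jump_law_def)

abbreviation trajectory :: "nat \<Rightarrow> nat \<Rightarrow> (nat \<Rightarrow> 's) \<Rightarrow> (nat \<Rightarrow> real) \<Rightarrow> 'w \<Rightarrow> bool" where
  "trajectory N m s t w \<equiv> \<forall>i\<le>m. Y (N + i) w = s i \<and> ennreal (t i) < H (N + i) w"

lemma emeasure_path:
  assumes "\<And>i. i \<le> m \<Longrightarrow> s i \<in> S" "\<And>i. i \<le> m \<Longrightarrow> 0 \<le> t i"
  shows "emeasure P {w\<in>space P. \<forall>i\<le>m. Y i w = s i \<and> ennreal (t i) < H i w} =
    of_bool (s 0 = x) * ennreal (path_weight m s t)"
proof -
  have "measure P {w\<in>space P. \<forall>i\<le>m. Y i w = s i \<and> ennreal (t i) < H i w} =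
      of_bool (s 0 = x) * path_weight m s t"
    using law assms unfolding jump_law_def path_weight_def by (simp add: mult.assoc)
  then show ?thesis
    by (subst emeasure_eq_measure) simp
qed

lemma emeasure_split_state:
  fixes F :: "'w \<Rightarrow> bool" and f :: "'w \<Rightarrow> 's"
  assumes [measurable]: "Measurable.pred P F" "f \<in> measurable P (count_space UNIV)"
  shows "emeasure P {w\<in>space P. F w \<and> f w \<in> S} =
    (\<Sum>\<^sub>cz. emeasure P {w\<in>space P. f w = z \<and> F w} * indicator S z)"
proof -
  have "emeasure P {w\<in>space P. F w \<and> f w \<in> S} =
      emeasure P (\<Union>z\<in>S. {w\<in>space P. f w = z \<and> F w})"
    by (intro arg_cong2[where f=emeasure]) auto
  also have "\<dots> = (\<integral>\<^sup>+z. emeasure P {w\<in>space P. f w = z \<and> F w} \<partial>count_space S)"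
    by (rule emeasure_UN_countable) (auto simp: disjoint_family_on_def)
  finally show ?thesis
    by (simp add: nn_integral_count_space_indicator)
qed

text \<open>The law describes paths inside \<open>S\<close> with holding times above given
  thresholds. With all thresholds 0, these events already carry total mass 1, so every other
  behaviour is null.\<close>

lemma AE_regular: "AE w in P. Y 0 w = x \<and> (\<forall>i. Y i w \<in> S \<and> 0 < H i w)"
proof -
  \<comment> \<open>The prefix length \<open>k\<close> and the prefix \<open>s\<close> vary in the
    induction on \<open>d\<close>: summing over the state at index \<open>k + 1\<close> lengthens
    the prefix by one and shortens the free part by one.\<close>
  have *: "emeasure P {w\<in>space P. (\<forall>i\<le>k. Y i w = s i \<and> 0 < H i w) \<and>
      (\<forall>i. k < i \<and> i \<le> k + d \<longrightarrow> Y i w \<in> S \<and> 0 < H i w)} =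
      of_bool (s 0 = x) * ennreal (\<Prod>i<k. J (s i) (s (Suc i)))"
    if "\<And>i. i \<le> k \<Longrightarrow> s i \<in> S" for k d s
    using that
  proof (induction d arbitrary: k s)
    case 0
    have "{w\<in>space P. (\<forall>i\<le>k. Y i w = s i \<and> 0 < H i w) \<and>
        (\<forall>i. k < i \<and> i \<le> k + 0 \<longrightarrow> Y i w \<in> S \<and> 0 < H i w)} =
        {w\<in>space P. \<forall>i\<le>k. Y i w = s i \<and> ennreal ((\<lambda>_. 0) i) < H i w}"
      by auto
    then show ?case
      using emeasure_path[of k s "\<lambda>_. 0"] 0 by (simp add: path_weight_def)
  next
    case (Suc d)
    let ?F = "\<lambda>w. (\<forall>i\<le>k. Y i w = s i \<and> 0 < H i w) \<and> 0 < H (Suc k) w \<and>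
        (\<forall>i. Suc k < i \<and> i \<le> Suc k + d \<longrightarrow> Y i w \<in> S \<and> 0 < H i w)"
    have split: "(\<forall>i. k < i \<and> i \<le> k + Suc d \<longrightarrow> G i) \<longleftrightarrow>
        G (Suc k) \<and> (\<forall>i. Suc k < i \<and> i \<le> Suc k + d \<longrightarrow> G i)" (is "?A \<longleftrightarrow> ?B") for G
    proof
      show "?A \<Longrightarrow> ?B" by simp
      assume B: ?B
      show ?A
      proof (intro allI impI)
        fix i assume "k < i \<and> i \<le> k + Suc d"
        then show "G i" using B by (cases "i = Suc k") auto
      qed
    qed
    have "{w\<in>space P. (\<forall>i\<le>k. Y i w = s i \<and> 0 < H i w) \<and>
        (\<forall>i. k < i \<and> i \<le> k + Suc d \<longrightarrow> Y i w \<in> S \<and> 0 < H i w)} =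
        {w\<in>space P. ?F w \<and> Y (Suc k) w \<in> S}"
      unfolding split by auto
    then have "emeasure P {w\<in>space P. (\<forall>i\<le>k. Y i w = s i \<and> 0 < H i w) \<and>
        (\<forall>i. k < i \<and> i \<le> k + Suc d \<longrightarrow> Y i w \<in> S \<and> 0 < H i w)} =
      (\<Sum>\<^sub>cz. emeasure P {w\<in>space P. Y (Suc k) w = z \<and> ?F w} * indicator S z)"
      by (simp only:) (rule emeasure_split_state; measurable)
    also have "\<dots> = (\<Sum>\<^sub>cz. (of_bool (s 0 = x) * ennreal (\<Prod>i<k. J (s i) (s (Suc i)))) *
        (ennreal (J (s k) z) * indicator S z))"
    proof (rule nn_integral_cong)
      fix z
      let ?s = "s(Suc k := z)"
      have set: "{w\<in>space P. Y (Suc k) w = z \<and> ?F w} =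
        {w\<in>space P. (\<forall>i\<le>Suc k. Y i w = ?s i \<and> 0 < H i w) \<and>
          (\<forall>i. Suc k < i \<and> i \<le> Suc k + d \<longrightarrow> Y i w \<in> S \<and> 0 < H i w)}"
        by (auto simp: le_Suc_eq)
      show "emeasure P {w\<in>space P. Y (Suc k) w = z \<and> ?F w} * indicator S z =
        (of_bool (s 0 = x) * ennreal (\<Prod>i<k. J (s i) (s (Suc i)))) *
        (ennreal (J (s k) z) * indicator S z)"
      proof (cases "z \<in> S")
        case True
        have "emeasure P {w\<in>space P. Y (Suc k) w = z \<and> ?F w} =
          of_bool (?s 0 = x) * ennreal (\<Prod>i<Suc k. J (?s i) (?s (Suc i)))"
          unfolding set using Suc.prems True by (intro Suc.IH) auto
        also have "(\<Prod>i<Suc k. J (?s i) (?s (Suc i))) = (\<Prod>i<k. J (s i) (s (Suc i))) * J (s k) z"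
          by (auto intro!: prod.cong)
        also have "ennreal \<dots> = ennreal (\<Prod>i<k. J (s i) (s (Suc i))) * ennreal (J (s k) z)"
          using Suc.prems by (intro ennreal_mult prod_nonneg J_nonneg) auto
        finally show ?thesis using True by (simp add: mult.assoc)
      qed simp
    qed
    also have "\<dots> = of_bool (s 0 = x) * ennreal (\<Prod>i<k. J (s i) (s (Suc i)))"
      using Suc.prems[of k] by (subst nn_integral_cmult) (auto simp: J_sum)
    finally show ?case .
  qed
  have "AE w in P. Y 0 w = x \<and> 0 < H 0 w \<and> (\<forall>i. 0 < i \<and> i \<le> d \<longrightarrow> Y i w \<in> S \<and> 0 < H i w)" for d
  proof -
    have "emeasure P {w\<in>space P. Y 0 w = x \<and> 0 < H 0 w \<and>
        (\<forall>i. 0 < i \<and> i \<le> d \<longrightarrow> Y i w \<in> S \<and> 0 < H i w)} = 1"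
      using *[of 0 "\<lambda>_. x" d] start by simp
    from AE_prob_1[OF measure_eq_emeasure_eq_ennreal[OF _ this[folded ennreal_1]]]
    show ?thesis by (auto elim: eventually_mono)
  qed
  then have "AE w in P. \<forall>d. Y 0 w = x \<and> 0 < H 0 w \<and> (\<forall>i. 0 < i \<and> i \<le> d \<longrightarrow> Y i w \<in> S \<and> 0 < H i w)"
    by (intro AE_all_countable[THEN iffD2] allI)
  then show ?thesis
  proof (rule eventually_mono)
    fix w
    assume *: "\<forall>d. Y 0 w = x \<and> 0 < H 0 w \<and> (\<forall>i. 0 < i \<and> i \<le> d \<longrightarrow> Y i w \<in> S \<and> 0 < H i w)"
    have "Y i w \<in> S \<and> 0 < H i w" for i
      using *[rule_format, of i] start by (cases "i = 0") auto
    with * show "Y 0 w = x \<and> (\<forall>i. Y i w \<in> S \<and> 0 < H i w)" by blast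
  qed
qed

lemma nn_integral_split_state:
  assumes [measurable]: "f \<in> borel_measurable P"
  shows "(\<integral>\<^sup>+w. f w \<partial>P) =
    (\<Sum>\<^sub>cy. indicator S y * (\<integral>\<^sup>+w. indicator {y} (Y N w) * f w \<partial>P))"
proof -
  have "(\<integral>\<^sup>+w. f w \<partial>P) =
      (\<integral>\<^sup>+w. (\<Sum>\<^sub>cy. indicator S y * (indicator {y} (Y N w) * f w)) \<partial>P)"
  proof (rule nn_integral_cong_AE)
    show "AE w in P. f w = (\<Sum>\<^sub>cy. indicator S y * (indicator {y} (Y N w) * f w))"
      using AE_regular
    proof eventually_elim
      case (elim w)
      then show ?case by (subst nn_integral_count_space_single[of "Y N w"]) auto
    qed
  qed
  also have "\<dots> = (\<Sum>\<^sub>cy. \<integral>\<^sup>+w. indicator S y * (indicator {y} (Y N w) * f w) \<partial>P)"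
    by (rule nn_integral_count_space_nn_integral) auto
  finally show ?thesis by (simp add: nn_integral_cmult)
qed

end

text \<open>
  \<open>Z N\<close> is a functional of \<open>Y\<^sub>0, \<dots>, Y\<^sub>N\<close> and \<open>H\<^sub>0, \<dots>, H\<^sub>N\<^sub>-\<^sub>1\<close> given by a recursion; it will be the time
  of the \<open>N\<close>-th jump, or record whether a state has been revisited.
\<close>

locale past_functional = jump_process S Q x P Y H
  for S :: "'s::countable set" and Q x and P :: "'w measure" and Y H +
  fixes K :: "'z measure" and Z :: "nat \<Rightarrow> 'w \<Rightarrow> 'z" and z0 :: 'z
    and \<phi> :: "'s \<Rightarrow> 's \<Rightarrow> 'z \<times> ennreal \<Rightarrow> 'z"
  assumes z0: "z0 \<in> space K"
    and measurable_step: "\<And>y y'. \<phi> y y' \<in> measurable (K \<Otimes>\<^sub>M borel) K"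
    and Z_0: "Z 0 = (\<lambda>w. z0)"
    and Z_Suc: "\<And>N. Z (Suc N) = (\<lambda>w. \<phi> (Y N w) (Y (Suc N) w) (Z N w, H N w))"
begin

lemma measurable_Z [measurable]: "Z N \<in> measurable P K"
proof (induction N)
  case 0 then show ?case by (simp add: Z_0 z0)
next
  case (Suc N)
  note Suc [measurable] measurable_step [measurable]
  have "(\<lambda>w. \<phi> y y' (Z N w, H N w)) \<in> measurable P K" for y y'
    by measurable
  then have "(\<lambda>w. \<phi> y (Y (Suc N) w) (Z N w, H N w)) \<in> measurable P K" for y
    by (rule measurable_compose_countable[where g="Y (Suc N)"]) measurable
  then show ?case unfolding Z_Suc
    by (rule measurable_compose_countable[where g="Y N"]) measurable
qed

text \<open>The law of \<open>Z N\<close> on the event \<open>Y N = y\<close>. It is left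
  unnormalised, which avoids dividing by a probability that may be 0.\<close>

definition \<nu> :: "nat \<Rightarrow> 's \<Rightarrow> 'z measure" where
  "\<nu> N y = distr (density P (\<lambda>w. indicator {y} (Y N w))) K (Z N)"

lemma sets_\<nu> [simp, measurable_cong]: "sets (\<nu> N y) = sets K"
  by (simp add: \<nu>_def)

lemma space_\<nu> [simp]: "space (\<nu> N y) = space K"
  by (simp add: \<nu>_def)

lemma nn_integral_\<nu>:
  assumes [measurable]: "f \<in> borel_measurable K"
  shows "(\<integral>\<^sup>+u. f u \<partial>\<nu> N y) = (\<integral>\<^sup>+w. indicator {y} (Y N w) * f (Z N w) \<partial>P)"
  unfolding \<nu>_def by (simp add: nn_integral_distr nn_integral_density)

lemma emeasure_\<nu>:
  assumes B [measurable]: "B \<in> sets K"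
  shows "emeasure (\<nu> N y) B = emeasure P {w\<in>space P. Y N w = y \<and> Z N w \<in> B}"
proof -
  have "emeasure (\<nu> N y) B = (\<integral>\<^sup>+u. indicator B u \<partial>\<nu> N y)" by simp
  also have "\<dots> = (\<integral>\<^sup>+w. indicator {w\<in>space P. Y N w = y \<and> Z N w \<in> B} w \<partial>P)"
    unfolding nn_integral_\<nu>[OF borel_measurable_indicator[OF B]]
    by (intro nn_integral_cong) (auto split: split_indicator)
  finally show ?thesis by simp
qed

lemma finite_\<nu>: "finite_measure (\<nu> N y)"
  by (rule finite_measureI) (simp add: emeasure_\<nu>[OF sets.top, simplified])

text \<open>Given \<open>Y N = y\<close>, the event \<open>F\<close> has probability \<open>c\<close> and is independent of \<open>Z N\<close> and \<open>H N\<close>.\<close>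

definition factorizes :: "nat \<Rightarrow> 's \<Rightarrow> ennreal \<Rightarrow> ('w \<Rightarrow> bool) \<Rightarrow> bool" where
  "factorizes N y c F \<longleftrightarrow> Measurable.pred P F \<and> y \<in> S \<and> c \<noteq> \<infinity> \<and>
    (\<forall>B\<in>sets K. \<forall>h\<ge>0.
      emeasure P {w\<in>space P. Y N w = y \<and> Z N w \<in> B \<and> ennreal h < H N w \<and> F w} =
      emeasure (\<nu> N y) B * (ennreal (exp (- q y * h)) * c))"

text \<open>\<open>factorizes\<close> prescribes the law of \<open>(Z N, H N)\<close> only on
  rectangles whose second side is a half-line. The tail criterion for product measures extends this
  to all measurable sets, after which past and holding time can be integrated separately.\<close>

lemma joint_law:
  assumes factor: "factorizes N y c F"
  shows "distr (density P (indicator {w\<in>space P. Y N w = y \<and> F w})) (K \<Otimes>\<^sub>M borel)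
    (\<lambda>w. (Z N w, H N w)) = scale_measure c (\<nu> N y \<Otimes>\<^sub>M exp_time (q y))" (is "?D = _")
proof -
  have [measurable]: "Measurable.pred P F" and y: "y \<in> S" and c: "c \<noteq> \<infinity>"
    and rect: "\<And>B h. B \<in> sets K \<Longrightarrow> 0 \<le> h \<Longrightarrow>
      emeasure P {w\<in>space P. Y N w = y \<and> Z N w \<in> B \<and> ennreal h < H N w \<and> F w} =
      emeasure (\<nu> N y) B * (ennreal (exp (- q y * h)) * c)"
    using factor by (auto simp: factorizes_def)
  let ?S = "scale_measure c (\<nu> N y)"
  have D: "emeasure ?D C = emeasure P {w\<in>space P. Y N w = y \<and> (Z N w, H N w) \<in> C \<and> F w}"
    if [measurable]: "C \<in> sets (K \<Otimes>\<^sub>M borel)" for C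
  proof -
    have "emeasure ?D C = (\<integral>\<^sup>+p. indicator C p \<partial>?D)" by simp
    also have "\<dots> = (\<integral>\<^sup>+w. indicator {w\<in>space P. Y N w = y \<and> F w} w * indicator C (Z N w, H N w) \<partial>P)"
      by (simp add: nn_integral_distr nn_integral_density del: nn_integral_indicator)
    also have "\<dots> = (\<integral>\<^sup>+w. indicator {w\<in>space P. Y N w = y \<and> (Z N w, H N w) \<in> C \<and> F w} w \<partial>P)"
      by (intro nn_integral_cong) (auto split: split_indicator)
    finally show ?thesis by simp
  qed
  interpret E: prob_space "exp_time (q y)" by (rule prob_space_exp_time[OF q_nonneg[OF y]])
  interpret \<nu>: finite_measure "\<nu> N y" by (rule finite_\<nu>)
  have "?D = ?S \<Otimes>\<^sub>M exp_time (q y)"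
  proof (rule pair_measure_eqI_tail)
    show "finite_measure ?S"
      using c by (intro finite_measureI) (simp add: ennreal_mult_eq_top_iff)
    show "finite_measure (exp_time (q y))" by unfold_locales
    have "emeasure ?D (space ?D) \<noteq> \<infinity>"
      using D[OF sets.top] by simp
    then show "finite_measure ?D" by (rule finite_measureI)
    show "sets ?D = sets (?S \<Otimes>\<^sub>M borel)"
      by (simp cong: sets_pair_measure_cong)
    fix A assume "A \<in> sets ?S"
    then have A [measurable]: "A \<in> sets K" by simp
    \<comment> \<open>The rectangle with full second side is the one with threshold 0, since holding
      times are almost surely positive.\<close>
    have pos: "AE w in P. \<forall>i. 0 < H i w" using AE_regular by (auto elim: eventually_mono)
    have "emeasure ?D (A \<times> UNIV) = emeasure P {w\<in>space P. Y N w = y \<and> Z N w \<in> A \<and> ennreal 0 < H N w \<and> F w}"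
      using pos by (subst D) (auto intro!: emeasure_eq_AE elim!: eventually_mono)
    then show "emeasure ?D (A \<times> UNIV) = emeasure ?S A * emeasure (exp_time (q y)) UNIV"
      using rect[OF A, of 0] E.emeasure_space_1 by (simp add: mult.commute)
    fix t :: real assume t: "0 \<le> t"
    have "emeasure ?D (A \<times> {ennreal t<..}) =
        emeasure P {w\<in>space P. Y N w = y \<and> Z N w \<in> A \<and> ennreal t < H N w \<and> F w}"
      by (subst D) (auto intro!: arg_cong2[where f=emeasure])
    then show "emeasure ?D (A \<times> {ennreal t<..}) = emeasure ?S A * emeasure (exp_time (q y)) {ennreal t<..}"
      using rect[OF A t] emeasure_exp_time_tail[OF q_nonneg[OF y] t] by (simp add: ac_simps)
  qed simp
  moreover have "?S \<Otimes>\<^sub>M exp_time (q y) = scale_measure c (\<nu> N y \<Otimes>\<^sub>M exp_time (q y))"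
  proof (rule measure_eqI)
    fix C assume "C \<in> sets (?S \<Otimes>\<^sub>M exp_time (q y))"
    then have "C \<in> sets (K \<Otimes>\<^sub>M borel)" by (simp cong: sets_pair_measure_cong)
    then show "emeasure (?S \<Otimes>\<^sub>M exp_time (q y)) C =
        emeasure (scale_measure c (\<nu> N y \<Otimes>\<^sub>M exp_time (q y))) C"
      unfolding emeasure_scale_measure by (subst (1 2) E.emeasure_pair_measure_alt)
        (auto simp: nn_integral_scale_measure cong: sets_pair_measure_cong measurable_cong_sets)
  qed (simp cong: sets_pair_measure_cong)
  ultimately show ?thesis by simp
qed

lemma nn_integral_step:
  assumes factor: "factorizes N y c F"
    and f [measurable]: "f \<in> borel_measurable (K \<Otimes>\<^sub>M borel)"
  shows "(\<integral>\<^sup>+w. indicator {w\<in>space P. Y N w = y \<and> F w} w * f (Z N w, H N w) \<partial>P) =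
    c * (\<integral>\<^sup>+u. \<integral>\<^sup>+h. f (u, h) \<partial>exp_time (q y) \<partial>\<nu> N y)"
proof -
  have [measurable]: "Measurable.pred P F" and y: "y \<in> S"
    using factor by (auto simp: factorizes_def)
  interpret E: prob_space "exp_time (q y)" by (rule prob_space_exp_time[OF q_nonneg[OF y]])
  have f': "f \<in> borel_measurable (\<nu> N y \<Otimes>\<^sub>M exp_time (q y))"
    using f by (simp cong: measurable_cong_sets sets_pair_measure_cong)
  have "(\<integral>\<^sup>+w. indicator {w\<in>space P. Y N w = y \<and> F w} w * f (Z N w, H N w) \<partial>P) =
      (\<integral>\<^sup>+p. f p \<partial>scale_measure c (\<nu> N y \<Otimes>\<^sub>M exp_time (q y)))"
    unfolding joint_law[OF factor, symmetric] by (simp add: nn_integral_distr nn_integral_density)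
  then show ?thesis
    using f' by (simp add: nn_integral_scale_measure E.nn_integral_fst[symmetric])
qed

lemma emeasure_step:
  assumes factor: "factorizes N y c F"
    and C [measurable]: "C \<in> sets (K \<Otimes>\<^sub>M borel)"
  shows "emeasure P {w\<in>space P. Y N w = y \<and> (Z N w, H N w) \<in> C \<and> F w} =
    c * emeasure (\<nu> N y \<Otimes>\<^sub>M exp_time (q y)) C"
proof -
  have [measurable]: "Measurable.pred P F" and y: "y \<in> S"
    using factor by (auto simp: factorizes_def)
  have "emeasure P {w\<in>space P. Y N w = y \<and> (Z N w, H N w) \<in> C \<and> F w} =
      (\<integral>\<^sup>+w. indicator {w\<in>space P. Y N w = y \<and> (Z N w, H N w) \<in> C \<and> F w} w \<partial>P)" by simp
  also have "\<dots> = (\<integral>\<^sup>+w. indicator {w\<in>space P. Y N w = y \<and> F w} w * indicator C (Z N w, H N w) \<partial>P)"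
    by (intro nn_integral_cong) (auto split: split_indicator)
  also have "\<dots> = c * (\<integral>\<^sup>+u. \<integral>\<^sup>+h. indicator C (u, h) \<partial>exp_time (q y) \<partial>\<nu> N y)"
    by (rule nn_integral_step[OF factor]) (use C in simp_all)
  also have "(\<integral>\<^sup>+u. \<integral>\<^sup>+h. indicator C (u, h) \<partial>exp_time (q y) \<partial>\<nu> N y) =
      emeasure (\<nu> N y \<Otimes>\<^sub>M exp_time (q y)) C"
    using C by (intro prob_space_exp_time[OF q_nonneg[OF y], THEN prob_space_imp_sigma_finite,
      THEN sigma_finite_measure.emeasure_pair_measure, symmetric]) (simp cong: sets_pair_measure_cong)
  finally show ?thesis .
qed

text \<open>The premise \<open>pf\<close> is the assertion of \<open>past_future\<close> at
  \<open>N\<close>. Stated in this conditional form, the lemma serves inside the induction that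
  proves \<open>past_future\<close> and again afterwards. The current state and its holding time are
  prepended to the future path.\<close>

lemma factorizes_future_aux:
  assumes pf: "\<And>B m s t. B \<in> sets K \<Longrightarrow> (\<And>i. i \<le> m \<Longrightarrow> s i \<in> S) \<Longrightarrow> (\<And>i. i \<le> m \<Longrightarrow> 0 \<le> t i) \<Longrightarrow>
      emeasure P {w\<in>space P. Z N w \<in> B \<and> trajectory N m s t w} =
      emeasure (\<nu> N (s 0)) B * ennreal (path_weight m s t)"
    and y: "y \<in> S" and s: "\<And>i. i \<le> m \<Longrightarrow> s i \<in> S" and t: "\<And>i. i \<le> m \<Longrightarrow> 0 \<le> t i"
  shows "factorizes N y (ennreal (J y (s 0) * path_weight m s t)) (trajectory (Suc N) m s t)"
  unfolding factorizes_def
proof (intro conjI ballI allI impI)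
  fix B and h :: real assume B: "B \<in> sets K" and h: "0 \<le> h"
  have "{w\<in>space P. Y N w = y \<and> Z N w \<in> B \<and> ennreal h < H N w \<and> trajectory (Suc N) m s t w} =
    {w\<in>space P. Z N w \<in> B \<and> trajectory N (Suc m) (case_nat y s) (case_nat h t) w}"
    unfolding all_le_Suc_shift by auto
  also have "emeasure P \<dots> = emeasure (\<nu> N (case_nat y s 0)) B *
     ennreal (path_weight (Suc m) (case_nat y s) (case_nat h t))"
    using B h y s t by (intro pf) (auto split: nat.split)
  also have "\<dots> = emeasure (\<nu> N y) B *
     (ennreal (exp (- q y * h)) * ennreal (J y (s 0) * path_weight m s t))"
    using y s path_weight_nonneg[of m s t] J_nonneg
    by (simp add: path_weight_Cons ennreal_mult)
  finally show "emeasure P {w\<in>space P. Y N w = y \<and> Z N w \<in> B \<and> ennreal h < H N w \<and>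
      trajectory (Suc N) m s t w} = \<dots>" .
qed (use y in simp_all)

text \<open>\<open>Z (Suc N)\<close> is a function of two successive states and of
  \<open>(Z N, H N)\<close>, whose law jointly with the future is known from the induction
  hypothesis. Summing over the state at \<open>N\<close> leaves a factor \<open>?G (s 0)\<close>
  that depends on the future path through \<open>s 0\<close> only.\<close>

lemma past_future:
  assumes "B \<in> sets K" "\<And>i. i \<le> m \<Longrightarrow> s i \<in> S" "\<And>i. i \<le> m \<Longrightarrow> 0 \<le> t i"
  shows "emeasure P {w\<in>space P. Z N w \<in> B \<and> trajectory N m s t w} =
    emeasure (\<nu> N (s 0)) B * ennreal (path_weight m s t)"
  using assms
proof (induction N arbitrary: B m s t)
  case 0
  have Y0: "AE w in P. Y 0 w = x" using AE_regular by (auto elim: eventually_mono)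
  have "emeasure (\<nu> 0 (s 0)) B = emeasure P {w\<in>space P. s 0 = x \<and> z0 \<in> B}"
    using Y0 0(1) by (auto simp: emeasure_\<nu> Z_0 intro!: emeasure_eq_AE elim!: eventually_mono)
  also have "\<dots> = of_bool (s 0 = x) * of_bool (z0 \<in> B)"
    by (auto simp: emeasure_space_1)
  finally have *: "emeasure (\<nu> 0 (s 0)) B = of_bool (s 0 = x) * of_bool (z0 \<in> B)" .
  show ?case
  proof (cases "z0 \<in> B")
    case True
    then show ?thesis
      using emeasure_path[of m s t] 0(2,3) by (simp add: Z_0 *)
  qed (simp add: Z_0 *)
next
  case (Suc N)
  note [measurable] = Suc.prems(1)
  have step [measurable]: "\<phi> y y' \<in> measurable (K \<Otimes>\<^sub>M borel) K" for y y' by (rule measurable_step)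
  let ?G = "\<lambda>z. \<Sum>\<^sub>cy. ennreal (J y z) * emeasure (\<nu> N y \<Otimes>\<^sub>M exp_time (q y))
      (\<phi> y z -` B \<inter> space (K \<Otimes>\<^sub>M borel)) * indicator S y"
  have main: "emeasure P {w\<in>space P. Z (Suc N) w \<in> B \<and> trajectory (Suc N) m s t w} =
      ?G (s 0) * ennreal (path_weight m s t)"
    if s: "\<And>i. i \<le> m \<Longrightarrow> s i \<in> S" and t: "\<And>i. i \<le> m \<Longrightarrow> 0 \<le> t i" for m s t
  proof -
    let ?F = "trajectory (Suc N) m s t"
    have "emeasure P {w\<in>space P. Z (Suc N) w \<in> B \<and> ?F w} =
        emeasure P {w\<in>space P. (Z (Suc N) w \<in> B \<and> ?F w) \<and> Y N w \<in> S}"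
    proof (rule emeasure_eq_AE)
      show "AE w in P. w \<in> {w\<in>space P. Z (Suc N) w \<in> B \<and> ?F w} \<longleftrightarrow>
          w \<in> {w\<in>space P. (Z (Suc N) w \<in> B \<and> ?F w) \<and> Y N w \<in> S}"
        using AE_regular by (rule eventually_mono) blast
    qed measurable
    also have "\<dots> = (\<Sum>\<^sub>cy. emeasure P {w\<in>space P. Y N w = y \<and> (Z (Suc N) w \<in> B \<and> ?F w)} * indicator S y)"
      by (rule emeasure_split_state) measurable
    also have "\<dots> = (\<Sum>\<^sub>cy. (ennreal (J y (s 0)) * emeasure (\<nu> N y \<Otimes>\<^sub>M exp_time (q y))
      (\<phi> y (s 0) -` B \<inter> space (K \<Otimes>\<^sub>M borel)) * indicator S y) * ennreal (path_weight m s t))"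
    proof (rule nn_integral_cong)
      fix y
      show "emeasure P {w\<in>space P. Y N w = y \<and> (Z (Suc N) w \<in> B \<and> ?F w)} * indicator S y =
       (ennreal (J y (s 0)) * emeasure (\<nu> N y \<Otimes>\<^sub>M exp_time (q y))
      (\<phi> y (s 0) -` B \<inter> space (K \<Otimes>\<^sub>M borel)) * indicator S y) * ennreal (path_weight m s t)"
      proof (cases "y \<in> S")
        case True
        let ?C = "\<phi> y (s 0) -` B \<inter> space (K \<Otimes>\<^sub>M borel)"
        have "{w\<in>space P. Y N w = y \<and> (Z (Suc N) w \<in> B \<and> ?F w)} =
          {w\<in>space P. Y N w = y \<and> (Z N w, H N w) \<in> ?C \<and> ?F w}"
          using measurable_space[OF measurable_Z]
          by (auto simp: Z_Suc space_pair_measure)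
        also have "emeasure P \<dots> = ennreal (J y (s 0) * path_weight m s t) *
            emeasure (\<nu> N y \<Otimes>\<^sub>M exp_time (q y)) ?C"
          using True s t by (intro emeasure_step factorizes_future_aux Suc.IH measurable_sets[OF step Suc.prems(1)])
        finally show ?thesis
          using True s path_weight_nonneg[of m s t] J_nonneg
          by (simp add: ennreal_mult ac_simps)
      qed simp
    qed
    also have "\<dots> = ?G (s 0) * ennreal (path_weight m s t)"
      by (rule nn_integral_multc) simp
    finally show ?thesis .
  qed
  \<comment> \<open>A future of length 0 with threshold 0 has path weight 1, which identifies
    \<open>?G (s 0)\<close> as the mass of \<open>B\<close>.\<close>
  have "emeasure (\<nu> (Suc N) (s 0)) B = emeasure P {w\<in>space P. Z (Suc N) w \<in> B \<and>
       trajectory (Suc N) 0 s (\<lambda>_. 0) w}"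
    unfolding emeasure_\<nu>[OF Suc.prems(1)]
  proof (rule emeasure_eq_AE)
    show "AE w in P. w \<in> {w\<in>space P. Y (Suc N) w = s 0 \<and> Z (Suc N) w \<in> B} \<longleftrightarrow>
        w \<in> {w\<in>space P. Z (Suc N) w \<in> B \<and> trajectory (Suc N) 0 s (\<lambda>_. 0) w}"
      using AE_regular by (rule eventually_mono) auto
  qed measurable
  also have "\<dots> = ?G (s 0) * ennreal (path_weight 0 s (\<lambda>_. 0))"
    using Suc.prems(2) by (intro main) auto
  finally have "emeasure (\<nu> (Suc N) (s 0)) B = ?G (s 0)" by (simp add: path_weight_0)
  then show ?case using main[of m s t] Suc.prems by simp
qed

lemma factorizes_future:
  assumes "y \<in> S" "\<And>i. i \<le> m \<Longrightarrow> s i \<in> S" "\<And>i. i \<le> m \<Longrightarrow> 0 \<le> t i"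
  shows "factorizes N y (ennreal (J y (s 0) * path_weight m s t)) (trajectory (Suc N) m s t)"
  using assms by (intro factorizes_future_aux past_future)

lemma factorizes_trivial: "y \<in> S \<Longrightarrow> factorizes N y 1 (\<lambda>_. True)"
  unfolding factorizes_def
proof (intro conjI ballI allI impI)
  fix B and h :: real assume y: "y \<in> S" and B: "B \<in> sets K" and h: "0 \<le> h"
  have "{w\<in>space P. Y N w = y \<and> Z N w \<in> B \<and> ennreal h < H N w \<and> True} =
    {w\<in>space P. Z N w \<in> B \<and> trajectory N 0 (\<lambda>_. y) (\<lambda>_. h) w}"
    by auto
  then show "emeasure P {w\<in>space P. Y N w = y \<and> Z N w \<in> B \<and> ennreal h < H N w \<and> True} =
    emeasure (\<nu> N y) B * (ennreal (exp (- q y * h)) * 1)"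
    using past_future[of B 0 "\<lambda>_. y" "\<lambda>_. h" N] y B h by (simp add: path_weight_0)
qed simp_all

lemma factorizes_next:
  assumes y: "y \<in> S" and z: "z \<in> S"
  shows "factorizes N y (ennreal (J y z)) (\<lambda>w. Y (Suc N) w = z)"
  unfolding factorizes_def
proof (intro conjI ballI allI impI)
  fix B and h :: real assume B [measurable]: "B \<in> sets K" and h: "0 \<le> h"
  let ?F = "trajectory (Suc N) 0 (\<lambda>_. z) (\<lambda>_. 0)"
  have "emeasure P {w\<in>space P. Y N w = y \<and> Z N w \<in> B \<and> ennreal h < H N w \<and> Y (Suc N) w = z} =
    emeasure P {w\<in>space P. Y N w = y \<and> Z N w \<in> B \<and> ennreal h < H N w \<and> ?F w}"
  proof (rule emeasure_eq_AE)
    show "AE w in P. w \<in> {w\<in>space P. Y N w = y \<and> Z N w \<in> B \<and> ennreal h < H N w \<and> Y (Suc N) w = z} \<longleftrightarrow>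
       w \<in> {w\<in>space P. Y N w = y \<and> Z N w \<in> B \<and> ennreal h < H N w \<and> ?F w}"
      using AE_regular by (rule eventually_mono) auto
  qed measurable
  then show "emeasure P {w\<in>space P. Y N w = y \<and> Z N w \<in> B \<and> ennreal h < H N w \<and> Y (Suc N) w = z} =
    emeasure (\<nu> N y) B * (ennreal (exp (- q y * h)) * ennreal (J y z))"
    using factorizes_future[of y 0 "\<lambda>_. z" "\<lambda>_. 0" N] y z B h
    by (simp add: factorizes_def path_weight_0)
qed (use y in simp_all)

end

section \<open>Transition probabilities\<close>


definition jump_time :: "(nat \<Rightarrow> 'w \<Rightarrow> ennreal) \<Rightarrow> nat \<Rightarrow> 'w \<Rightarrow> ennreal" where
  "jump_time H N w = (\<Sum>i<N. H i w)"

lemma jump_time_0 [simp]: "jump_time H 0 w = 0"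
  by (simp add: jump_time_def)

lemma jump_time_Suc: "jump_time H (Suc N) w = jump_time H N w + H N w"
  by (simp add: jump_time_def)

lemma jump_time_mono: "M \<le> N \<Longrightarrow> jump_time H M w \<le> jump_time H N w"
  unfolding jump_time_def by (rule sum_mono2) auto

lemma explosion_time_SUP: "explosion_time H w = (SUP N. jump_time H N w)"
  by (simp add: explosion_time_def jump_time_def suminf_eq_SUP)

definition jump_index :: "(nat \<Rightarrow> 'w \<Rightarrow> ennreal) \<Rightarrow> real \<Rightarrow> 'w \<Rightarrow> nat" where
  "jump_index H t w = (LEAST m. ennreal t < jump_time H (Suc m) w)"

lemma jump_index_eq:
  assumes "jump_time H N w \<le> ennreal t" "ennreal t < jump_time H (Suc N) w"
  shows "jump_index H t w = N"
  unfolding jump_index_def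
proof (rule Least_equality)
  fix m assume m: "ennreal t < jump_time H (Suc m) w"
  show "N \<le> m"
  proof (rule ccontr)
    assume "\<not> N \<le> m"
    then have "jump_time H (Suc m) w \<le> jump_time H N w" by (intro jump_time_mono) auto
    with m assms(1) show False by simp
  qed
qed fact

text \<open>This trades the least index and the explosion test for the number \<open>N\<close> of
  jumps up to \<open>t\<close>. That number is unique, so events at time \<open>t\<close> split into
  disjoint pieces expressed by jump times.\<close>

lemma state_at_eq_Some_iff:
  "state_at Y H t w = Some z \<longleftrightarrow>
    (\<exists>N. jump_time H N w \<le> ennreal t \<and> ennreal t < jump_time H (Suc N) w \<and> Y N w = z)"
proof -
  let ?N = "LEAST m. ennreal t < jump_time H (Suc m) w"
  have expl: "ennreal t < explosion_time H w \<longleftrightarrow> (\<exists>m. ennreal t < jump_time H (Suc m) w)"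
  proof
    assume "ennreal t < explosion_time H w"
    then obtain m where "ennreal t < jump_time H m w"
      by (auto simp: explosion_time_SUP less_SUP_iff)
    then show "\<exists>m. ennreal t < jump_time H (Suc m) w"
      using jump_time_mono[of m "Suc m" H w] by (auto intro: less_le_trans)
  qed (auto simp: explosion_time_SUP less_SUP_iff)
  have st: "state_at Y H t w = (if ennreal t < explosion_time H w then Some (Y ?N w) else None)"
    by (simp add: state_at_def jump_time_def lessThan_Suc_atMost)
  have N: "?N = N" if "jump_time H N w \<le> ennreal t" "ennreal t < jump_time H (Suc N) w" for N
    using jump_index_eq[OF that] by (simp add: jump_index_def)
  have "jump_time H ?N w \<le> ennreal t \<and> ennreal t < jump_time H (Suc ?N) w"
    if "ennreal t < explosion_time H w"
  proof
    from that show "ennreal t < jump_time H (Suc ?N) w" unfolding expl by (rule LeastI_ex)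
    show "jump_time H ?N w \<le> ennreal t"
    proof (cases ?N)
      case (Suc n)
      then have "\<not> ennreal t < jump_time H (Suc n) w" by (intro not_less_Least) simp
      then show ?thesis using Suc by simp
    qed simp
  qed
  then show ?thesis unfolding st using expl N by auto
qed

lemma jump_time_interval_unique:
  assumes "jump_time H N w \<le> ennreal t" "ennreal t < jump_time H (Suc N) w"
    "jump_time H N' w \<le> ennreal t" "ennreal t < jump_time H (Suc N') w"
  shows "N = N'"
  using jump_index_eq[OF assms(1,2)] jump_index_eq[OF assms(3,4)] by simp

text \<open>The probability of no jump from \<open>u\<close> to \<open>v\<close> at exit rate \<open>r\<close>, as a function of both times.\<close>

definition hold :: "real \<Rightarrow> real \<Rightarrow> ennreal \<Rightarrow> ennreal" where
  "hold r v u = (if 0 \<le> v \<and> u \<le> ennreal v then ennreal (exp (- r * (v - enn2real u))) else 0)"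

lemma measurable_hold [measurable]:
  assumes [measurable]: "f \<in> borel_measurable M" "g \<in> borel_measurable M"
  shows "(\<lambda>w. hold r (f w) (g w)) \<in> borel_measurable M"
  unfolding hold_def by measurable

context conservative_generator
begin

text \<open>
  The probability to be in \<open>z\<close> at time \<open>t\<close> after exactly \<open>N\<close> jumps, decomposed at the last jump.
\<close>

primrec occ :: "nat \<Rightarrow> 's \<Rightarrow> 's \<Rightarrow> real \<Rightarrow> ennreal" where
  "occ 0 x z t = (if x = z then hold (q x) t 0 else 0)"
| "occ (Suc N) x z t = (\<Sum>\<^sub>cy. R y z * conv (occ N x y) (\<lambda>v. hold (q z) v 0) t)"

definition trans :: "real \<Rightarrow> 's \<Rightarrow> 's \<Rightarrow> ennreal" where
  "trans t x z = (\<Sum>N. occ N x z t)"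

lemma measurable_occ [measurable]: "occ N x z \<in> borel_measurable borel"
proof (induction N arbitrary: z)
  case 0 then show ?case
    by (cases "x = z") (simp_all cong: measurable_cong)
next
  case (Suc N)
  note Suc [measurable]
  have "(\<lambda>t. \<Sum>\<^sub>cy. R y z * conv (occ N x y) (\<lambda>v. hold (q z) v 0) t)
      \<in> borel_measurable borel"
    by measurable
  then show ?case by (simp cong: measurable_cong)
qed

text \<open>The last jump is split off by definition and the first one by the induction hypothesis.
  Associativity of \<open>conv\<close> regroups the factors, and the sums over the two intermediate
  states are exchanged.\<close>

lemma occ_first:
  "occ (Suc N) x z t = (\<Sum>\<^sub>cy. R x y * conv (\<lambda>v. hold (q x) v 0) (occ N y z) t)"
proof (induction N arbitrary: z t)
  case 0
  have z: "occ 0 x z = (\<lambda>v. (if x = z then 1 else 0) * hold (q x) v 0)" for x z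
    by auto
  have "occ (Suc 0) x z t = R x z * conv (\<lambda>v. hold (q x) v 0) (\<lambda>v. hold (q z) v 0) t"
    unfolding occ.simps(2)
    by (subst nn_integral_count_space_single[of x]) (auto simp del: occ.simps simp: z conv_cmult_left)
  moreover have "(\<Sum>\<^sub>cy. R x y * conv (\<lambda>v. hold (q x) v 0) (occ 0 y z) t) =
      R x z * conv (\<lambda>v. hold (q x) v 0) (\<lambda>v. hold (q z) v 0) t"
    by (subst nn_integral_count_space_single[of z]) (auto simp del: occ.simps simp: z conv_cmult_right)
  ultimately show ?case by (simp only:)
next
  case (Suc N)
  let ?h = "\<lambda>z v. hold (q z) v 0"
  have "occ (Suc (Suc N)) x z t =
      (\<Sum>\<^sub>cy. R y z * conv (\<lambda>v. \<Sum>\<^sub>cu. R x u * conv (?h x) (occ N u y) v) (?h z) t)"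
    unfolding occ.simps(2)[of "Suc N"] by (simp only: Suc.IH[abs_def])
  also have "\<dots> = (\<Sum>\<^sub>cy. \<Sum>\<^sub>cu. R x u * (R y z * conv (?h x) (conv (occ N u y) (?h z)) t))"
    by (simp add: conv_sum_left conv_cmult_left nn_integral_cmult[symmetric] conv_assoc mult.left_commute)
  also have "\<dots> = (\<Sum>\<^sub>cu. \<Sum>\<^sub>cy. R x u * (R y z * conv (?h x) (conv (occ N u y) (?h z)) t))"
    by (rule nn_integral_count_space_commute)
  also have "\<dots> = (\<Sum>\<^sub>cu. R x u * conv (?h x)
      (\<lambda>v. \<Sum>\<^sub>cy. R y z * conv (occ N u y) (?h z) v) t)"
    by (simp add: conv_sum_right conv_cmult_right nn_integral_cmult)
  also have "\<dots> = (\<Sum>\<^sub>cu. R x u * conv (?h x) (occ (Suc N) u z) t)"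
    by (simp only: occ.simps(2)[abs_def])
  finally show ?case .
qed

text \<open>The first-jump decomposition of one side is the last-jump decomposition of the other.\<close>

lemma occ_symmetric:
  assumes bal: "\<And>x z. w x * R x z = w z * R z x"
  shows "w x * occ N x z t = w z * occ N z x t"
proof (induction N arbitrary: x z t)
  case 0 then show ?case by auto
next
  case (Suc N)
  let ?h = "\<lambda>z v. hold (q z) v 0"
  \<comment> \<open>Balance carries the weight across the jump from \<open>x\<close> to
    \<open>y\<close>, where the induction hypothesis applies. Commuting \<open>conv\<close> then
    makes the holding time of \<open>x\<close> the last one.\<close>
  have *: "w x * (R x y * conv (?h x) (occ N y z) t) = w z * (R y x * conv (occ N z y) (?h x) t)" for y
  proof -
    have "w x * (R x y * conv (?h x) (occ N y z) t) = R y x * (w y * conv (?h x) (occ N y z) t)"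
      using bal[of x y] by (metis mult.assoc mult.commute)
    also have "w y * conv (?h x) (occ N y z) t = conv (?h x) (\<lambda>v. w z * occ N z y v) t"
      by (simp add: conv_cmult_right[symmetric] Suc.IH)
    also have "\<dots> = w z * conv (occ N z y) (?h x) t"
      by (simp add: conv_cmult_right conv_commute)
    finally show ?thesis by (simp add: mult.left_commute)
  qed
  have "w x * occ (Suc N) x z t = (\<Sum>\<^sub>cy. w x * (R x y * conv (?h x) (occ N y z) t))"
    unfolding occ_first by (simp add: nn_integral_cmult)
  also have "\<dots> = (\<Sum>\<^sub>cy. w z * (R y x * conv (occ N z y) (?h x) t))"
    by (simp only: *)
  also have "\<dots> = w z * occ (Suc N) z x t"
    by (simp add: nn_integral_cmult)
  finally show ?case .
qed

lemma trans_symmetric: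
  assumes bal: "\<And>x z. w x * R x z = w z * R z x"
  shows "w x * trans t x z = w z * trans t z x"
  unfolding trans_def ennreal_suminf_cmult[symmetric] occ_symmetric[OF bal, of x] ..

definition reaches :: "'s \<Rightarrow> 's \<Rightarrow> bool" where
  "reaches = (\<lambda>x z. 0 < R x z)\<^sup>*\<^sup>*"

lemma reaches_refl [simp]: "reaches x x"
  by (simp add: reaches_def)

lemma reaches_step: "reaches x y \<Longrightarrow> 0 < R y z \<Longrightarrow> reaches x z"
  unfolding reaches_def by (rule rtranclp.rtrancl_into_rtrancl)

lemma reaches_in_S: "reaches x z \<Longrightarrow> x \<in> S \<Longrightarrow> z \<in> S"
  unfolding reaches_def by (induction rule: rtranclp_induct) (auto simp: R_def split: if_splits)

text \<open>Along a path of positive rates the convolutions have a positive integrand on the whole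
  interval from 0 to \<open>t\<close>. The number of jumps is the length of the path and does not
  depend on \<open>t\<close>.\<close>

lemma trans_pos:
  assumes "reaches x z" "0 < t" shows "0 < trans t x z"
proof -
  have "\<exists>N. \<forall>t>0. 0 < occ N x z t"
    using assms(1) unfolding reaches_def
  proof (induction rule: rtranclp_induct)
    case base
    have "\<forall>t>0. 0 < occ 0 x x t" by (simp add: hold_def)
    then show ?case by blast
  next
    case (step y z)
    then obtain N where N: "\<And>t. 0 < t \<Longrightarrow> 0 < occ N x y t" by blast
    have "0 < occ (Suc N) x z t" if t: "0 < t" for t
    proof -
      have "0 < conv (occ N x y) (\<lambda>v. hold (q z) v 0) t"
      proof (rule ccontr)
        assume "\<not> 0 < conv (occ N x y) (\<lambda>v. hold (q z) v 0) t"
        then have "AE v in lborel. occ N x y v * hold (q z) (t - v) 0 = 0"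
          by (simp add: conv_def nn_integral_0_iff_AE)
        then have "AE v in lborel. v \<notin> {0<..<t}"
          by (rule eventually_mono) (use N in \<open>force simp: hold_def\<close>)
        then have "{0<..<t} \<in> null_sets lborel" by (subst AE_iff_null_sets) auto
        then show False using t by auto
      qed
      then have "0 < R y z * conv (occ N x y) (\<lambda>v. hold (q z) v 0) t"
        using step by (simp add: ennreal_zero_less_mult_iff)
      also have "\<dots> \<le> occ (Suc N) x z t"
        unfolding occ.simps by (rule nn_integral_ge_point) simp
      finally show ?thesis .
    qed
    then show ?case by blast
  qed
  then obtain N where "0 < occ N x z t" using assms(2) by blast
  also have "occ N x z t \<le> trans t x z"
    unfolding trans_def using sum_le_suminf[of "\<lambda>N. occ N x z t" "{N}"] by simp
  finally show ?thesis .
qed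

lemma trans_reaches:
  assumes "\<not> reaches x z" shows "trans t x z = 0"
proof -
  have "occ N x z t = 0" if "\<not> reaches x z" for N z t
    using that
  proof (induction N arbitrary: z t)
    case 0 then show ?case by auto
  next
    case (Suc N)
    have "R y z * conv (occ N x y) (\<lambda>v. hold (q z) v 0) t = 0" for y
    proof (cases "reaches x y")
      case True
      then have "R y z = 0" using Suc.prems reaches_step[of x y z] by (auto simp: zero_less_iff_neq_zero)
      then show ?thesis by simp
    next
      case False
      then show ?thesis using Suc.IH by (simp add: conv_def)
    qed
    then show ?case by (simp only: occ.simps) simp
  qed
  with assms show ?thesis by (simp add: trans_def)
qed

end

section \<open>One-step recursion of the past functional and the law of the jump times\<close>

context past_functional
begin

lemma nn_integral_\<nu>_Suc:
  assumes z: "z \<in> S" and f [measurable]: "f \<in> borel_measurable K"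
  shows "(\<integral>\<^sup>+u. f u \<partial>\<nu> (Suc N) z) = (\<Sum>\<^sub>cy. indicator S y * (ennreal (J y z) *
    (\<integral>\<^sup>+u. \<integral>\<^sup>+h. f (\<phi> y z (u, h)) \<partial>exp_time (q y) \<partial>\<nu> N y)))"
proof -
  have step [measurable]: "\<phi> y y' \<in> measurable (K \<Otimes>\<^sub>M borel) K" for y y' by (rule measurable_step)
  have "(\<integral>\<^sup>+u. f u \<partial>\<nu> (Suc N) z) = (\<integral>\<^sup>+w. indicator {z} (Y (Suc N) w) * f (Z (Suc N) w) \<partial>P)"
    by (rule nn_integral_\<nu>) simp
  also have "\<dots> = (\<Sum>\<^sub>cy. indicator S y * (\<integral>\<^sup>+w. indicator {y} (Y N w) *
      (indicator {z} (Y (Suc N) w) * f (Z (Suc N) w)) \<partial>P))"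
    by (rule nn_integral_split_state) simp
  also have "\<dots> = (\<Sum>\<^sub>cy. indicator S y * (ennreal (J y z) *
    (\<integral>\<^sup>+u. \<integral>\<^sup>+h. f (\<phi> y z (u, h)) \<partial>exp_time (q y) \<partial>\<nu> N y)))"
  proof (rule nn_integral_cong)
    fix y
    show "indicator S y * (\<integral>\<^sup>+w. indicator {y} (Y N w) *
        (indicator {z} (Y (Suc N) w) * f (Z (Suc N) w)) \<partial>P) =
      indicator S y * (ennreal (J y z) *
        (\<integral>\<^sup>+u. \<integral>\<^sup>+h. f (\<phi> y z (u, h)) \<partial>exp_time (q y) \<partial>\<nu> N y))"
    proof (cases "y \<in> S")
      case True
      have "(\<integral>\<^sup>+w. indicator {y} (Y N w) * (indicator {z} (Y (Suc N) w) * f (Z (Suc N) w)) \<partial>P) =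
        (\<integral>\<^sup>+w. indicator {w\<in>space P. Y N w = y \<and> Y (Suc N) w = z} w * f (\<phi> y z (Z N w, H N w)) \<partial>P)"
        by (intro nn_integral_cong) (auto simp: Z_Suc split: split_indicator)
      then show ?thesis
        using True nn_integral_step[OF factorizes_next[OF True z], of "\<lambda>p. f (\<phi> y z p)"] by simp
    qed simp
  qed
  finally show ?thesis .
qed

lemma nn_integral_\<nu>_0:
  assumes [measurable]: "f \<in> borel_measurable K"
  shows "(\<integral>\<^sup>+u. f u \<partial>\<nu> 0 z) = (if z = x then f z0 else 0)"
proof -
  have "(\<integral>\<^sup>+u. f u \<partial>\<nu> 0 z) = (\<integral>\<^sup>+w. (if z = x then f z0 else 0) \<partial>P)"
    unfolding nn_integral_\<nu>[OF assms]
  proof (rule nn_integral_cong_AE)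
    show "AE w in P. indicator {z} (Y 0 w) * f (Z 0 w) = (if z = x then f z0 else 0)"
      using AE_regular by (rule eventually_mono) (auto simp: Z_0)
  qed
  then show ?thesis by (simp add: emeasure_space_1)
qed

lemma nn_integral_\<nu>_total:
  assumes [measurable]: "f \<in> borel_measurable K"
  shows "(\<integral>\<^sup>+w. f (Z N w) \<partial>P) = (\<Sum>\<^sub>cy. indicator S y * (\<integral>\<^sup>+u. f u \<partial>\<nu> N y))"
  by (subst nn_integral_split_state[of _ N]) (simp_all add: nn_integral_\<nu>)

end

context jump_process
begin

sublocale time: past_functional S Q x P Y H borel "jump_time H" 0 "\<lambda>y y' (u, h). u + h"
  by unfold_locales (auto simp: jump_time_Suc)

lemma measurable_jump_time [measurable]: "jump_time H N \<in> borel_measurable P"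
  by (rule time.measurable_Z)

text \<open>The link between the recursion \<open>occ\<close> and the process: the chance of no
  further jump until \<open>t\<close> is integrated over the law of the \<open>N\<close>-th jump
  time. Conditioning on the previous state yields the recursion of \<open>occ\<close>, because
  \<open>q y * J y z\<close> is the rate \<open>R y z\<close>.\<close>

lemma time_occ: "z \<in> S \<Longrightarrow> (\<integral>\<^sup>+u. hold (q z) t u \<partial>time.\<nu> N z) = occ N x z t"
proof (induction N arbitrary: z t)
  case 0
  then show ?case by (subst time.nn_integral_\<nu>_0) auto
next
  case (Suc N)
  have key: "ennreal (J y z) * (\<integral>\<^sup>+u. \<integral>\<^sup>+h. hold (q z) t (u + h) \<partial>exp_time (q y) \<partial>time.\<nu> N y) =
      R y z * conv (occ N x y) (\<lambda>v. hold (q z) v 0) t" if y: "y \<in> S" for y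
  proof (cases "q y = 0")
    case True
    then show ?thesis by (simp add: R_zero nn_integral_exp_time_0 hold_def top_unique)
  next
    case False
    then have qy: "0 < q y" using q_nonneg[OF y] by simp
    \<comment> \<open>The new variable \<open>v = u + h\<close> is the time of the next jump. The
      exponential density at \<open>h\<close> becomes \<open>q y\<close> times the survival factor
      from \<open>u\<close> to \<open>v\<close>.\<close>
    have inner: "(\<integral>\<^sup>+h. hold (q z) t (u + h) \<partial>exp_time (q y)) =
      (\<integral>\<^sup>+v. ennreal (q y) * (hold (q y) v u * hold (q z) (t - v) 0) \<partial>lborel)" for u
    proof (cases u)
      case top then show ?thesis using qy by (subst nn_integral_exp_time) (auto simp: hold_def top_unique)
    next
      case (real a)
      have "(\<integral>\<^sup>+v. ennreal (q y) * (hold (q y) v u * hold (q z) (t - v) 0) \<partial>lborel) =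
        ennreal \<bar>1\<bar> * (\<integral>\<^sup>+h. ennreal (q y) * (hold (q y) (a + 1 * h) u * hold (q z) (t - (a + 1 * h)) 0) \<partial>lborel)"
        by (rule nn_integral_real_affine) auto
      also have "\<dots> = (\<integral>\<^sup>+h. ennreal (exponential_density (q y) h) * hold (q z) t (u + ennreal h) \<partial>lborel)"
      proof (simp, rule nn_integral_cong)
        fix h
        show "ennreal (q y) * (hold (q y) (a + h) u * hold (q z) (t - (a + h)) 0) =
          ennreal (exponential_density (q y) h) * hold (q z) t (u + ennreal h)"
        proof (cases "0 \<le> h")
          case h: True
          then show ?thesis using real qy
            by (auto simp: hold_def exponential_density_def ennreal_plus[symmetric] ennreal_mult[symmetric]
                mult.commute mult.assoc simp del: ennreal_plus)
        next
          case False
          then show ?thesis using real by (auto simp: hold_def exponential_density_def)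
        qed
      qed
      also have "\<dots> = (\<integral>\<^sup>+h. hold (q z) t (u + h) \<partial>exp_time (q y))"
        using qy by (subst nn_integral_exp_time) auto
      finally show ?thesis by simp
    qed
    interpret \<nu>: finite_measure "time.\<nu> N y" by (rule time.finite_\<nu>)
    interpret pair: pair_sigma_finite "time.\<nu> N y" lborel by unfold_locales
    have "(\<integral>\<^sup>+u. \<integral>\<^sup>+h. hold (q z) t (u + h) \<partial>exp_time (q y) \<partial>time.\<nu> N y) =
      (\<integral>\<^sup>+u. \<integral>\<^sup>+v. ennreal (q y) * (hold (q y) v u * hold (q z) (t - v) 0) \<partial>lborel \<partial>time.\<nu> N y)"
      by (simp only: inner)
    also have "\<dots> = (\<integral>\<^sup>+v. \<integral>\<^sup>+u. ennreal (q y) * (hold (q y) v u * hold (q z) (t - v) 0) \<partial>time.\<nu> N y \<partial>lborel)"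
      by (rule pair.Fubini'[symmetric]) measurable
    also have "\<dots> = (\<integral>\<^sup>+v. ennreal (q y) * ((\<integral>\<^sup>+u. hold (q y) v u \<partial>time.\<nu> N y) * hold (q z) (t - v) 0) \<partial>lborel)"
      by (simp add: nn_integral_cmult nn_integral_multc)
    also have "\<dots> = ennreal (q y) * conv (occ N x y) (\<lambda>v. hold (q z) v 0) t"
      unfolding conv_def by (simp add: Suc.IH[OF y] nn_integral_cmult)
    finally have "ennreal (J y z) * (\<integral>\<^sup>+u. \<integral>\<^sup>+h. hold (q z) t (u + h) \<partial>exp_time (q y) \<partial>time.\<nu> N y) =
      (ennreal (q y) * ennreal (J y z)) * conv (occ N x y) (\<lambda>v. hold (q z) v 0) t"
      by (simp add: ac_simps)
    then show ?thesis by (simp add: J_R[OF y Suc.prems])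
  qed
  have "(\<integral>\<^sup>+u. hold (q z) t u \<partial>time.\<nu> (Suc N) z) =
     (\<Sum>\<^sub>cy. indicator S y * (ennreal (J y z) *
    (\<integral>\<^sup>+u. \<integral>\<^sup>+h. hold (q z) t (u + h) \<partial>exp_time (q y) \<partial>time.\<nu> N y)))"
    using Suc.prems by (subst time.nn_integral_\<nu>_Suc) auto
  also have "\<dots> = occ (Suc N) x z t"
    unfolding occ.simps
  proof (rule nn_integral_cong)
    fix y
    show "indicator S y * (ennreal (J y z) *
        (\<integral>\<^sup>+u. \<integral>\<^sup>+h. hold (q z) t (u + h) \<partial>exp_time (q y) \<partial>time.\<nu> N y)) =
      R y z * conv (occ N x y) (\<lambda>v. hold (q z) v 0) t"
      by (cases "y \<in> S") (simp_all only: key indicator_simps mult_1 mult_zero_left, simp add: R_def)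
  qed
  finally show ?case .
qed

text \<open>Absence of memory: surviving a further \<open>t0\<close> beyond \<open>t\<close> costs
  the same factor whatever the time of the last jump. The value \<open>t0 = 0\<close> gives the
  state at time \<open>t\<close>; general \<open>t0\<close> gives the residual holding time.\<close>

lemma emeasure_interval:
  assumes factor: "time.factorizes N y c F" and t: "0 \<le> t" "0 \<le> t0"
  shows "emeasure P {w\<in>space P. Y N w = y \<and> jump_time H N w \<le> ennreal t \<and>
      ennreal (t + t0) < jump_time H (Suc N) w \<and> F w} =
    occ N x y t * (ennreal (exp (- q y * t0)) * c)"
proof -
  have y: "y \<in> S" using factor by (simp add: time.factorizes_def)
  interpret E: prob_space "exp_time (q y)" by (rule prob_space_exp_time[OF q_nonneg[OF y]])
  let ?C = "{p::ennreal \<times> ennreal. fst p \<le> ennreal t \<and> ennreal (t + t0) < fst p + snd p}"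
  have "{p \<in> space (borel \<Otimes>\<^sub>M borel). fst p \<le> ennreal t \<and> ennreal (t + t0) < fst p + snd p}
      \<in> sets (borel \<Otimes>\<^sub>M borel)"
    by measurable
  then have C: "?C \<in> sets (borel \<Otimes>\<^sub>M borel)"
    by (simp add: space_pair_measure)
  have "{w\<in>space P. Y N w = y \<and> jump_time H N w \<le> ennreal t \<and>
      ennreal (t + t0) < jump_time H (Suc N) w \<and> F w} =
    {w\<in>space P. Y N w = y \<and> (jump_time H N w, H N w) \<in> ?C \<and> F w}"
    by (auto simp: jump_time_Suc)
  also have "emeasure P \<dots> = c * emeasure (time.\<nu> N y \<Otimes>\<^sub>M exp_time (q y)) ?C"
    by (rule time.emeasure_step[OF factor C])
  also have "emeasure (time.\<nu> N y \<Otimes>\<^sub>M exp_time (q y)) ?C =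
      (\<integral>\<^sup>+u. emeasure (exp_time (q y)) (Pair u -` ?C) \<partial>time.\<nu> N y)"
    using C by (intro E.emeasure_pair_measure_alt) (simp cong: sets_pair_measure_cong)
  also have "\<dots> = (\<integral>\<^sup>+u. hold (q y) t u * ennreal (exp (- q y * t0)) \<partial>time.\<nu> N y)"
  proof (rule nn_integral_cong)
    fix u
    show "emeasure (exp_time (q y)) (Pair u -` ?C) = hold (q y) t u * ennreal (exp (- q y * t0))"
    proof (cases "u \<le> ennreal t")
      case True
      then obtain a where a: "u = ennreal a" "0 \<le> a" "a \<le> t"
        using t by (cases u) (auto simp: top_unique)
      have "ennreal (t + t0) < ennreal a + h \<longleftrightarrow> ennreal (t + t0 - a) < h" for h
        using a t by (cases h)
          (auto simp: ennreal_plus[symmetric] ennreal_less_iff simp del: ennreal_plus)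
      then have "Pair u -` ?C = {ennreal (t + t0 - a)<..}"
        using True a by auto
      then have "emeasure (exp_time (q y)) (Pair u -` ?C) = ennreal (exp (- q y * (t + t0 - a)))"
        using emeasure_exp_time_tail[OF q_nonneg[OF y], of "t + t0 - a"] a t by simp
      also have "\<dots> = hold (q y) t u * ennreal (exp (- q y * t0))"
        using a t by (simp add: hold_def ennreal_mult[symmetric] exp_add[symmetric] algebra_simps)
      finally show ?thesis .
    qed (simp add: hold_def)
  qed
  also have "\<dots> = occ N x y t * ennreal (exp (- q y * t0))"
    by (simp add: nn_integral_multc time_occ[OF y])
  finally show ?thesis by (simp add: ac_simps)
qed

lemma measurable_state_at [measurable]: "Measurable.pred P (\<lambda>w. state_at Y H t w = Some z)"
  unfolding state_at_eq_Some_iff by measurable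

lemma emeasure_state_at:
  assumes z: "z \<in> S" and t: "0 \<le> t"
  shows "emeasure P {w\<in>space P. state_at Y H t w = Some z} = trans t x z"
proof -
  let ?A = "\<lambda>N. {w\<in>space P. Y N w = z \<and> jump_time H N w \<le> ennreal t \<and>
      ennreal (t + 0) < jump_time H (Suc N) w \<and> True}"
  have "{w\<in>space P. state_at Y H t w = Some z} = (\<Union>N. ?A N)"
    by (auto simp: state_at_eq_Some_iff)
  also have "emeasure P \<dots> = (\<Sum>N. emeasure P (?A N))"
    using jump_time_interval_unique[of H _ _ t]
    by (intro suminf_emeasure[symmetric]) (auto simp: disjoint_family_on_def)
  also have "\<dots> = trans t x z"
    unfolding trans_def
    using emeasure_interval[OF time.factorizes_trivial[OF z] t, of 0] by simp
  finally show ?thesis .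
qed

end

section \<open>The Markov property at a fixed time\<close>


text \<open>The process restarted at time \<open>t\<close>: indices are shifted by the number of
  jumps made, and in \<open>later_H\<close> the current state keeps only its residual holding time.
  After an explosion the index is unspecified, so the identities below assume that the state at
  \<open>t\<close> exists.\<close>

definition later_Y where
  "later_Y Y H t i w = Y (jump_index H t w + i) w"

definition later_H where
  "later_H H t i w = (if i = 0 then jump_time H (Suc (jump_index H t w)) w - ennreal t
     else H (jump_index H t w + i) w)"

lemma later_jump_time:
  assumes N: "jump_time H N w \<le> ennreal t" "ennreal t < jump_time H (Suc N) w"
  shows "jump_time (later_H H t) (Suc k) w = jump_time H (N + Suc k) w - ennreal t"
proof (induction k)
  case 0
  then show ?case by (simp add: jump_time_Suc[of _ 0] later_H_def jump_index_eq[OF N])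
next
  case (Suc k)
  \<comment> \<open>Subtraction in \<open>ennreal\<close> is truncated at 0, so moving it past the
    sum requires this inequality.\<close>
  have "ennreal t \<le> jump_time H (N + Suc k) w"
    using N(2) jump_time_mono[of "Suc N" "N + Suc k" H w] by (auto intro: less_imp_le less_le_trans)
  then have "jump_time H (N + Suc k) w - ennreal t + H (N + Suc k) w =
      jump_time H (N + Suc k) w + H (N + Suc k) w - ennreal t"
    by (subst (1 2) add.commute) (rule add_diff_eq_ennreal)
  moreover have "later_H H t (Suc k) w = H (N + Suc k) w"
    by (simp add: later_H_def jump_index_eq[OF N])
  ultimately show ?case
    using Suc.IH jump_time_Suc[of H "N + Suc k" w] jump_time_Suc[of "later_H H t" "Suc k" w] by simp
qed

lemma state_at_later:
  assumes st: "state_at Y H t w = Some y" and t: "0 \<le> t" and u: "0 \<le> u"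
  shows "state_at (later_Y Y H t) (later_H H t) u w = Some z \<longleftrightarrow> state_at Y H (t + u) w = Some z"
proof -
  obtain N where N: "jump_time H N w \<le> ennreal t" "ennreal t < jump_time H (Suc N) w"
    using st by (auto simp: state_at_eq_Some_iff)
  note later = later_jump_time[OF N]
  have less: "ennreal u < jump_time (later_H H t) (Suc k) w \<longleftrightarrow> ennreal (t + u) < jump_time H (Suc (N + k)) w" for k
    using later[of k] t u by (simp add: less_diff_eq_ennreal ennreal_plus add.commute)
  have tu: "ennreal t \<le> ennreal (t + u)" using u by (intro ennreal_leI) simp
  have le: "jump_time (later_H H t) k w \<le> ennreal u \<longleftrightarrow> jump_time H (N + k) w \<le> ennreal (t + u)" for k
  proof (cases k)
    case 0
    then show ?thesis using order_trans[OF N(1) tu] by simp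
  next
    case (Suc n)
    then show ?thesis using less[of n] by (simp add: linorder_not_less[symmetric])
  qed
  show ?thesis
  proof
    assume "state_at (later_Y Y H t) (later_H H t) u w = Some z"
    then obtain k where k: "jump_time (later_H H t) k w \<le> ennreal u"
      "ennreal u < jump_time (later_H H t) (Suc k) w" "later_Y Y H t k w = z"
      by (auto simp: state_at_eq_Some_iff)
    then have "Y (N + k) w = z" by (simp add: later_Y_def jump_index_eq[OF N])
    with k le less show "state_at Y H (t + u) w = Some z"
      unfolding state_at_eq_Some_iff by blast
  next
    assume "state_at Y H (t + u) w = Some z"
    then obtain N' where N': "jump_time H N' w \<le> ennreal (t + u)"
      "ennreal (t + u) < jump_time H (Suc N') w" "Y N' w = z"
      by (auto simp: state_at_eq_Some_iff)
    have "N \<le> N'"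
    proof (rule ccontr)
      assume "\<not> N \<le> N'"
      then have "jump_time H (Suc N') w \<le> jump_time H N w" by (intro jump_time_mono) auto
      also have "\<dots> \<le> ennreal t" by fact
      also have "\<dots> \<le> ennreal (t + u)" by (rule tu)
      finally show False using N'(2) by simp
    qed
    then obtain k where k: "N' = N + k" using le_Suc_ex by blast
    then have "later_Y Y H t k w = z" using N'(3) by (simp add: later_Y_def jump_index_eq[OF N])
    with N' k le less show "state_at (later_Y Y H t) (later_H H t) u w = Some z"
      unfolding state_at_eq_Some_iff by blast
  qed
qed

context jump_process
begin

lemma measurable_jump_index [measurable]: "jump_index H t \<in> measurable P (count_space UNIV)"
  unfolding jump_index_def by measurable

lemma measurable_later_Y [measurable]: "later_Y Y H t i \<in> measurable P (count_space UNIV)"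
proof -
  have "(\<lambda>w. Y (jump_index H t w + i) w) \<in> measurable P (count_space UNIV)"
    by (rule measurable_compose_countable[where g="jump_index H t"]) measurable
  then show ?thesis by (simp add: later_Y_def[abs_def])
qed

lemma measurable_later_H [measurable]: "later_H H t i \<in> borel_measurable P"
proof -
  have 1: "(\<lambda>w. H (jump_index H t w + i) w) \<in> borel_measurable P"
    by (rule measurable_compose_countable[where g="jump_index H t"]) measurable
  have 2: "(\<lambda>w. jump_time H (Suc (jump_index H t w)) w) \<in> borel_measurable P"
    by (rule measurable_compose_countable[where g="jump_index H t"]) measurable
  show ?thesis
    unfolding later_H_def[abs_def] using 1 2 by (cases "i = 0") simp_all
qed

text \<open>The event is split by the number \<open>N\<close> of jumps up to \<open>t\<close>. On
  each piece the residual holding time exceeds \<open>\<tau> 0\<close> exactly when no jump occurs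
  before or at \<open>t + \<tau> 0\<close>, and the rest of the path factorizes. The coefficients
  \<open>occ N x y t\<close> add up to \<open>trans t x y\<close>.\<close>

lemma emeasure_later:
  assumes y: "y \<in> S" and t: "0 \<le> t"
    and s: "\<And>i. i \<le> m \<Longrightarrow> s i \<in> S" and \<tau>: "\<And>i. i \<le> m \<Longrightarrow> 0 \<le> \<tau> i"
  shows "emeasure P {w\<in>space P. state_at Y H t w = Some y \<and>
      (\<forall>i\<le>m. later_Y Y H t i w = s i \<and> ennreal (\<tau> i) < later_H H t i w)} =
    trans t x y * (of_bool (s 0 = y) * ennreal (path_weight m s \<tau>))"
proof (cases "s 0 = y")
  case False
  have "{w\<in>space P. state_at Y H t w = Some y \<and>
      (\<forall>i\<le>m. later_Y Y H t i w = s i \<and> ennreal (\<tau> i) < later_H H t i w)} = {}"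
    using False by (auto simp: state_at_eq_Some_iff later_Y_def) (metis add_0_right jump_index_eq le0)
  then show ?thesis using False by (simp only:) simp
next
  case True
  \<comment> \<open>\<open>F\<close> and \<open>c\<close> are the event and the weight of the path
    beyond the current state. For \<open>m = 0\<close> nothing lies beyond it, hence the trivial
    values.\<close>
  define F where "F N w = (case m of 0 \<Rightarrow> True | Suc k \<Rightarrow>
      trajectory (Suc N) k (\<lambda>i. s (Suc i)) (\<lambda>i. \<tau> (Suc i)) w)" for N w
  define c where "c = (case m of 0 \<Rightarrow> 1 | Suc k \<Rightarrow>
      ennreal (J y (s (Suc 0)) * path_weight k (\<lambda>i. s (Suc i)) (\<lambda>i. \<tau> (Suc i))))"
  define A where "A N = {w\<in>space P. Y N w = y \<and> jump_time H N w \<le> ennreal t \<and>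
      ennreal (t + \<tau> 0) < jump_time H (Suc N) w \<and> F N w}" for N
  have F: "Measurable.pred P (F N)" for N unfolding F_def by (cases m) simp_all
  have weight: "ennreal (path_weight m s \<tau>) = ennreal (exp (- q y * \<tau> 0)) * c"
  proof (cases m)
    case 0 then show ?thesis using True by (simp add: path_weight_0 c_def)
  next
    case (Suc k)
    have 1: "s = case_nat y (\<lambda>i. s (Suc i))" "\<tau> = case_nat (\<tau> 0) (\<lambda>i. \<tau> (Suc i))"
      using True by (auto split: nat.split)
    have "path_weight m s \<tau> = exp (- q y * \<tau> 0) * (J y (s (Suc 0)) * path_weight k (\<lambda>i. s (Suc i)) (\<lambda>i. \<tau> (Suc i)))"
      using path_weight_Cons[of k y "\<lambda>i. s (Suc i)" "\<tau> 0" "\<lambda>i. \<tau> (Suc i)"]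
      unfolding 1[symmetric] Suc by simp
    moreover have "0 \<le> J y (s (Suc 0)) * path_weight k (\<lambda>i. s (Suc i)) (\<lambda>i. \<tau> (Suc i))"
      using s y Suc by (intro mult_nonneg_nonneg J_nonneg path_weight_nonneg) auto
    ultimately show ?thesis using Suc by (simp add: ennreal_mult c_def)
  qed
  have each: "emeasure P (A N) = occ N x y t * (ennreal (exp (- q y * \<tau> 0)) * c)" for N
  unfolding A_def
  proof (rule emeasure_interval)
    show "time.factorizes N y c (F N)"
    proof (cases m)
      case 0
      then have "F N = (\<lambda>_. True)" by (simp add: F_def fun_eq_iff)
      then show ?thesis using 0 y time.factorizes_trivial by (simp add: c_def)
    next
      case (Suc k)
      then have "F N = trajectory (Suc N) k (\<lambda>i. s (Suc i)) (\<lambda>i. \<tau> (Suc i))"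
        by (simp add: F_def fun_eq_iff)
      then show ?thesis
        using time.factorizes_future[of y k "\<lambda>i. s (Suc i)" "\<lambda>i. \<tau> (Suc i)" N] s \<tau> Suc y
        by (simp add: c_def)
    qed
  qed (use t \<tau> in auto)
  have "{w\<in>space P. state_at Y H t w = Some y \<and>
      (\<forall>i\<le>m. later_Y Y H t i w = s i \<and> ennreal (\<tau> i) < later_H H t i w)} = (\<Union>N. A N)"
  proof (intro set_eqI iffI)
    fix w
    assume "w \<in> {w\<in>space P. state_at Y H t w = Some y \<and>
      (\<forall>i\<le>m. later_Y Y H t i w = s i \<and> ennreal (\<tau> i) < later_H H t i w)}"
    then obtain N where w: "w \<in> space P" and N: "jump_time H N w \<le> ennreal t"
      "ennreal t < jump_time H (Suc N) w" "Y N w = y"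
      and l: "\<And>i. i \<le> m \<Longrightarrow> later_Y Y H t i w = s i \<and> ennreal (\<tau> i) < later_H H t i w"
      by (auto simp: state_at_eq_Some_iff)
    note ind = jump_index_eq[OF N(1,2)]
    have "ennreal (t + \<tau> 0) < jump_time H (Suc N) w"
      using l[of 0] t \<tau>[of 0]
      by (simp add: later_H_def ind less_diff_eq_ennreal ennreal_plus add.commute)
    moreover have "F N w"
      using l[of "Suc _"] by (auto simp: F_def later_H_def later_Y_def ind split: nat.split)
    ultimately show "w \<in> (\<Union>N. A N)" using w N unfolding A_def by blast
  next
    fix w assume "w \<in> (\<Union>N. A N)"
    then obtain N where w: "w \<in> space P" and N: "Y N w = y" "jump_time H N w \<le> ennreal t"
      "ennreal (t + \<tau> 0) < jump_time H (Suc N) w" "F N w" unfolding A_def by blast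
    have "ennreal t \<le> ennreal (t + \<tau> 0)" using \<tau>[of 0] by (intro ennreal_leI) simp
    then have N': "ennreal t < jump_time H (Suc N) w" using N(3) by simp
    note ind = jump_index_eq[OF N(2) N']
    have "state_at Y H t w = Some y" using N N' by (auto simp: state_at_eq_Some_iff)
    moreover have "later_Y Y H t i w = s i \<and> ennreal (\<tau> i) < later_H H t i w" if "i \<le> m" for i
    proof (cases i)
      case 0
      then show ?thesis
        using N t \<tau>[of 0] True
        by (simp add: later_Y_def later_H_def ind less_diff_eq_ennreal ennreal_plus add.commute)
    next
      case (Suc j)
      then show ?thesis
        using N(4) that by (auto simp: F_def later_Y_def later_H_def ind split: nat.splits)
    qed
    ultimately show "w \<in> {w\<in>space P. state_at Y H t w = Some y \<and>
      (\<forall>i\<le>m. later_Y Y H t i w = s i \<and> ennreal (\<tau> i) < later_H H t i w)}" using w by simp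
  qed
  also have "emeasure P \<dots> = (\<Sum>N. emeasure P (A N))"
  proof (intro suminf_emeasure[symmetric])
    have "N = N'" if "w \<in> A N" "w \<in> A N'" for N N' w
    proof -
      have "ennreal t \<le> ennreal (t + \<tau> 0)" using \<tau>[of 0] by (intro ennreal_leI) simp
      with that show ?thesis
        by (intro jump_time_interval_unique[of H N w t N']) (auto simp: A_def)
    qed
    then show "disjoint_family A" unfolding disjoint_family_on_def by blast
    show "range A \<subseteq> sets P" using F by (auto simp: A_def)
  qed
  also have "\<dots> = (\<Sum>N. occ N x y t * (ennreal (exp (- q y * \<tau> 0)) * c))"
    by (rule suminf_cong) (rule each)
  also have "\<dots> = trans t x y * ennreal (path_weight m s \<tau>)"
    unfolding trans_def by (subst weight) (rule ennreal_suminf_multc)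
  finally show ?thesis using True by simp
qed

text \<open>The Markov property in a form that can be iterated: conditioning on the present state
  keeps the sample space, and the restarted process is again a \<open>jump_process\<close>, now
  started at \<open>y\<close>.\<close>

lemma jump_process_later:
  assumes y: "y \<in> S" and t: "0 \<le> t" and pos: "trans t x y \<noteq> 0"
  shows "jump_process S Q y
    (uniform_measure P {w\<in>space P. state_at Y H t w = Some y}) (later_Y Y H t) (later_H H t)"
proof
  let ?A = "{w\<in>space P. state_at Y H t w = Some y}"
  have A: "emeasure P ?A = trans t x y" by (rule emeasure_state_at[OF y t])
  show "jump_law S Q y (uniform_measure P ?A) (later_Y Y H t) (later_H H t)"
    unfolding jump_law_def
  proof (intro conjI allI impI)
    show "prob_space (uniform_measure P ?A)"
      using A pos by (intro prob_space_uniform_measure) auto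
    show "later_Y Y H t i \<in> measurable (uniform_measure P ?A) (count_space UNIV)" for i
      using measurable_later_Y by (simp cong: measurable_cong_sets)
    show "later_H H t i \<in> borel_measurable (uniform_measure P ?A)" for i
      using measurable_later_H by (simp cong: measurable_cong_sets)
    fix m :: nat and s and \<tau> :: "nat \<Rightarrow> real"
    assume *: "\<forall>i\<le>m. s i \<in> S \<and> 0 \<le> \<tau> i"
    let ?B = "{w\<in>space P. \<forall>i\<le>m. later_Y Y H t i w = s i \<and> ennreal (\<tau> i) < later_H H t i w}"
    have "?A \<inter> ?B = {w\<in>space P. state_at Y H t w = Some y \<and>
      (\<forall>i\<le>m. later_Y Y H t i w = s i \<and> ennreal (\<tau> i) < later_H H t i w)}"
      by auto
    then have "emeasure P (?A \<inter> ?B) = trans t x y * (of_bool (s 0 = y) * ennreal (path_weight m s \<tau>))"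
      using emeasure_later[OF y t, of m s \<tau>] *
      by simp
    then have "emeasure (uniform_measure P ?A) ?B = of_bool (s 0 = y) * ennreal (path_weight m s \<tau>)"
      using A pos emeasure_finite[of ?A]
      by (simp add: emeasure_uniform_measure ennreal_mult_divide_eq mult.commute)
    then have "measure (uniform_measure P ?A) ?B = of_bool (s 0 = y) * path_weight m s \<tau>"
      using * path_weight_nonneg[of m s \<tau>] by (auto simp: measure_def)
    then show "measure (uniform_measure P ?A) {w \<in> space (uniform_measure P ?A).
        \<forall>i\<le>m. later_Y Y H t i w = s i \<and> ennreal (\<tau> i) < later_H H t i w} =
        of_bool (s 0 = y) * (\<Prod>i<m. J (s i) (s (Suc i))) * (\<Prod>i\<le>m. exp (- q (s i) * \<tau> i))"
      by (simp add: path_weight_def mult.assoc)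
  qed
qed (rule y)

end

context conservative_generator
begin

fun path_prob :: "'s \<Rightarrow> real \<Rightarrow> (real \<times> 's) list \<Rightarrow> ennreal" where
  "path_prob x u [] = 1"
| "path_prob x u ((t, z) # L) = trans (t - u) x z * path_prob z t L"

text \<open>\<open>B\<close> is a property of processes whose probability is the same number
  \<open>b\<close> for every process started at \<open>z\<close> on this type of sample space, in
  particular for the conditioned one. If \<open>z\<close> has probability 0 at time
  \<open>t\<close>, both sides vanish.\<close>

lemma emeasure_state_at_and_later:
  fixes P :: "'w measure"
  assumes "jump_process S Q x P Y H" and z: "z \<in> S" and t: "0 \<le> t"
    and B: "\<And>P' :: 'w measure. \<And>Y' H'. jump_process S Q z P' Y' H' \<Longrightarrow>
      Measurable.pred P' (B Y' H') \<and> emeasure P' {w\<in>space P'. B Y' H' w} = b"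
  shows "emeasure P {w\<in>space P. state_at Y H t w = Some z \<and> B (later_Y Y H t) (later_H H t) w} =
    trans t x z * b"
proof -
  interpret jump_process S Q x P Y H by fact
  let ?A = "{w\<in>space P. state_at Y H t w = Some z}"
  let ?B = "{w\<in>space P. B (later_Y Y H t) (later_H H t) w}"
  have A: "emeasure P ?A = trans t x z" by (rule emeasure_state_at[OF z t])
  show ?thesis
  proof (cases "trans t x z = 0")
    case True
    have "emeasure P {w\<in>space P. state_at Y H t w = Some z \<and> B (later_Y Y H t) (later_H H t) w}
        \<le> emeasure P ?A"
      by (intro emeasure_mono) auto
    with True A show ?thesis by simp
  next
    case False
    note later = B[OF jump_process_later[OF z t False]]
    have [measurable]: "Measurable.pred P (B (later_Y Y H t) (later_H H t))"
      using later[THEN conjunct1]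
      by (subst (asm) measurable_cong_sets[OF sets_uniform_measure refl])
    have eq: "{w\<in>space P. state_at Y H t w = Some z \<and> B (later_Y Y H t) (later_H H t) w} = ?A \<inter> ?B"
      by auto
    have "emeasure P (?A \<inter> ?B) / emeasure P ?A = b"
      using later by (simp add: emeasure_uniform_measure)
    moreover have "emeasure P (?A \<inter> ?B) = emeasure P (?A \<inter> ?B) / emeasure P ?A * emeasure P ?A"
      using False A emeasure_finite[of ?A] by (simp add: ennreal_divide_times ennreal_divide_self top.not_eq_extremum)
    ultimately have "emeasure P (?A \<inter> ?B) = trans t x z * b"
      by (simp add: A mult.commute)
    then show ?thesis unfolding eq .
  qed
qed

text \<open>The offset \<open>u\<close> is the time already reached, at which the process is in
  \<open>x\<close>. At each observation the process is restarted and the observation time becomes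
  the new offset.\<close>

lemma emeasure_finite_dim:
  fixes P :: "'w measure"
  assumes "jump_process S Q x P Y H" "sorted (map fst L)"
    "\<And>t z. (t, z) \<in> set L \<Longrightarrow> u \<le> t \<and> z \<in> S"
  shows "emeasure P {w\<in>space P. \<forall>(t, z)\<in>set L. state_at Y H (t - u) w = Some z} = path_prob x u L"
  using assms
proof (induction L arbitrary: x P Y H u)
  case Nil
  interpret jump_process S Q x P Y H by fact
  show ?case using emeasure_space_1 by simp
next
  case (Cons a L)
  obtain t z where a: "a = (t, z)" by (cases a)
  have z: "z \<in> S" and t: "0 \<le> t - u" using Cons.prems(3)[of t z] a by auto
  have L: "t \<le> t' \<and> z' \<in> S" if "(t', z') \<in> set L" for t' z'
    using Cons.prems(2,3) that by (force simp: a)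
  let ?B = "\<lambda>Y H w. \<forall>(t', z')\<in>set L. state_at Y H (t' - t) w = Some z'"
  have "{w\<in>space P. \<forall>(t, z)\<in>set (a # L). state_at Y H (t - u) w = Some z} =
    {w\<in>space P. state_at Y H (t - u) w = Some z \<and> ?B (later_Y Y H (t - u)) (later_H H (t - u)) w}"
    using state_at_later[OF _ t, of Y H _ z "_ - t"] L by (fastforce simp: a)
  also have "emeasure P \<dots> = trans (t - u) x z * path_prob z t L"
  proof (rule emeasure_state_at_and_later[OF Cons.prems(1) z t])
    fix P' :: "'w measure" and Y' H' assume P': "jump_process S Q z P' Y' H'"
    interpret P': jump_process S Q z P' Y' H' by fact
    have "Measurable.pred P' (\<lambda>w. ?B Y' H' w)"
      by (rule pred_intros_finite) (auto simp: case_prod_beta')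
    moreover have "emeasure P' {w\<in>space P'. ?B Y' H' w} = path_prob z t L"
      using Cons.prems(2) L by (intro Cons.IH[OF P']) (auto simp: a)
    ultimately show "Measurable.pred P' (?B Y' H') \<and> emeasure P' {w\<in>space P'. ?B Y' H' w} = path_prob z t L"
      by blast
  qed
  finally show ?case by (simp add: a)
qed

end

section \<open>Countable sums and uniqueness of invariant measures\<close>

lemma has_sum_iff_nn_integral:
  fixes f :: "'s \<Rightarrow> real"
  assumes f: "\<And>x. x \<in> A \<Longrightarrow> 0 \<le> f x"
  shows "(f has_sum c) A \<longleftrightarrow> 0 \<le> c \<and> (\<integral>\<^sup>+x. ennreal (f x) \<partial>count_space A) = ennreal c"
proof
  assume c: "(f has_sum c) A"
  then have abs: "(\<lambda>x. norm (f x)) summable_on A"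
    using f summable_on_iff_abs_summable_on_real has_sum_imp_summable by blast
  then have int: "integrable (count_space A) f"
    using abs_summable_equivalent[of f A] by (simp add: Infinite_Set_Sum.abs_summable_on_def)
  have "infsetsum f A = c"
    using infsetsum_infsum[of f A] abs abs_summable_equivalent[of f A] infsumI[OF c] by simp
  then have "(\<integral>x. f x \<partial>count_space A) = c" by (simp add: infsetsum_def)
  then show "0 \<le> c \<and> (\<integral>\<^sup>+x. ennreal (f x) \<partial>count_space A) = ennreal c"
    using nn_integral_eq_integral[OF int] f has_sum_nonneg[OF c f] by (auto simp: AE_count_space)
next
  assume c: "0 \<le> c \<and> (\<integral>\<^sup>+x. ennreal (f x) \<partial>count_space A) = ennreal c"
  then have int: "has_bochner_integral (count_space A) f c"
    using f by (intro has_bochner_integral_nn_integral) (auto simp: AE_count_space)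
  then have abs: "Infinite_Set_Sum.abs_summable_on f A"
    by (auto simp: Infinite_Set_Sum.abs_summable_on_def has_bochner_integral_iff)
  have "infsetsum f A = c" using int by (simp add: infsetsum_def has_bochner_integral_iff)
  then have "infsum f A = c" using infsetsum_infsum[OF abs] by simp
  moreover have "f summable_on A"
    using abs abs_summable_equivalent[of f A] abs_summable_summable by blast
  ultimately show "(f has_sum c) A" using has_sum_infsum by blast
qed

lemma nn_integral_count_space_eqD:
  fixes f g :: "'s \<Rightarrow> ennreal"
  assumes le: "\<And>x. f x \<le> g x" and ge: "(\<Sum>\<^sub>cx. g x) \<le> (\<Sum>\<^sub>cx. f x)"
    and fin: "(\<Sum>\<^sub>cx. f x) \<noteq> \<infinity>"
  shows "f x = g x"
proof -
  have "(\<Sum>\<^sub>cx. g x - f x) =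
      (\<Sum>\<^sub>cx. g x) - (\<Sum>\<^sub>cx. f x)"
    using le fin by (intro nn_integral_diff) auto
  also have "\<dots> = 0" using ge fin by (simp add: diff_eq_0_iff_ennreal top.not_eq_extremum)
  finally have "g x - f x = 0" by (simp add: nn_integral_0_iff_AE AE_count_space)
  moreover have "f x \<noteq> \<infinity>"
    using fin nn_integral_ge_point[of x UNIV f] by (auto simp: top_unique)
  ultimately have "g x \<le> f x" by (auto simp: diff_eq_0_iff_ennreal)
  with le show ?thesis by (simp add: antisym)
qed

text \<open>
  The minimum of two invariant measures is again invariant, so their differences with it are
  invariant with disjoint supports; but a nonzero invariant measure charges \<open>x0\<close>.
\<close>

lemma invariant_measure_unique:
  fixes K :: "'s::countable \<Rightarrow> 's \<Rightarrow> ennreal" and a b :: "'s \<Rightarrow> ennreal"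
  assumes a: "\<And>z. (\<Sum>\<^sub>cx. a x * K x z) = a z"
    and b: "\<And>z. (\<Sum>\<^sub>cx. b x * K x z) = b z"
    and a1: "(\<Sum>\<^sub>cx. a x) = 1" and b1: "(\<Sum>\<^sub>cx. b x) = 1"
    and K: "\<And>x. a x \<noteq> 0 \<or> b x \<noteq> 0 \<Longrightarrow> (\<Sum>\<^sub>cz. K x z) = 1 \<and> 0 < K x x0"
  shows "a = b"
proof -
  define m where "m x = min (a x) (b x)" for x
  have m_le: "m x \<le> a x" "m x \<le> b x" for x by (simp_all add: m_def)
  have afin: "a x \<noteq> \<infinity>" for x using a1 nn_integral_ge_point[of x UNIV a] by (auto simp: top_unique)
  have bfin: "b x \<noteq> \<infinity>" for x using b1 nn_integral_ge_point[of x UNIV b] by (auto simp: top_unique)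
  have mfin: "m x \<noteq> \<infinity>" for x using afin[of x] m_le(1)[of x] by (auto simp: top_unique)
  have "(\<Sum>\<^sub>cx. m x * K x z) \<le> (\<Sum>\<^sub>cx. a x * K x z)"
    "(\<Sum>\<^sub>cx. m x * K x z) \<le> (\<Sum>\<^sub>cx. b x * K x z)" for z
    by (intro nn_integral_mono mult_right_mono m_le zero_le)+
  then have le: "(\<Sum>\<^sub>cx. m x * K x z) \<le> m z" for z
    using a b by (simp add: m_def)
  have "(\<Sum>\<^sub>cz. \<Sum>\<^sub>cx. m x * K x z) =
      (\<Sum>\<^sub>cx. \<Sum>\<^sub>cz. m x * K x z)"
    by (rule nn_integral_count_space_commute)
  also have "\<dots> = (\<Sum>\<^sub>cx. m x)"
  proof (rule nn_integral_cong)
    fix x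
    show "(\<Sum>\<^sub>cz. m x * K x z) = m x"
      using K[of x] by (cases "m x = 0") (auto simp: nn_integral_cmult m_def min_def split: if_splits)
  qed
  finally have tot: "(\<Sum>\<^sub>cz. \<Sum>\<^sub>cx. m x * K x z) =
      (\<Sum>\<^sub>cx. m x)" .
  have "(\<Sum>\<^sub>cx. m x) \<le> 1"
    unfolding a1[symmetric] by (intro nn_integral_mono m_le)
  then have "(\<Sum>\<^sub>cz. \<Sum>\<^sub>cx. m x * K x z) \<noteq> \<infinity>"
    unfolding tot by (auto simp: top_unique)
  then have m: "(\<Sum>\<^sub>cx. m x * K x z) = m z" for z
    using le tot by (intro nn_integral_count_space_eqD) auto
  \<comment> \<open>Here \<open>c\<close> is \<open>a\<close> or \<open>b\<close>. The excess
    \<open>c - m\<close> sends no mass to \<open>x0\<close>, while every state charged by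
    \<open>c\<close> leads to \<open>x0\<close> with positive probability, so the excess is
    0.\<close>
  have key: "c x \<le> m x" if c: "\<And>z. (\<Sum>\<^sub>cx. c x * K x z) = c z"
    and cm: "\<And>x. m x \<le> c x" and cfin: "\<And>x. c x \<noteq> \<infinity>" and x0: "c x0 = m x0"
    and cK: "\<And>x. c x \<noteq> 0 \<Longrightarrow> 0 < K x x0" for c x
  proof -
    have "c x0 = (\<Sum>\<^sub>cx. (c x - m x) * K x x0 + m x * K x x0)"
      using cm by (subst c[of x0, symmetric], intro nn_integral_cong)
        (simp add: distrib_right[symmetric] diff_add_cancel_ennreal)
    also have "\<dots> = (\<Sum>\<^sub>cx. (c x - m x) * K x x0) + m x0"
      by (subst nn_integral_add) (auto simp: m)
    finally have "(\<Sum>\<^sub>cx. (c x - m x) * K x x0) + m x0 = 0 + m x0"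
      using x0 by simp
    then have "(\<Sum>\<^sub>cx. (c x - m x) * K x x0) = 0"
      using mfin[of x0] by (simp add: add.commute[of _ "m x0"] ennreal_add_left_cancel)
    then have "(c x - m x) * K x x0 = 0" by (simp add: nn_integral_0_iff_AE AE_count_space)
    then have "c x - m x = 0 \<or> c x = 0" using cK[of x] by auto
    then show "c x \<le> m x" using cfin[of x] by (auto simp: diff_eq_0_iff_ennreal)
  qed
  \<comment> \<open>The measure that is smaller at \<open>x0\<close> agrees there with the minimum,
    so it lies below the other one everywhere. Equal total masses then force equality.\<close>
  have "(\<forall>x. a x \<le> b x) \<or> (\<forall>x. b x \<le> a x)"
  proof (cases "a x0 \<le> b x0")
    case True
    then have "a x \<le> m x" for x
      by (intro key) (use a m_le afin K in \<open>auto simp: m_def min_def\<close>)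
    then show ?thesis using m_le order_trans by blast
  next
    case False
    then have "b x \<le> m x" for x
      by (intro key) (use b m_le bfin K in \<open>auto simp: m_def min_def\<close>)
    then show ?thesis using m_le order_trans by blast
  qed
  then show "a = b"
  proof
    assume "\<forall>x. a x \<le> b x"
    then show ?thesis using a1 b1 by (intro ext nn_integral_count_space_eqD) auto
  next
    assume "\<forall>x. b x \<le> a x"
    then have "b = a" using a1 b1 by (intro ext nn_integral_count_space_eqD) auto
    then show ?thesis by simp
  qed
qed

section \<open>Explosion and return times\<close>


lemma laplace_antimono: "0 \<le> a \<Longrightarrow> u \<le> v \<Longrightarrow> laplace a v \<le> laplace a u"
  by (cases u; cases v) (auto simp: laplace_def top_unique intro!: ennreal_leI mult_left_mono)

context jump_process
begin

text \<open>\<open>e\<close> iterates the expected discount over one holding time followed by one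
  jump, so \<open>e k\<close> is the transform of the \<open>k\<close>-th jump time as a function of
  the starting state.\<close>

lemma laplace_jump_time:
  assumes a: "0 < a" and e0: "\<And>y. e 0 y = 1"
    and e_Suc: "\<And>k y. e (Suc k) y = (\<Sum>z\<in>{z. Q y z \<noteq> 0} - {y}. Q y z * e k z) / (a + q y)"
    and e: "\<And>k y. y \<in> S \<Longrightarrow> 0 \<le> e k y"
  shows "(\<integral>\<^sup>+w. laplace a (jump_time H k w) \<partial>P) = ennreal (e k x)"
proof -
  define A where "A N y = (\<integral>\<^sup>+u. laplace a u \<partial>time.\<nu> N y)" for N y
  have A_Suc: "A (Suc N) z = (\<Sum>\<^sub>cy. indicator S y * A N y * ennreal (1 / (a + q y)) * R y z)"
    if z: "z \<in> S" for N z
    unfolding A_def time.nn_integral_\<nu>_Suc[OF z measurable_laplace]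
  proof (rule nn_integral_cong)
    fix y
    show "indicator S y * (ennreal (J y z) * (\<integral>\<^sup>+u. \<integral>\<^sup>+h. laplace a ((\<lambda>(u, h). u + h) (u, h))
        \<partial>exp_time (q y) \<partial>time.\<nu> N y)) =
      indicator S y * (\<integral>\<^sup>+u. laplace a u \<partial>time.\<nu> N y) * ennreal (1 / (a + q y)) * R y z"
    proof (cases "y \<in> S")
      case True
      have "(\<integral>\<^sup>+u. \<integral>\<^sup>+h. laplace a (u + h) \<partial>exp_time (q y) \<partial>time.\<nu> N y) =
          A N y * ennreal (q y / (a + q y))"
        unfolding laplace_add A_def
        by (simp add: nn_integral_cmult nn_integral_multc nn_integral_exp_time_laplace[OF a q_nonneg[OF True]])
      also have "ennreal (q y / (a + q y)) = ennreal (1 / (a + q y)) * ennreal (q y)"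
        using a q_nonneg[OF True] by (simp add: ennreal_mult[symmetric])
      finally show ?thesis
        using True J_R[OF True z, symmetric] by (simp add: A_def ac_simps)
    qed simp
  qed
  \<comment> \<open>The first \<open>N\<close> jumps are accounted for by the law of the process,
    the remaining \<open>k\<close> by \<open>e\<close>. Handing one jump over from the former to the
    latter leaves the sum unchanged.\<close>
  have *: "(\<Sum>\<^sub>cy. indicator S y * A N y * ennreal (e k y)) = ennreal (e (N + k) x)" for N k
  proof (induction N arbitrary: k)
    case 0
    have "A 0 y = (if y = x then 1 else 0)" for y
      unfolding A_def by (subst time.nn_integral_\<nu>_0) auto
    then show ?case
      using start by (subst nn_integral_count_space_single[of x]) auto
  next
    case (Suc N)
    have "(\<Sum>\<^sub>cz. indicator S z * A (Suc N) z * ennreal (e k z)) =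
      (\<Sum>\<^sub>cz. \<Sum>\<^sub>cy. indicator S y * A N y * ennreal (1 / (a + q y)) * (R y z * ennreal (e k z)))"
    proof (rule nn_integral_cong)
      fix z
      show "indicator S z * A (Suc N) z * ennreal (e k z) =
        (\<Sum>\<^sub>cy. indicator S y * A N y * ennreal (1 / (a + q y)) * (R y z * ennreal (e k z)))"
        by (cases "z \<in> S") (simp_all add: A_Suc nn_integral_multc[symmetric] mult.assoc, simp add: R_def)
    qed
    also have "\<dots> = (\<Sum>\<^sub>cy. \<Sum>\<^sub>cz. indicator S y * A N y * ennreal (1 / (a + q y)) * (R y z * ennreal (e k z)))"
      by (rule nn_integral_count_space_commute)
    also have "\<dots> = (\<Sum>\<^sub>cy. indicator S y * A N y * ennreal (e (Suc k) y))"
    proof (rule nn_integral_cong)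
      fix y
      show "(\<Sum>\<^sub>cz. indicator S y * A N y * ennreal (1 / (a + q y)) * (R y z * ennreal (e k z))) =
        indicator S y * A N y * ennreal (e (Suc k) y)"
      proof (cases "y \<in> S")
        case True
        have "0 \<le> (\<Sum>z\<in>{z. Q y z \<noteq> 0} - {y}. Q y z * e k z)"
          using e[OF True, of "Suc k"] a q_nonneg[OF True] unfolding e_Suc
          by (simp add: zero_le_divide_iff)
        then show ?thesis
          using True a q_nonneg[OF True]
          by (simp add: nn_integral_cmult R_integral[OF True e] e_Suc ennreal_mult[symmetric] mult.assoc)
      qed simp
    qed
    finally show ?case using Suc.IH[of "Suc k"] by simp
  qed
  have "(\<integral>\<^sup>+w. laplace a (jump_time H k w) \<partial>P) = (\<Sum>\<^sub>cy. indicator S y * A k y * ennreal (e 0 y))"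
    by (subst time.nn_integral_\<nu>_total) (simp_all add: A_def e0)
  then show ?thesis using *[of k 0] by simp
qed

section \<open>Taboo probabilities and the first return\<close>

lemma avoid_functional:
  "past_functional S Q x P Y H (count_space UNIV) (\<lambda>N w. \<forall>i\<in>{1..N}. Y i w \<noteq> x) True
    (\<lambda>y y' (b, h). b \<and> y' \<noteq> x)"
proof
  fix y y'
  show "(\<lambda>(b, h). b \<and> y' \<noteq> x) \<in> measurable (count_space UNIV \<Otimes>\<^sub>M (borel :: ennreal measure)) (count_space UNIV)"
    by (simp add: case_prod_beta')
next
  fix N
  show "(\<lambda>w. \<forall>i\<in>{1..Suc N}. Y i w \<noteq> x) =
      (\<lambda>w. (\<lambda>(b, h). b \<and> Y (Suc N) w \<noteq> x) (\<forall>i\<in>{1..N}. Y i w \<noteq> x, H N w))"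
    by (auto simp: fun_eq_iff atLeastAtMostSuc_conv)
qed auto

sublocale avoid: past_functional S Q x P Y H "count_space UNIV" "\<lambda>N w. \<forall>i\<in>{1..N}. Y i w \<noteq> x" True
  "\<lambda>y y' (b, h). b \<and> y' \<noteq> x"
  by (rule avoid_functional)

text \<open>The taboo probability of being in \<open>z\<close> after \<open>N\<close> jumps without
  a visit to \<open>x\<close> since the start. The start itself is not counted, so for
  \<open>N = 0\<close> the mass sits at \<open>x\<close>.\<close>

definition avoid_prob :: "nat \<Rightarrow> 's \<Rightarrow> ennreal" where
  "avoid_prob N z = (\<integral>\<^sup>+b. of_bool b \<partial>avoid.\<nu> N z)"

lemma avoid_prob_0: "avoid_prob 0 z = of_bool (z = x)"
  unfolding avoid_prob_def by (subst avoid.nn_integral_\<nu>_0) auto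

lemma avoid_prob_Suc:
  assumes z: "z \<in> S"
  shows "avoid_prob (Suc N) z =
    of_bool (z \<noteq> x) * (\<Sum>\<^sub>cy. indicator S y * (ennreal (J y z) * avoid_prob N y))"
proof -
  have "avoid_prob (Suc N) z = (\<Sum>\<^sub>cy. indicator S y * (ennreal (J y z) *
    (\<integral>\<^sup>+b. \<integral>\<^sup>+h. of_bool ((\<lambda>(b, h). b \<and> z \<noteq> x) (b, h)) \<partial>exp_time (q y) \<partial>avoid.\<nu> N y)))"
    unfolding avoid_prob_def by (rule avoid.nn_integral_\<nu>_Suc[OF z]) simp
  also have "\<dots> = (\<Sum>\<^sub>cy. of_bool (z \<noteq> x) * (indicator S y * (ennreal (J y z) * avoid_prob N y)))"
  proof (rule nn_integral_cong)
    fix y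
    show "indicator S y * (ennreal (J y z) *
      (\<integral>\<^sup>+b. \<integral>\<^sup>+h. of_bool ((\<lambda>(b, h). b \<and> z \<noteq> x) (b, h)) \<partial>exp_time (q y) \<partial>avoid.\<nu> N y)) =
      of_bool (z \<noteq> x) * (indicator S y * (ennreal (J y z) * avoid_prob N y))"
    proof (cases "y \<in> S")
      case True
      interpret E: prob_space "exp_time (q y)" by (rule prob_space_exp_time[OF q_nonneg[OF True]])
      show ?thesis
        using E.emeasure_space_1 by (cases "z = x") (simp_all add: avoid_prob_def)
    qed simp
  qed
  finally show ?thesis by (simp add: nn_integral_cmult)
qed

lemma nn_integral_hold_avoid:
  "(\<integral>\<^sup>+w. of_bool (\<forall>i\<in>{1..N}. Y i w \<noteq> x) * H N w \<partial>P) =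
   (\<Sum>\<^sub>cy. indicator S y * (avoid_prob N y * (\<integral>\<^sup>+h. h \<partial>exp_time (q y))))"
proof -
  let ?Z = "\<lambda>w. \<forall>i\<in>{1..N}. Y i w \<noteq> x"
  have "(\<integral>\<^sup>+w. of_bool (?Z w) * H N w \<partial>P) = (\<Sum>\<^sub>cy. indicator S y *
      (\<integral>\<^sup>+w. indicator {y} (Y N w) * (of_bool (?Z w) * H N w) \<partial>P))"
    by (rule nn_integral_split_state) simp
  also have "\<dots> = (\<Sum>\<^sub>cy. indicator S y * (avoid_prob N y * (\<integral>\<^sup>+h. h \<partial>exp_time (q y))))"
  proof (rule nn_integral_cong)
    fix y
    have f: "(\<lambda>(b, h). of_bool b * h) \<in> borel_measurable (count_space UNIV \<Otimes>\<^sub>M (borel :: ennreal measure))"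
      by (simp add: case_prod_beta')
    show "indicator S y * (\<integral>\<^sup>+w. indicator {y} (Y N w) * (of_bool (?Z w) * H N w) \<partial>P) =
      indicator S y * (avoid_prob N y * (\<integral>\<^sup>+h. h \<partial>exp_time (q y)))"
    proof (cases "y \<in> S")
      case True
      have "(\<integral>\<^sup>+w. indicator {y} (Y N w) * (of_bool (?Z w) * H N w) \<partial>P) =
        (\<integral>\<^sup>+w. indicator {w\<in>space P. Y N w = y \<and> True} w * (\<lambda>(b, h). of_bool b * h) (?Z w, H N w) \<partial>P)"
        by (intro nn_integral_cong) (auto split: split_indicator)
      also have "\<dots> = 1 * (\<integral>\<^sup>+b. \<integral>\<^sup>+h. (\<lambda>(b, h). of_bool b * h) (b, h) \<partial>exp_time (q y) \<partial>avoid.\<nu> N y)"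
        by (rule avoid.nn_integral_step[OF avoid.factorizes_trivial[OF True] f])
      also have "\<dots> = (\<integral>\<^sup>+b. of_bool b * (\<integral>\<^sup>+h. h \<partial>exp_time (q y)) \<partial>avoid.\<nu> N y)"
        unfolding mult_1 by (intro nn_integral_cong) (simp add: nn_integral_cmult)
      also have "\<dots> = avoid_prob N y * (\<integral>\<^sup>+h. h \<partial>exp_time (q y))"
        unfolding avoid_prob_def
        by (rule nn_integral_multc) (simp only: measurable_cong_sets[OF avoid.sets_\<nu> refl], simp)
      finally show ?thesis using True by simp
    qed simp
  qed
  finally show ?thesis .
qed

text \<open>The terms that survive are the holding times before the first return of the jump chain,
  so they add up to a time at which \<open>x\<close> is occupied again. Without a return the sum is
  the explosion time, hence infinite.\<close>

lemma return_time_le: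
  assumes "\<And>i. 0 < H i w" "explosion_time H w = \<infinity>"
  shows "return_time Y H x w \<le> (\<Sum>N. of_bool (\<forall>i\<in>{1..N}. Y i w \<noteq> x) * H N w)" (is "_ \<le> ?sum")
proof (cases "\<exists>k\<ge>1. Y k w = x")
  case False
  then have "?sum = explosion_time H w"
    unfolding explosion_time_def by (intro suminf_cong) auto
  then show ?thesis using assms(2) by simp
next
  case True
  define k where "k = (LEAST k. 1 \<le> k \<and> Y k w = x)"
  have k: "1 \<le> k" "Y k w = x" using LeastI_ex[OF True[simplified]] unfolding k_def by auto
  have least: "Y i w \<noteq> x" if "1 \<le> i" "i < k" for i
    using not_less_Least[of i "\<lambda>k. 1 \<le> k \<and> Y k w = x"] that unfolding k_def by auto
  have "jump_time H k w = (\<Sum>N<k. of_bool (\<forall>i\<in>{1..N}. Y i w \<noteq> x) * H N w)"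
    unfolding jump_time_def using least by (intro sum.cong) auto
  also have "\<dots> \<le> ?sum" by (intro sum_le_suminf) auto
  finally have le: "jump_time H k w \<le> ?sum" .
  have "return_time Y H x w \<le> jump_time H k w"
  proof (cases "jump_time H k w")
    case top then show ?thesis by simp
  next
    case (real t)
    have "H 0 w \<le> jump_time H k w"
      using jump_time_mono[OF k(1), of H w] by (simp add: jump_time_def)
    moreover have "state_at Y H t w = Some x"
      unfolding state_at_eq_Some_iff
    proof (intro exI conjI)
      \<comment> \<open>Positivity of the holding time at index \<open>k\<close> makes
        \<open>x\<close> the state occupied at the jump time itself.\<close>
      show "ennreal t < jump_time H (Suc k) w"
        using real assms(1)[of k]
        by (simp add: jump_time_Suc)
    qed (use real k in auto)
    ultimately show ?thesis
      unfolding return_time_def using real by (intro Inf_lower) auto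
  qed
  with le show ?thesis by simp
qed

end

locale markov_family = conservative_generator S Q
  for S :: "'s::countable set" and Q +
  fixes Pr :: "'s \<Rightarrow> 'w measure" and Y :: "nat \<Rightarrow> 'w \<Rightarrow> 's" and H :: "nat \<Rightarrow> 'w \<Rightarrow> ennreal"
  assumes process: "markov_process S Q Pr Y H"
begin

lemma process_at: "x \<in> S \<Longrightarrow> jump_process S Q x (Pr x) Y H"
  using markov_process_jump_law[OF process] by unfold_locales

text \<open>
  The Laplace transform of the explosion time is bounded by a nonnegative subsolution \<open>L\<close> of
  \<open>(a - Q) L = 0\<close> with \<open>L \<le> 1\<close>.  By the maximum principle \<open>L \<le> \<epsilon> V\<close> for all \<open>\<epsilon> > 0\<close>.
\<close>

lemma non_explosive_Lyapunov:
  fixes V :: "'s \<Rightarrow> real"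
  assumes V: "\<And>y. y \<in> S \<Longrightarrow> 0 \<le> V y" and level: "\<And>c. finite {y\<in>S. V y \<le> c}" and a: "0 < a"
    and drift: "\<And>y. y \<in> S \<Longrightarrow> (\<Sum>z\<in>{z. Q y z \<noteq> 0} - {y}. Q y z * V z) \<le> (a + q y) * V y"
  shows "non_explosive S Pr H"
proof -
  let ?N = "\<lambda>y. {z. Q y z \<noteq> 0} - {y}"
  \<comment> \<open>\<open>e k y\<close> is the Laplace transform at \<open>a\<close> of the
    \<open>k\<close>-th jump time from \<open>y\<close>. It decreases in \<open>k\<close>, and its
    limit \<open>L\<close> dominates the transform of the explosion time.\<close>
  define e where "e = rec_nat (\<lambda>y. 1) (\<lambda>k f y. (\<Sum>z\<in>?N y. Q y z * f z) / (a + q y))"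
  have e0: "e 0 y = 1" for y by (simp add: e_def)
  have e_Suc: "e (Suc k) y = (\<Sum>z\<in>?N y. Q y z * e k z) / (a + q y)" for k y
    by (simp add: e_def)
  have N_S: "z \<in> S" "0 \<le> Q y z" if "y \<in> S" "z \<in> ?N y" for y z
    using that Q_closed Q_nonneg by auto
  have aq: "0 < a + q y" if "y \<in> S" for y using a q_nonneg[OF that] by simp
  have e_nonneg: "0 \<le> e k y" if "y \<in> S" for k y
    using that
  proof (induction k arbitrary: y)
    case (Suc k)
    then show ?case
      unfolding e_Suc using N_S[OF Suc.prems] aq[OF Suc.prems]
      by (intro divide_nonneg_pos sum_nonneg mult_nonneg_nonneg) auto
  qed (simp add: e0)
  have e_dec: "e (Suc k) y \<le> e k y" if "y \<in> S" for k y
    using that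
  proof (induction k arbitrary: y)
    case 0
    then show ?case
      unfolding e_Suc e0 mult_1_right q_eq[OF 0, symmetric] using a aq[OF 0] by simp
  next
    case (Suc k)
    have "(\<Sum>z\<in>?N y. Q y z * e (Suc k) z) \<le> (\<Sum>z\<in>?N y. Q y z * e k z)"
      using N_S[OF Suc.prems] Suc.IH by (intro sum_mono mult_left_mono) auto
    then show ?case
      using aq[OF Suc.prems] unfolding e_Suc[of "Suc k"] e_Suc[of k] by (intro divide_right_mono) auto
  qed
  define L where "L y = lim (\<lambda>k. e k y)" for y
  have lim: "(\<lambda>k. e k y) \<longlonglongrightarrow> L y" if y: "y \<in> S" for y
  proof -
    have "decseq (\<lambda>k. e k y)" using e_dec[OF y] by (simp add: decseq_Suc_iff)
    from decseq_convergent[OF this, of 0] obtain l where "(\<lambda>k. e k y) \<longlonglongrightarrow> l"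
      using e_nonneg[OF y] by blast
    then show ?thesis unfolding L_def by (simp add: limI)
  qed
  have L_nonneg: "0 \<le> L y" if "y \<in> S" for y
    using lim[OF that] e_nonneg[OF that] by (intro LIMSEQ_le_const) auto
  have L_le_1: "L y \<le> 1" if y: "y \<in> S" for y
  proof (rule LIMSEQ_le_const2[OF lim[OF y]])
    have "e k y \<le> 1" for k by (induction k) (use e_dec[OF y] e0 order_trans in \<open>auto, blast\<close>)
    then show "\<exists>N. \<forall>n\<ge>N. e n y \<le> 1" by blast
  qed
  have L_eq: "(a + q y) * L y = (\<Sum>z\<in>?N y. Q y z * L z)" if y: "y \<in> S" for y
  proof -
    have "(\<lambda>k. (a + q y) * e (Suc k) y) \<longlonglongrightarrow> (a + q y) * L y"
      by (intro tendsto_intros LIMSEQ_Suc lim y)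
    moreover have "(\<lambda>k. \<Sum>z\<in>?N y. Q y z * e k z) \<longlonglongrightarrow> (\<Sum>z\<in>?N y. Q y z * L z)"
      by (intro tendsto_intros lim N_S[OF y])
    moreover have "(a + q y) * e (Suc k) y = (\<Sum>z\<in>?N y. Q y z * e k z)" for k
      using aq[OF y] by (simp add: e_Suc)
    ultimately show ?thesis using LIMSEQ_unique by simp
  qed
  have L_V: "L y \<le> \<epsilon> * V y" if y: "y \<in> S" and \<epsilon>: "0 < \<epsilon>" for y \<epsilon>
  proof (rule ccontr)
    assume not: "\<not> L y \<le> \<epsilon> * V y"
    define f where "f z = L z - \<epsilon> * V z" for z
    let ?F = "{z\<in>S. 0 < f z}"
    \<comment> \<open>Since \<open>L \<le> 1\<close>, the function \<open>f\<close> is positive only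
      where \<open>V\<close> is at most \<open>1 / \<epsilon>\<close>, a finite set, so it has a
      positive maximum. There the drift bound yields \<open>(a + q m) * f m \<le> q m * f m\<close>,
      which is impossible.\<close>
    have "V z \<le> 1 / \<epsilon>" if "z \<in> S" "0 < f z" for z
      using that L_le_1[of z] \<epsilon> by (simp add: f_def field_simps)
    then have "?F \<subseteq> {z\<in>S. V z \<le> 1 / \<epsilon>}" by auto
    then have fin: "finite ?F" using level finite_subset by blast
    have ne: "?F \<noteq> {}" using not y by (auto simp: f_def)
    have "Max (f ` ?F) \<in> f ` ?F" using fin ne by (intro Max_in) auto
    then obtain m where m: "m \<in> ?F" and mm: "Max (f ` ?F) = f m" by (rule imageE)
    have max: "f z \<le> f m" if "z \<in> ?F" for z
      unfolding mm[symmetric] using fin that by (intro Max_ge) auto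
    have mS: "m \<in> S" and fm: "0 < f m" using m by auto
    have "(a + q m) * f m = (a + q m) * L m - \<epsilon> * ((a + q m) * V m)"
      by (simp add: f_def algebra_simps)
    also have "\<dots> \<le> (\<Sum>z\<in>?N m. Q m z * L z) - \<epsilon> * (\<Sum>z\<in>?N m. Q m z * V z)"
      using drift[OF mS] \<epsilon> by (simp add: L_eq[OF mS])
    also have "\<dots> = (\<Sum>z\<in>?N m. Q m z * f z)"
      by (simp add: f_def sum_subtractf sum_distrib_left algebra_simps)
    also have "\<dots> \<le> (\<Sum>z\<in>?N m. Q m z * f m)"
    proof (intro sum_mono mult_left_mono)
      fix z assume z: "z \<in> ?N m"
      show "f z \<le> f m" using max[of z] fm N_S[OF mS z] by (cases "0 < f z") auto
    qed (use N_S[OF mS] in auto)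
    also have "\<dots> = q m * f m" using q_eq[OF mS] by (simp add: sum_distrib_right)
    finally have "a * f m \<le> 0" by (simp add: algebra_simps)
    then show False using a fm by (simp add: mult_le_0_iff)
  qed
  have L_0: "L y = 0" if y: "y \<in> S" for y
  proof (rule ccontr)
    assume "L y \<noteq> 0"
    then have L: "0 < L y" using L_nonneg[OF y] by simp
    \<comment> \<open>This choice of \<open>\<epsilon>\<close> puts \<open>\<epsilon> * V y\<close>
      below half of \<open>L y\<close>.\<close>
    have "L y \<le> (L y / (2 * (V y + 1))) * V y"
      using L V[OF y] by (intro L_V[OF y]) auto
    also have "\<dots> < L y"
      using L V[OF y] mult_nonneg_nonneg[of "L y" "V y"] by (simp add: field_simps add_nonneg_pos)
    finally show False by simp
  qed
  show ?thesis
    unfolding non_explosive_def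
  proof
    fix x assume x: "x \<in> S"
    interpret jump_process S Q x "Pr x" Y H by (rule process_at[OF x])
    have [measurable]: "explosion_time H \<in> borel_measurable (Pr x)"
      unfolding explosion_time_def[abs_def] by measurable
    have "(\<integral>\<^sup>+w. laplace a (explosion_time H w) \<partial>Pr x) \<le> ennreal (e k x)" for k
    proof -
      have "(\<integral>\<^sup>+w. laplace a (explosion_time H w) \<partial>Pr x) \<le> (\<integral>\<^sup>+w. laplace a (jump_time H k w) \<partial>Pr x)"
        using a by (intro nn_integral_mono laplace_antimono) (auto simp: explosion_time_SUP intro: SUP_upper)
      also have "\<dots> = ennreal (e k x)"
        by (rule laplace_jump_time[OF a]) (use e0 e_Suc e_nonneg in auto)
      finally show ?thesis .
    qed
    moreover have "(\<lambda>k. ennreal (e k x)) \<longlonglongrightarrow> ennreal 0"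
      using lim[OF x] unfolding L_0[OF x] by (rule tendsto_ennrealI)
    ultimately have "(\<integral>\<^sup>+w. laplace a (explosion_time H w) \<partial>Pr x) \<le> ennreal 0"
      by (intro LIMSEQ_le_const[of "\<lambda>k. ennreal (e k x)"]) auto
    then have "AE w in Pr x. laplace a (explosion_time H w) = 0"
      by (simp add: nn_integral_0_iff_AE)
    then show "AE w in Pr x. explosion_time H w = \<infinity>"
      by (rule eventually_mono) (auto simp: laplace_def split: if_splits)
  qed
qed

end

section \<open>Reversible processes\<close>


lemma nn_integral_count_space_restrict:
  "(\<integral>\<^sup>+x. f x \<partial>count_space A) = (\<Sum>\<^sub>cx. f x * indicator A x)"
  by (simp add: nn_integral_restrict_space[symmetric] restrict_count_space)

context jump_process
begin

lemma emeasure_alive: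
  assumes "0 \<le> t"
  shows "emeasure P {v\<in>space P. \<exists>z\<in>S. state_at Y H t v = Some z} =
    (\<Sum>\<^sub>cz. trans t x z)"
proof -
  have "{v\<in>space P. \<exists>z\<in>S. state_at Y H t v = Some z} =
      (\<Union>z\<in>S. {v\<in>space P. state_at Y H t v = Some z})" by auto
  also have "emeasure P \<dots> = (\<integral>\<^sup>+z. emeasure P {v\<in>space P. state_at Y H t v = Some z} \<partial>count_space S)"
    by (rule emeasure_UN_countable) (auto simp: disjoint_family_on_def)
  also have "\<dots> = (\<integral>\<^sup>+z. trans t x z \<partial>count_space S)"
    using assms by (intro nn_integral_cong emeasure_state_at) auto
  also have "\<dots> = (\<Sum>\<^sub>cz. trans t x z)"
    using trans_reaches[of x _ t] reaches_in_S[OF _ start]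
    by (intro nn_integral_count_space_eq) auto
  finally show ?thesis .
qed

end

text \<open>The weight \<open>w\<close> may have zeros. The substitute for irreducibility is a
  single state \<open>x0\<close> of positive weight that every state reaches.\<close>

locale reversible_family = markov_family S Q Pr Y H
  for S :: "'s::countable set" and Q and Pr :: "'s \<Rightarrow> 'w measure" and Y H +
  fixes w :: "'s \<Rightarrow> real" and x0 :: 's
  assumes w_nonneg: "x \<in> S \<Longrightarrow> 0 \<le> w x"
    and w_sum: "(w has_sum 1) S"
    and balance: "x \<in> S \<Longrightarrow> z \<in> S \<Longrightarrow> z \<noteq> x \<Longrightarrow> w x * Q x z = w z * Q z x"
    and x0: "x0 \<in> S" "0 < w x0"
    and reaches_x0: "x \<in> S \<Longrightarrow> reaches x x0"
    and non_explosive: "non_explosive S Pr H"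
begin

definition W :: "'s \<Rightarrow> ennreal" where
  "W x = indicator S x * ennreal (w x)"

lemma W_balance: "W x * R x z = W z * R z x"
  using balance[of x z] w_nonneg[of x] w_nonneg[of z] Q_nonneg[of x z] Q_nonneg[of z x]
  by (auto simp: W_def R_def ennreal_mult[symmetric])

lemma W_sum: "(\<Sum>\<^sub>cx. W x) = 1"
proof -
  have "(\<integral>\<^sup>+x. ennreal (w x) \<partial>count_space S) = ennreal 1"
    using w_sum has_sum_iff_nn_integral[of S w 1] w_nonneg by blast
  then show ?thesis
    by (simp add: W_def nn_integral_count_space_restrict[of S] mult.commute)
qed

text \<open>The kernel can lose mass only by explosion, which is almost surely excluded.\<close>

lemma trans_total:
  assumes x: "x \<in> S" and t: "0 \<le> t"
  shows "(\<Sum>\<^sub>cz. trans t x z) = 1"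
proof -
  interpret jump_process S Q x "Pr x" Y H by (rule process_at[OF x])
  have "AE v in Pr x. explosion_time H v = \<infinity>"
    using non_explosive x by (simp add: non_explosive_def)
  then have "AE v in Pr x. \<exists>z\<in>S. state_at Y H t v = Some z"
    using AE_regular by eventually_elim (auto simp: state_at_def)
  then have "emeasure (Pr x) {v\<in>space (Pr x). \<exists>z\<in>S. state_at Y H t v = Some z} = 1"
    using AE_space by (intro emeasure_eq_1_AE) (auto elim: eventually_elim2)
  then show ?thesis using emeasure_alive[OF t] by simp
qed

text \<open>By symmetry the weight moves from the summation variable to \<open>z\<close>, and only
  the total mass of \<open>trans\<close> from \<open>z\<close> remains.\<close>

lemma W_stationary:
  assumes t: "0 \<le> t"
  shows "(\<Sum>\<^sub>cx. W x * trans t x z) = W z"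
proof -
  have "(\<Sum>\<^sub>cx. W x * trans t x z) = (\<Sum>\<^sub>cx. W z * trans t z x)"
    using trans_symmetric[of W, OF W_balance] by simp
  also have "\<dots> = W z"
    using trans_total[OF _ t, of z] by (cases "z \<in> S") (simp_all add: nn_integral_cmult W_def)
  finally show ?thesis .
qed

lemma transition_prob_trans:
  assumes "x \<in> S" "z \<in> S" "0 \<le> t"
  shows "ennreal (transition_prob Pr Y H t x z) = trans t x z"
proof -
  interpret jump_process S Q x "Pr x" Y H by (rule process_at[OF assms(1)])
  show ?thesis
    unfolding transition_prob_def emeasure_eq_measure[symmetric] by (rule emeasure_state_at[OF assms(2,3)])
qed

lemma stationary_iff:
  "stationary_distribution S Pr Y H p \<longleftrightarrow> (\<forall>x\<in>S. 0 \<le> p x) \<and>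
    (\<Sum>\<^sub>cx. indicator S x * ennreal (p x)) = 1 \<and>
    (\<forall>t\<ge>0. \<forall>z\<in>S. (\<Sum>\<^sub>cx. (indicator S x * ennreal (p x)) * trans t x z) = ennreal (p z))"
proof (cases "\<forall>x\<in>S. 0 \<le> p x")
  case True
  have 1: "(p has_sum 1) S \<longleftrightarrow> (\<Sum>\<^sub>cx. indicator S x * ennreal (p x)) = 1"
    using True by (subst has_sum_iff_nn_integral)
      (auto simp: nn_integral_count_space_restrict[of S] mult.commute)
  have 2: "((\<lambda>x. p x * transition_prob Pr Y H t x z) has_sum p z) S \<longleftrightarrow>
      (\<Sum>\<^sub>cx. (indicator S x * ennreal (p x)) * trans t x z) = ennreal (p z)"
    if "0 \<le> t" "z \<in> S" for t z
  proof -
    have "(\<integral>\<^sup>+x. ennreal (p x * transition_prob Pr Y H t x z) \<partial>count_space S) =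
      (\<Sum>\<^sub>cx. (indicator S x * ennreal (p x)) * trans t x z)"
      unfolding nn_integral_count_space_restrict[of S]
    proof (rule nn_integral_cong)
      fix x
      show "ennreal (p x * transition_prob Pr Y H t x z) * indicator S x =
          indicator S x * ennreal (p x) * trans t x z"
        using True that transition_prob_trans[of x z t]
        by (cases "x \<in> S") (simp_all add: ennreal_mult transition_prob_def)
    qed
    then show ?thesis
      using True that by (subst has_sum_iff_nn_integral) (auto simp: transition_prob_def)
  qed
  show ?thesis unfolding stationary_distribution_def using True 1 2 by auto
next
  case False then show ?thesis by (auto simp: stationary_distribution_def)
qed

lemma stationary_w: "stationary_distribution S Pr Y H w"
  unfolding stationary_iff using w_nonneg W_sum W_stationary
  by (simp add: W_def[abs_def, symmetric]) (simp add: W_def)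

text \<open>The kernel at time 1 charges \<open>x0\<close> from every state of \<open>S\<close> and
  has unit mass there, as the one-step uniqueness statement demands.\<close>

lemma stationary_unique:
  assumes p: "stationary_distribution S Pr Y H p" and x: "x \<in> S"
  shows "p x = w x"
proof -
  define A where "A x = indicator S x * ennreal (p x)" for x
  note p = p[unfolded stationary_iff A_def[symmetric]]
  have "A = W"
  proof (rule invariant_measure_unique[where K="trans 1" and ?x0.0=x0])
    fix z
    show "(\<Sum>\<^sub>cx. W x * trans 1 x z) = W z" by (rule W_stationary) simp
    show "(\<Sum>\<^sub>cx. A x * trans 1 x z) = A z"
    proof (cases "z \<in> S")
      case True then show ?thesis using p by (simp add: A_def)
    next
      case False
      have "A x * trans 1 x z = 0" for x
        using trans_reaches[of x z 1] reaches_in_S[of x z] False by (cases "x \<in> S") (auto simp: A_def)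
      then show ?thesis using False by (simp only:) (simp add: A_def)
    qed
    assume "A z \<noteq> 0 \<or> W z \<noteq> 0"
    then have "z \<in> S" by (cases "z \<in> S") (auto simp: A_def W_def)
    then show "(\<Sum>\<^sub>cy. trans 1 z y) = 1 \<and> 0 < trans 1 z x0"
      using trans_total[of z 1] trans_pos[OF reaches_x0, of z 1] by simp
  qed (use p W_sum in auto)
  then have "A x = W x" by simp
  then show ?thesis using x p w_nonneg by (simp add: A_def W_def)
qed

section \<open>Time reversal of the finite-dimensional distributions\<close>

lemma path_prob_snoc2:
  "path_prob x u (L @ [(t, y), (s, z)]) = path_prob x u (L @ [(t, y)]) * trans (s - t) y z"
  by (induction L arbitrary: x u) (auto simp: mult.assoc)

text \<open>By stationarity the state at the first observation has law \<open>W\<close> whatever its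
  time, so only the later time differences enter.\<close>

definition start_path :: "(real \<times> 's) list \<Rightarrow> ennreal" where
  "start_path L = W (snd (hd L)) * path_prob (snd (hd L)) (fst (hd L)) (tl L)"

lemma start_path_snoc2:
  "start_path (L @ [(t, y), (s, z)]) = start_path (L @ [(t, y)]) * trans (s - t) y z"
  by (cases L) (auto simp: start_path_def path_prob_snoc2 mult.assoc)

text \<open>The first two observations become the last two of the reversed list. Symmetry of
  \<open>trans\<close> carries the weight from the second state to the first, and \<open>T\<close>
  cancels in time differences.\<close>

lemma start_path_rev:
  "L \<noteq> [] \<Longrightarrow> start_path (rev (map (\<lambda>(t, z). (T - t, z)) L)) = start_path L"
proof (induction L rule: induct_list012)
  case (2 a)
  then show ?case by (simp add: start_path_def case_prod_beta)
next
  case (3 a b L)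
  obtain t y s z where [simp]: "a = (t, y)" "b = (s, z)" by (cases a; cases b)
  have "start_path (rev (map (\<lambda>(t, z). (T - t, z)) (a # b # L))) =
      start_path (rev (map (\<lambda>(t, z). (T - t, z)) (b # L))) * trans (s - t) z y"
    using start_path_snoc2[of "rev (map (\<lambda>(t, z). (T - t, z)) L)" "T - s" z "T - t" y] by simp
  also have "\<dots> = W z * path_prob z s L * trans (s - t) z y"
    using 3(2) by (simp add: start_path_def)
  also have "\<dots> = (W z * trans (s - t) z y) * path_prob z s L"
    by (simp add: ac_simps)
  also have "\<dots> = start_path (a # b # L)"
    using trans_symmetric[of W, OF W_balance, of z "s - t" y] by (simp add: start_path_def mult.assoc)
  finally show ?case .
qed simp

text \<open>Only the set of time-state pairs matters, so repetitions among the indices are harmless.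
  The total mass of \<open>W\<close> bounds \<open>start_path L\<close>, which permits the return
  from \<open>ennreal\<close> to a real sum.\<close>

lemma finite_dim_prob_sorted:
  assumes L: "sorted (map fst L)" "L \<noteq> []" "\<And>t z. (t, z) \<in> set L \<Longrightarrow> 0 \<le> t \<and> z \<in> S"
    and set: "set L = (\<lambda>i. (t i, s i)) ` {..<m}"
  shows "ennreal (finite_dim_prob S Pr Y H w m t s) = start_path L"
proof -
  let ?E = "\<lambda>x. {v\<in>space (Pr x). \<forall>i<m. state_at Y H (t i) v = Some (s i)}"
  have E: "emeasure (Pr x) (?E x) = path_prob x 0 L" if x: "x \<in> S" for x
  proof -
    have "?E x = {v\<in>space (Pr x). \<forall>(t, z)\<in>set L. state_at Y H (t - 0) v = Some z}"
      unfolding set by auto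
    also have "emeasure (Pr x) \<dots> = path_prob x 0 L"
      using L by (intro emeasure_finite_dim process_at x) auto
    finally show ?thesis .
  qed
  obtain u y L' where Lc: "L = (u, y) # L'" using L(2) by (cases L) auto
  have u: "0 \<le> u" using L(3)[of u y] Lc by simp
  let ?f = "\<lambda>x. w x * measure (Pr x) (?E x)"
  have "(\<integral>\<^sup>+x. ennreal (?f x) \<partial>count_space S) = (\<Sum>\<^sub>cx. W x * path_prob x 0 L)"
    unfolding nn_integral_count_space_restrict[of S]
  proof (rule nn_integral_cong)
    fix x
    show "ennreal (?f x) * indicator S x = W x * path_prob x 0 L"
    proof (cases "x \<in> S")
      case True
      interpret jump_process S Q x "Pr x" Y H by (rule process_at[OF True])
      show ?thesis
        using True w_nonneg[OF True] E[OF True]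
        by (simp add: W_def ennreal_mult emeasure_eq_measure)
    qed (simp add: W_def)
  qed
  also have "\<dots> = (\<Sum>\<^sub>cx. (W x * trans u x y) * path_prob y u L')"
    by (simp add: Lc mult.assoc)
  also have "\<dots> = start_path L"
    by (simp add: nn_integral_multc W_stationary[OF u] start_path_def Lc)
  finally have int: "(\<integral>\<^sup>+x. ennreal (?f x) \<partial>count_space S) = start_path L" .
  have "(\<integral>\<^sup>+x. ennreal (?f x) \<partial>count_space S) \<le> (\<Sum>\<^sub>cx. W x)"
    unfolding nn_integral_count_space_restrict[of S]
  proof (rule nn_integral_mono)
    fix x
    show "ennreal (?f x) * indicator S x \<le> W x"
    proof (cases "x \<in> S")
      case True
      interpret jump_process S Q x "Pr x" Y H by (rule process_at[OF True])
      show ?thesis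
        using True w_nonneg[OF True] by (auto simp: W_def intro!: ennreal_leI mult_left_le)
    qed simp
  qed
  then have "start_path L \<noteq> \<infinity>" unfolding int W_sum by (auto simp: top_unique)
  then obtain c where c: "0 \<le> c" "start_path L = ennreal c" by (cases "start_path L") auto
  have "(?f has_sum c) S"
    using c int w_nonneg by (subst has_sum_iff_nn_integral) auto
  then have "finite_dim_prob S Pr Y H w m t s = c"
    unfolding finite_dim_prob_def by (rule infsumI)
  then show ?thesis using c by simp
qed

lemma reversible_w: "reversible S Pr Y H w"
  unfolding reversible_def
proof (intro allI impI)
  fix T and m :: nat and t :: "nat \<Rightarrow> real" and s
  assume ts: "\<forall>i<m. 0 \<le> t i \<and> t i \<le> T \<and> s i \<in> S"
  show "finite_dim_prob S Pr Y H w m t s = finite_dim_prob S Pr Y H w m (\<lambda>i. T - t i) s"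
  proof (cases "m = 0")
    case True then show ?thesis by (simp add: finite_dim_prob_def)
  next
    case False
    \<comment> \<open>The observation times come unordered. Sorting gives the path form, and
      reflecting the times while reversing the list keeps it sorted.\<close>
    define L where "L = sort_key fst (map (\<lambda>i. (t i, s i)) [0..<m])"
    let ?L' = "rev (map (\<lambda>(t, z). (T - t, z)) L)"
    have set: "set L = (\<lambda>i. (t i, s i)) ` {..<m}"
      by (auto simp: L_def)
    have ne: "L \<noteq> []" using False set by (metis image_is_empty lessThan_empty_iff list.set(1) bot_nat_0.extremum_strict bot_nat_def)
    have sorted: "sorted (map fst L)" by (simp add: L_def)
    have 1: "ennreal (finite_dim_prob S Pr Y H w m t s) = start_path L"
      using sorted ne set ts by (intro finite_dim_prob_sorted) auto
    have "map fst ?L' = rev (map (\<lambda>u. T - u) (map fst L))"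
      by (simp add: rev_map case_prod_beta' comp_def)
    moreover have "sorted (rev (map (\<lambda>u. T - u) (map fst L)))"
      using sorted unfolding sorted_wrt_rev
      by (auto simp: sorted_wrt_map elim!: sorted_wrt_mono_rel[rotated])
    ultimately have "sorted (map fst ?L')" by simp
    moreover have "set ?L' = (\<lambda>i. (T - t i, s i)) ` {..<m}"
      by (auto simp: set image_image)
    ultimately have 2: "ennreal (finite_dim_prob S Pr Y H w m (\<lambda>i. T - t i) s) = start_path ?L'"
      using ne ts by (intro finite_dim_prob_sorted) auto
    have nonneg: "0 \<le> finite_dim_prob S Pr Y H w m t s" for t s
      unfolding finite_dim_prob_def using w_nonneg by (intro infsum_nonneg) auto
    show ?thesis
      using 1 2 start_path_rev[OF ne, of T] nonneg by (metis ennreal_inj)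
  qed
qed

text \<open>Multiplying the bound on the visits by the mean holding time cancels the exit rates. As
  \<open>w\<close> sums to 1, the mean return time is at most
  \<open>1 / (w x * q x)\<close>.\<close>

lemma positive_recurrent_state_w:
  assumes x: "x \<in> S" and wx: "0 < w x"
  shows "positive_recurrent_state Q Pr Y H x"
proof (cases "q x = 0")
  case False
  interpret jump_process S Q x "Pr x" Y H by (rule process_at[OF x])
  have qx: "0 < q x" using False q_nonneg[OF x] by simp
  let ?m = "\<lambda>z. W z * ennreal (q z)"
  \<comment> \<open>At \<open>z = x\<close> only the start contributes. Elsewhere one further step
    is bounded by the flow of \<open>?m\<close> into \<open>z\<close>, which balance turns into the
    flow out of \<open>z\<close>.\<close>
  have bound: "?m x * (\<Sum>N<K. avoid_prob N z) \<le> ?m z" if "z \<in> S" for K z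
    using that
  proof (induction K arbitrary: z)
    case (Suc K)
    show ?case
    proof (cases "z = x")
      case True
      then have "avoid_prob (Suc N) z = 0" for N using avoid_prob_Suc[OF Suc.prems] by simp
      then have "(\<Sum>N<Suc K. avoid_prob N z) = 1"
        using True by (simp add: sum.lessThan_Suc_shift avoid_prob_0 del: sum.lessThan_Suc)
      then show ?thesis using True by simp
    next
      case False
      have "(\<Sum>N<Suc K. avoid_prob N z) =
        (\<Sum>N<K. \<Sum>\<^sub>cy. indicator S y * (ennreal (J y z) * avoid_prob N y))"
        using False avoid_prob_Suc[OF Suc.prems]
        by (simp add: sum.lessThan_Suc_shift avoid_prob_0 del: sum.lessThan_Suc)
      also have "\<dots> = (\<Sum>\<^sub>cy. indicator S y * (ennreal (J y z) * (\<Sum>N<K. avoid_prob N y)))"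
        by (simp add: nn_integral_sum[symmetric] sum_distrib_left)
      finally have "?m x * (\<Sum>N<Suc K. avoid_prob N z) =
        (\<Sum>\<^sub>cy. indicator S y * (ennreal (J y z) * (?m x * (\<Sum>N<K. avoid_prob N y))))"
        by (simp add: nn_integral_cmult[symmetric] ac_simps)
      also have "\<dots> \<le> (\<Sum>\<^sub>cy. W z * R z y)"
      proof (rule nn_integral_mono)
        fix y
        show "indicator S y * (ennreal (J y z) * (?m x * (\<Sum>N<K. avoid_prob N y))) \<le> W z * R z y"
        proof (cases "y \<in> S")
          case True
          have "ennreal (J y z) * (?m x * (\<Sum>N<K. avoid_prob N y)) \<le> ennreal (J y z) * ?m y"
            by (intro mult_left_mono Suc.IH True) simp
          also have "\<dots> = W y * R y z"
            using J_R[OF True Suc.prems, symmetric] by (simp add: ac_simps)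
          finally show ?thesis using True by (simp add: W_balance[of y z])
        qed simp
      qed
      also have "\<dots> = ?m z" by (simp add: nn_integral_cmult R_sum[OF Suc.prems])
      finally show ?thesis .
    qed
  qed simp
  have bound': "?m x * (\<Sum>N. avoid_prob N z) \<le> ?m z" if "z \<in> S" for z
  proof -
    have "?m x * (\<Sum>N. avoid_prob N z) = (SUP K. ?m x * (\<Sum>N<K. avoid_prob N z))"
      by (simp only: suminf_eq_SUP SUP_mult_left_ennreal)
    then show ?thesis using bound[OF that] by (simp only:) (intro SUP_least)
  qed
  let ?h = "\<lambda>y. \<integral>\<^sup>+h. h \<partial>exp_time (q y)"
  \<comment> \<open>An absorbing state contributes nothing: \<open>?m y\<close> is 0 there, and 0
    times an infinite mean is 0.\<close>
  have mean: "?m y * ?h y \<le> W y" if y: "y \<in> S" for y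
  proof (cases "q y = 0")
    case False
    then have "0 < q y" using q_nonneg[OF y] by simp
    then show ?thesis
      by (simp add: nn_integral_exp_time_mean mult.assoc ennreal_mult[symmetric])
  qed simp
  have "AE v in Pr x. explosion_time H v = \<infinity>"
    using non_explosive x by (simp add: non_explosive_def)
  then have le: "AE v in Pr x. return_time Y H x v \<le> (\<Sum>N. of_bool (\<forall>i\<in>{1..N}. Y i v \<noteq> x) * H N v)"
    using AE_regular by eventually_elim (rule return_time_le, auto)
  have "?m x * (\<integral>\<^sup>+v. return_time Y H x v \<partial>Pr x) \<le>
      ?m x * (\<integral>\<^sup>+v. (\<Sum>N. of_bool (\<forall>i\<in>{1..N}. Y i v \<noteq> x) * H N v) \<partial>Pr x)"
    by (intro mult_left_mono nn_integral_mono_AE le) simp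
  also have "\<dots> = ?m x * (\<Sum>N. \<Sum>\<^sub>cy. indicator S y * (avoid_prob N y * ?h y))"
    by (subst nn_integral_suminf) (simp_all only: nn_integral_hold_avoid, measurable)
  also have "\<dots> = (\<Sum>\<^sub>cy. indicator S y * ((?m x * (\<Sum>N. avoid_prob N y)) * ?h y))"
  proof -
    have "(\<Sum>N. \<Sum>\<^sub>cy. indicator S y * (avoid_prob N y * ?h y)) =
        (\<Sum>\<^sub>cy. indicator S y * ((\<Sum>N. avoid_prob N y) * ?h y))"
      by (subst nn_integral_suminf[symmetric], simp) (simp only: ennreal_suminf_cmult ennreal_suminf_multc)
    then show ?thesis
      by (simp only:) (subst nn_integral_cmult[symmetric], simp, simp only: ac_simps)
  qed
  also have "\<dots> \<le> (\<Sum>\<^sub>cy. W y)"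
  proof (rule nn_integral_mono)
    fix y
    show "indicator S y * ((?m x * (\<Sum>N. avoid_prob N y)) * ?h y) \<le> W y"
    proof (cases "y \<in> S")
      case True
      have "(?m x * (\<Sum>N. avoid_prob N y)) * ?h y \<le> ?m y * ?h y"
        by (intro mult_right_mono bound'[OF True]) simp
      also have "\<dots> \<le> W y" by (rule mean[OF True])
      finally show ?thesis using True by simp
    qed simp
  qed
  also have "\<dots> = 1" by (rule W_sum)
  finally have "?m x * (\<integral>\<^sup>+v. return_time Y H x v \<partial>Pr x) \<le> 1" .
  moreover have "?m x \<noteq> 0" using x wx qx by (simp add: W_def)
  ultimately have "(\<integral>\<^sup>+v. return_time Y H x v \<partial>Pr x) \<noteq> \<infinity>"
    by (auto simp: ennreal_mult_top top_unique)
  then show ?thesis by (simp add: positive_recurrent_state_def top.not_eq_extremum)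
qed (simp add: positive_recurrent_state_def)

text \<open>Weight times rate is symmetric, so an edge of positive rate out of a charged state ends
  in a charged state and can be traversed backwards.\<close>

lemma reaches_reverse:
  assumes "reaches x z" "0 < W x" shows "0 < W z \<and> reaches z x"
  using assms unfolding reaches_def
proof (induction rule: rtranclp_induct)
  case (step y z)
  then have "0 < W y * R y z" by (simp add: ennreal_zero_less_mult_iff)
  then have "0 < W z * R z y" by (simp add: W_balance)
  then have "0 < W z" "0 < R z y" by (simp_all add: ennreal_zero_less_mult_iff)
  then show ?case using step by (auto intro: converse_rtranclp_into_rtranclp)
qed simp

text \<open>Every charged state reaches \<open>x0\<close>, and by reversal \<open>x0\<close> reaches
  it, so any two charged states communicate through \<open>x0\<close>.\<close>

lemma closed_class_support: "closed_class S Q {x\<in>S. 0 < w x}"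
  unfolding closed_class_def
proof (intro conjI ballI)
  show "{x\<in>S. 0 < w x} \<noteq> {}" using x0 by auto
  show "Q x z = 0" if "x \<in> {x\<in>S. 0 < w x}" "z \<in> S - {x\<in>S. 0 < w x}" for x z
    using that balance[of x z] w_nonneg[of z] by (cases "z = x") auto
  have edge: "(\<lambda>x z. 0 < R x z) = (\<lambda>u v. u \<in> S \<and> v \<in> S \<and> u \<noteq> v \<and> 0 < Q u v)"
    by (auto simp: R_def fun_eq_iff)
  show "(\<lambda>u v. u \<in> S \<and> v \<in> S \<and> u \<noteq> v \<and> 0 < Q u v)\<^sup>*\<^sup>* x z"
    if "x \<in> {x\<in>S. 0 < w x}" "z \<in> {x\<in>S. 0 < w x}" for x z
  proof -
    have "reaches x x0" using that by (intro reaches_x0) simp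
    moreover have "reaches x0 z"
      using that reaches_reverse[of z x0] reaches_x0[of z] by (simp add: W_def)
    ultimately show ?thesis unfolding edge[symmetric] reaches_def by (rule rtranclp_trans)
  qed
qed auto

section \<open>Hitting the support from states of weight zero\<close>

text \<open>The probability that \<open>x0\<close> is avoided at the times \<open>1, \<dots>, K\<close>.\<close>

primrec miss :: "nat \<Rightarrow> 's \<Rightarrow> ennreal" where
  "miss 0 x = 1"
| "miss (Suc K) x = (\<Sum>\<^sub>cy. of_bool (y \<noteq> x0) * (trans 1 x y * miss K y))"

lemma emeasure_miss:
  fixes P :: "'v measure"
  assumes "x \<in> S" "jump_process S Q x P Y' H'"
  shows "emeasure P {v\<in>space P. \<forall>i\<in>{1..K}. state_at Y' H' (real i) v \<noteq> Some x0} = miss K x"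
  using assms
proof (induction K arbitrary: x P Y' H')
  case 0
  interpret jump_process S Q x P Y' H' by fact
  show ?case using emeasure_space_1 by simp
next
  case (Suc K)
  interpret jump_process S Q x P Y' H' by fact
  let ?B = "\<lambda>K Y H v. \<forall>i\<in>{1..K}. state_at Y H (real i) v \<noteq> Some x0"
  let ?A = "\<lambda>y. {v\<in>space P. state_at Y' H' 1 v = Some y \<and> ?B K (later_Y Y' H' 1) (later_H H' 1) v}"
  have 1: "emeasure P {v\<in>space P. \<exists>y\<in>S. state_at Y' H' 1 v = Some y} = 1"
    using emeasure_alive[of 1] trans_total[OF start, of 1] by simp
  have alive: "AE v in P. \<exists>y\<in>S. state_at Y' H' 1 v = Some y"
    using AE_prob_1[OF measure_eq_emeasure_eq_ennreal[OF _ 1[folded ennreal_1]]]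
    by (auto elim: eventually_mono)
  have A: "emeasure P (?A y) = trans 1 x y * miss K y" if y: "y \<in> S" for y
  proof (rule emeasure_state_at_and_later[OF Suc.prems(2) y])
    fix P' :: "'v measure" and Y'' H'' assume P': "jump_process S Q y P' Y'' H''"
    interpret P': jump_process S Q y P' Y'' H'' by fact
    show "Measurable.pred P' (?B K Y'' H'') \<and> emeasure P' {w\<in>space P'. ?B K Y'' H'' w} = miss K y"
      using Suc.IH[OF y P'] by simp
  qed simp
  \<comment> \<open>The restarted process is translated back to absolute times, where measurability
    is known.\<close>
  have A_sets: "?A y \<in> sets P" if y: "y \<in> S" for y
  proof -
    have "?A y = {v\<in>space P. state_at Y' H' 1 v = Some y \<and>
        (\<forall>i\<in>{1..K}. state_at Y' H' (1 + real i) v \<noteq> Some x0)}"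
      using state_at_later[of Y' H' 1 _ y] by auto
    then show ?thesis by simp
  qed
  have "emeasure P {v\<in>space P. ?B (Suc K) Y' H' v} = emeasure P (\<Union>y\<in>S - {x0}. ?A y)"
  proof (rule emeasure_eq_AE)
    show "(\<Union>y\<in>S - {x0}. ?A y) \<in> sets P" using A_sets by (intro sets.countable_UN') auto
    have iff: "?B (Suc K) Y' H' v \<longleftrightarrow> y \<noteq> x0 \<and> ?B K (later_Y Y' H' 1) (later_H H' 1) v"
      if y: "state_at Y' H' 1 v = Some y" for v y
    proof -
      have shift: "(\<forall>i\<in>{1..Suc K}. f i) \<longleftrightarrow> f 1 \<and> (\<forall>i\<in>{1..K}. f (Suc i))" for f
      proof (intro iffI ballI)
        fix i assume f: "f 1 \<and> (\<forall>i\<in>{1..K}. f (Suc i))" and i: "i \<in> {1..Suc K}"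
        show "f i"
        proof (cases "i = 1")
          case False
          then have "i - 1 \<in> {1..K}" "Suc (i - 1) = i" using i by auto
          then show ?thesis using f by metis
        qed (use f in simp)
      qed auto
      show ?thesis
        unfolding shift using y state_at_later[OF y, of "real _" x0] by simp
    qed
    show "AE v in P. v \<in> {v\<in>space P. ?B (Suc K) Y' H' v} \<longleftrightarrow> v \<in> (\<Union>y\<in>S - {x0}. ?A y)"
      using alive
    proof eventually_elim
      case (elim v)
      then obtain y where "y \<in> S" "state_at Y' H' 1 v = Some y" by blast
      with iff[of v y] show ?case by auto
    qed
  qed simp
  also have "\<dots> = (\<integral>\<^sup>+y. emeasure P (?A y) \<partial>count_space (S - {x0}))"
    using A_sets by (intro emeasure_UN_countable) (auto simp: disjoint_family_on_def)
  also have "\<dots> = (\<integral>\<^sup>+y. trans 1 x y * miss K y \<partial>count_space (S - {x0}))"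
    by (intro nn_integral_cong A) auto
  also have "\<dots> = miss (Suc K) x"
  proof -
    have zero: "trans 1 x y = 0" if "y \<notin> S" for y
      using trans_reaches reaches_in_S[OF _ start] that by blast
    show ?thesis
      by (auto simp: nn_integral_count_space_restrict[of "S - {x0}"] zero
          intro!: nn_integral_cong split: split_indicator)
  qed
  finally show ?case .
qed

text \<open>On a finite set the chance of being in \<open>x0\<close> one time unit later has a
  positive minimum \<open>\<delta>\<close>, so missing \<open>x0\<close> at the times 1 to
  \<open>K\<close> has probability at most \<open>(1 - \<delta>) ^ K\<close>.\<close>

lemma hits_support_finite:
  assumes x: "x \<in> S" and fin: "finite {z. reaches x z}"
  shows "AE v in Pr x. \<exists>t\<ge>0. state_at Y H t v = Some x0"
proof -
  interpret jump_process S Q x "Pr x" Y H by (rule process_at[OF x])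
  let ?C = "{z. reaches x z}"
  define \<delta> where "\<delta> = Min ((\<lambda>z. trans 1 z x0) ` ?C)"
  have CS: "z \<in> S" if "z \<in> ?C" for z using that reaches_in_S x by blast
  have "\<delta> \<in> (\<lambda>z. trans 1 z x0) ` ?C"
    unfolding \<delta>_def using fin by (intro Min_in) (auto intro: exI[of _ x])
  then have \<delta>: "0 < \<delta>" using trans_pos[OF reaches_x0] CS by auto
  have miss: "miss K z \<le> (1 - \<delta>) ^ K" if "z \<in> ?C" for K z
    using that
  proof (induction K arbitrary: z)
    case (Suc K)
    have "miss (Suc K) z \<le> (\<Sum>\<^sub>cy. of_bool (y \<noteq> x0) * trans 1 z y * (1 - \<delta>) ^ K)"
      unfolding miss.simps
    proof (rule nn_integral_mono)
      fix y
      show "of_bool (y \<noteq> x0) * (trans 1 z y * miss K y) \<le> of_bool (y \<noteq> x0) * trans 1 z y * (1 - \<delta>) ^ K"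
      proof (cases "reaches z y")
        case True
        then have "y \<in> ?C" using Suc.prems by (auto simp: reaches_def)
        then show ?thesis using Suc.IH by (auto intro: mult_left_mono)
      qed (simp add: trans_reaches)
    qed
    also have "\<dots> = (\<Sum>\<^sub>cy. of_bool (y \<noteq> x0) * trans 1 z y) * (1 - \<delta>) ^ K"
      by (simp add: nn_integral_multc)
    also have "(\<Sum>\<^sub>cy. of_bool (y \<noteq> x0) * trans 1 z y) \<le> 1 - \<delta>"
    proof -
      have "\<delta> \<le> trans 1 z x0" unfolding \<delta>_def using fin Suc.prems by (intro Min_le) auto
      also have "trans 1 z x0 = (\<Sum>\<^sub>cy. of_bool (y = x0) * trans 1 z y)"
        by (subst nn_integral_count_space_single[of x0]) auto
      finally have "(\<Sum>\<^sub>cy. of_bool (y \<noteq> x0) * trans 1 z y) + \<delta> \<le>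
        (\<Sum>\<^sub>cy. of_bool (y \<noteq> x0) * trans 1 z y) +
        (\<Sum>\<^sub>cy. of_bool (y = x0) * trans 1 z y)"
        by (intro add_left_mono)
      also have "\<dots> = (\<Sum>\<^sub>cy. trans 1 z y)"
        by (subst nn_integral_add[symmetric]) (auto intro!: nn_integral_cong)
      also have "\<dots> = 1" using trans_total[OF CS[OF Suc.prems], of 1] by simp
      finally have *: "(\<Sum>\<^sub>cy. of_bool (y \<noteq> x0) * trans 1 z y) + \<delta> \<le> 1" .
      then show ?thesis by (simp add: ennreal_le_minus_iff)
    qed
    finally show ?case by (simp add: mult_right_mono)
  qed simp
  let ?E = "{v\<in>space (Pr x). \<forall>i\<ge>1. state_at Y H (real i) v \<noteq> Some x0}"
  have "emeasure (Pr x) ?E \<le> (1 - \<delta>) ^ K" for K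
  proof -
    have "emeasure (Pr x) ?E \<le> emeasure (Pr x) {v\<in>space (Pr x). \<forall>i\<in>{1..K}. state_at Y H (real i) v \<noteq> Some x0}"
      by (intro emeasure_mono) auto
    also have "\<dots> = miss K x" by (rule emeasure_miss[OF x process_at[OF x]])
    also have "\<dots> \<le> (1 - \<delta>) ^ K" by (rule miss) simp
    finally show ?thesis .
  qed
  moreover have "(\<lambda>K. (1 - \<delta>) ^ K) \<longlonglongrightarrow> 0"
  proof -
    obtain d where d: "1 - \<delta> = ennreal d" "0 \<le> d" by (cases "1 - \<delta>") (auto simp: ennreal_minus_eq_top)
    have "ennreal d < 1" unfolding d(1)[symmetric] using ennreal_between[OF \<delta>, of 1] by simp
    then have "d < 1" using d(2) by (simp add: ennreal_less_one_iff)
    then have "(\<lambda>K. ennreal (d ^ K)) \<longlonglongrightarrow> ennreal 0"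
      using d(2) by (intro tendsto_ennrealI LIMSEQ_realpow_zero) auto
    then show ?thesis using d by (simp add: ennreal_power)
  qed
  ultimately have "emeasure (Pr x) ?E \<le> 0"
    by (intro LIMSEQ_le_const[of "\<lambda>K. (1 - \<delta>) ^ K"]) auto
  then have "AE v in Pr x. v \<notin> ?E"
    by (intro AE_not_in) (auto simp: null_sets_def)
  then show ?thesis
    using AE_space by eventually_elim (use of_nat_0_le_iff in blast)
qed

lemma positive_recurrent_w:
  assumes fin: "\<And>x. x \<in> S \<Longrightarrow> w x = 0 \<Longrightarrow> finite {z. reaches x z}"
  shows "positive_recurrent S Q Pr Y H"
  unfolding positive_recurrent_def
proof (intro exI[of _ "{x\<in>S. 0 < w x}"] conjI ballI)
  show "closed_class S Q {x\<in>S. 0 < w x}" by (rule closed_class_support)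
  show "positive_recurrent_state Q Pr Y H x" if "x \<in> {x\<in>S. 0 < w x}" for x
    using that by (intro positive_recurrent_state_w) auto
  fix x assume x: "x \<in> S"
  interpret jump_process S Q x "Pr x" Y H by (rule process_at[OF x])
  show "AE v in Pr x. \<exists>t\<ge>0. \<exists>z\<in>{x\<in>S. 0 < w x}. state_at Y H t v = Some z"
  proof (cases "w x = 0")
    case True
    from hits_support_finite[OF x fin[OF x True]] show ?thesis
      by (rule eventually_mono) (use x0 in blast)
  next
    case False
    with w_nonneg[OF x] have wx: "0 < w x" by simp
    show ?thesis
      using AE_regular
    proof eventually_elim
      case (elim v)
      have "state_at Y H 0 v = Some x"
        unfolding state_at_eq_Some_iff using elim by (intro exI[of _ 0]) (auto simp: jump_time_Suc)
      then show ?case using x wx by (intro exI[of _ 0]) auto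
    qed
  qed
qed

end

section \<open>The network\<close>


text \<open>The additive form avoids truncated subtraction of natural numbers.\<close>

lemma sum_fun_upd:
  fixes v :: "'a::finite \<Rightarrow> nat"
  shows "(\<Sum>s\<in>UNIV. (v(p := m)) s) + v p = (\<Sum>s\<in>UNIV. v s) + m"
proof -
  have "(\<Sum>s\<in>UNIV - {p}. (v(p := m)) s) = (\<Sum>s\<in>UNIV - {p}. v s)"
    by (intro sum.cong) auto
  then show ?thesis
    using sum.remove[of UNIV p "v(p := m)"] sum.remove[of UNIV p v] by simp
qed

lemma sum_incr: "(\<Sum>s\<in>UNIV. incr p v s) = (\<Sum>s\<in>UNIV. v s) + 1" for v :: "'a::finite \<Rightarrow> nat"
  using sum_fun_upd[of v p "v p + 1"] by (simp add: incr_def)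

lemma incr_decr: "1 \<le> v p \<Longrightarrow> incr p (decr p v) = v"
  by (auto simp: incr_def decr_def)

lemma sum_decr: "1 \<le> v p \<Longrightarrow> (\<Sum>s\<in>UNIV. decr p v s) + 1 = (\<Sum>s\<in>UNIV. v s)"
  for v :: "'a::finite \<Rightarrow> nat"
  using sum_incr[of p "decr p v"] by (simp add: incr_decr)

lemma sum_transfer: "1 \<le> v k \<Longrightarrow> (\<Sum>s\<in>UNIV. transfer k l v s) = (\<Sum>s\<in>UNIV. v s)"
  for v :: "'a::finite \<Rightarrow> nat"
  using sum_decr[of v k] by (simp add: transfer_def sum_incr)

lemma transfer_back: "k \<noteq> l \<Longrightarrow> 1 \<le> v k \<Longrightarrow> transfer l k (transfer k l v) = v"
  by (auto simp: transfer_def incr_def decr_def)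

lemma transfer_apply:
  "k \<noteq> l \<Longrightarrow> transfer k l v k = v k - 1" "k \<noteq> l \<Longrightarrow> transfer k l v l = v l + 1"
  "s \<noteq> k \<Longrightarrow> s \<noteq> l \<Longrightarrow> transfer k l v s = v s"
  by (auto simp: transfer_def incr_def decr_def)

text \<open>Each move between two sites is undone by exactly the opposite move, which is what
  matches the terms of the two sides of detailed balance.\<close>

lemma transfer_eq_iff:
  "k \<noteq> l \<Longrightarrow> (1 \<le> v k \<and> v' = transfer k l v) \<longleftrightarrow> (1 \<le> v' l \<and> v = transfer l k v')"
  using transfer_back[of k l v] transfer_back[of l k v'] transfer_apply(2)[of k l v] transfer_apply(2)[of l k v']
  by auto

lemma incr_eq_iff: "v' = incr p v \<longleftrightarrow> 1 \<le> v' p \<and> v = decr p v'"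
  using incr_decr[of v' p] by (auto simp: incr_def decr_def)

lemma finite_bounded_configs:
  "finite {v :: 'a::finite \<Rightarrow> nat. (\<Sum>s\<in>UNIV. v s) \<le> N}"
proof (rule finite_subset)
  show "{v :: 'a \<Rightarrow> nat. (\<Sum>s\<in>UNIV. v s) \<le> N} \<subseteq> PiE UNIV (\<lambda>_. {..N})"
  proof (intro subsetI PiE_I)
    fix v :: "'a \<Rightarrow> nat" and i
    assume "v \<in> {v. (\<Sum>s\<in>UNIV. v s) \<le> N}"
    then show "v i \<in> {..N}" using member_le_sum[of i UNIV v] by simp
  qed simp
  show "finite (PiE (UNIV :: 'a set) (\<lambda>_. {..N}))" by (rule finite_PiE) auto
qed

lemma sum_offdiagonal_swap:
  fixes g :: "'a::finite \<Rightarrow> 'a \<Rightarrow> real"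
  shows "(\<Sum>k\<in>UNIV. \<Sum>l\<in>UNIV - {k}. g k l) = (\<Sum>k\<in>UNIV. \<Sum>l\<in>UNIV - {k}. g l k)"
proof -
  have *: "(\<Sum>l\<in>UNIV - {k}. f l) = (\<Sum>l\<in>UNIV. if l = k then 0 else f l)" for f :: "'a \<Rightarrow> real" and k
    by (rule sum.mono_neutral_cong_left) auto
  have "(\<Sum>k\<in>UNIV. \<Sum>l\<in>UNIV. if l = k then 0 else g k l) =
      (\<Sum>l\<in>UNIV. \<Sum>k\<in>UNIV. if l = k then 0 else g k l)"
    by (rule sum.swap)
  then show ?thesis unfolding * by (simp add: eq_commute)
qed

lemma of_bool_one: "P \<Longrightarrow> of_bool P = (1 :: real)" and of_bool_zero: "\<not> P \<Longrightarrow> of_bool P = (0 :: real)"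
  by simp_all

lemma transfer_sum_nonzero:
  fixes g :: "'a::finite \<Rightarrow> 'a \<Rightarrow> real"
  assumes "(\<Sum>k\<in>UNIV. \<Sum>l\<in>UNIV - {k}. of_bool (A \<and> 1 \<le> v k \<and> v' = transfer k l v) * g k l) \<noteq> 0"
  obtains k l where "l \<noteq> k" A "1 \<le> v k" "v' = transfer k l v"
proof -
  from assms obtain k where "(\<Sum>l\<in>UNIV - {k}. of_bool (A \<and> 1 \<le> v k \<and> v' = transfer k l v) * g k l) \<noteq> 0"
    by (rule sum.not_neutral_contains_not_neutral)
  then obtain l where "l \<in> UNIV - {k}" "of_bool (A \<and> 1 \<le> v k \<and> v' = transfer k l v) * g k l \<noteq> 0"
    by (rule sum.not_neutral_contains_not_neutral)
  then show ?thesis by (intro that[of l k]) (auto split: if_splits)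
qed

text \<open>Exchanging \<open>k\<close> and \<open>l\<close> pairs each move with its inverse, so
  the balance of the sums reduces to that of a single move. \<open>A\<close> and \<open>B\<close>
  are the conditions on the component that stays fixed.\<close>

lemma transfer_sum_balance:
  fixes g h :: "'a::finite \<Rightarrow> 'a \<Rightarrow> real"
  assumes AB: "A \<longleftrightarrow> B"
    and eq: "\<And>k l. l \<noteq> k \<Longrightarrow> A \<Longrightarrow> 1 \<le> v k \<Longrightarrow> v' = transfer k l v \<Longrightarrow> a * g k l = b * h l k"
  shows "a * (\<Sum>k\<in>UNIV. \<Sum>l\<in>UNIV - {k}. of_bool (A \<and> 1 \<le> v k \<and> v' = transfer k l v) * g k l) =
    b * (\<Sum>k\<in>UNIV. \<Sum>l\<in>UNIV - {k}. of_bool (B \<and> 1 \<le> v' k \<and> v = transfer k l v') * h k l)"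
proof -
  have *: "a * (of_bool (A \<and> 1 \<le> v k \<and> v' = transfer k l v) * g k l) =
      b * (of_bool (B \<and> 1 \<le> v' l \<and> v = transfer l k v') * h l k)" if kl: "l \<noteq> k" for k l
  proof (cases "A \<and> 1 \<le> v k \<and> v' = transfer k l v")
    case True
    then have "B \<and> 1 \<le> v' l \<and> v = transfer l k v'"
      using AB transfer_eq_iff[of k l v v'] kl by blast
    then show ?thesis
      unfolding of_bool_one[OF True] using eq[OF kl] True by (subst of_bool_one) simp_all
  next
    case False
    then have "\<not> (B \<and> 1 \<le> v' l \<and> v = transfer l k v')"
      using AB transfer_eq_iff[of k l v v'] kl by blast
    then show ?thesis unfolding of_bool_zero[OF False] by (subst of_bool_zero) simp_all
  qed
  have "(\<Sum>k\<in>UNIV. \<Sum>l\<in>UNIV - {k}. a * (of_bool (A \<and> 1 \<le> v k \<and> v' = transfer k l v) * g k l)) =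
      (\<Sum>k\<in>UNIV. \<Sum>l\<in>UNIV - {k}. b * (of_bool (B \<and> 1 \<le> v' l \<and> v = transfer l k v') * h l k))"
    by (intro sum.cong refl *) simp
  also have "\<dots> = (\<Sum>k\<in>UNIV. \<Sum>l\<in>UNIV - {k}. b * (of_bool (B \<and> 1 \<le> v' k \<and> v = transfer k l v') * h k l))"
    by (rule sum_offdiagonal_swap)
  finally show ?thesis unfolding sum_distrib_left .
qed

locale task_network =
  fixes M :: nat
    and lam mu :: "'a::finite intensity"
    and gam :: "'a \<Rightarrow> nat \<Rightarrow> real"
    and beta theta eps :: "'a array"
    and tau :: "'a \<Rightarrow> 'a \<Rightarrow> ('a \<Rightarrow> nat) \<Rightarrow> ('a \<Rightarrow> nat) \<Rightarrow> real"
  assumes lam_nonneg: "\<And>i n y. 0 \<le> lam i n y"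
    and lam_sup: "\<exists>K. \<forall>i n y. lam i n y \<le> K"
    and mu_inf: "\<exists>c>0. \<forall>i n y. 1 \<le> n \<longrightarrow> c \<le> mu i n y"
    and lam_pos: "\<And>i n y. 0 < lam i (n + 1) y \<Longrightarrow> 0 < lam i n y"
    and gam_nonneg: "\<And>i n. 0 \<le> gam i n"
    and gam_pos: "\<And>i n. 0 < gam i (n + 1) \<Longrightarrow> 0 < gam i n"
    and gam_bar_pos:
      "\<And>y n j j'. (\<Sum>s\<in>UNIV. y s) = M \<Longrightarrow> 1 \<le> y j \<Longrightarrow> j' \<noteq> j \<Longrightarrow>
         0 < gam_bar gam j (n j) \<and> 0 < gam_bar gam j' (n j')"
    and beta_irred:
      "\<And>k l a b y. k \<noteq> l \<Longrightarrow> y k = 0 \<Longrightarrow> y l = 0 \<Longrightarrow> 0 < beta k l a b y"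
    and theta_irred:
      "\<And>j k a b y. 1 \<le> y j \<Longrightarrow> y k = 0 \<Longrightarrow> 0 < theta j k a b y \<and> 0 < theta k j a b y"
    and eps_irred:
      "\<And>i j a b y. i \<noteq> j \<Longrightarrow> 1 \<le> y i \<Longrightarrow> 1 \<le> y j \<Longrightarrow> 0 < eps i j a b y"
    and tau_irred:
      "\<And>j j' n y. 1 \<le> y j \<Longrightarrow> j' \<noteq> j \<Longrightarrow> 0 < tau j j' n y"
    and beta_balance:
      "\<And>k l n y. k \<noteq> l \<Longrightarrow> y k = 0 \<Longrightarrow> y l = 0 \<Longrightarrow> 1 \<le> n k \<Longrightarrow>
         lam k (n k - 1) y / mu k (n k) y * beta k l (n k) (n l) y =
         lam l (n l) y / mu l (n l + 1) y * beta l k (n l + 1) (n k - 1) y"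
    and theta_balance:
      "\<And>j k n y. 1 \<le> y j \<Longrightarrow> y k = 0 \<Longrightarrow> 1 \<le> n j \<Longrightarrow>
         lam j (n j - 1) y / mu j (n j) y * theta j k (n j) (n k) y =
         lam k (n k) y / mu k (n k + 1) y * theta k j (n k + 1) (n j - 1) y"
    and eps_balance:
      "\<And>i j n y. i \<noteq> j \<Longrightarrow> 1 \<le> y i \<Longrightarrow> 1 \<le> y j \<Longrightarrow> 1 \<le> n i \<Longrightarrow>
         lam i (n i - 1) y * gam i (n i - 1) ^ y i / mu i (n i) y * eps i j (n i) (n j) y =
         lam j (n j) y * gam j (n j) ^ y j / mu j (n j + 1) y * eps j i (n j + 1) (n i - 1) y"
    and tau_balance:
      "\<And>j j' n y. 1 \<le> y j \<Longrightarrow> j' \<noteq> j \<Longrightarrow>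
         tau j j' n y * (\<Prod>q\<in>UNIV. lam_bar lam q (n q) y / mu_bar mu q (n q) y) =
         tau j' j n (transfer j j' y) *
           (\<Prod>q\<in>UNIV. lam_bar lam q (n q) (transfer j j' y) / mu_bar mu q (n q) (transfer j j' y))"
    and U_finite:
      "\<And>y l. (\<Sum>s\<in>UNIV. y s) = M \<Longrightarrow> y l = 0 \<Longrightarrow> summable (U_term lam mu y l)"
    and C_finite:
      "\<And>y r. (\<Sum>s\<in>UNIV. y s) = M \<Longrightarrow> 1 \<le> y r \<Longrightarrow> summable (C_term lam mu gam y r)"
begin

section \<open>The four kinds of moves and the generator of the network\<close>

abbreviation S :: "'a config set" where "S \<equiv> states M"

abbreviation Rate :: "'a config \<Rightarrow> 'a config \<Rightarrow> real" where
  "Rate \<equiv> rate lam mu gam beta theta eps tau"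

abbreviation Gen :: "'a config \<Rightarrow> 'a config \<Rightarrow> real" where
  "Gen \<equiv> generator lam mu gam beta theta eps tau"

definition arrival :: "'a config \<Rightarrow> 'a config \<Rightarrow> real" where
  "arrival = (\<lambda>(y, n) (y', n').
     \<Sum>p\<in>UNIV. of_bool (y' = y \<and> n' = incr p n) * (lam p (n p) y * gam p (n p) ^ y p))"

definition departure :: "'a config \<Rightarrow> 'a config \<Rightarrow> real" where
  "departure = (\<lambda>(y, n) (y', n').
     \<Sum>p\<in>UNIV. of_bool (y' = y \<and> 1 \<le> n p \<and> n' = decr p n) * mu p (n p) y)"

definition task_move :: "'a config \<Rightarrow> 'a config \<Rightarrow> real" where
  "task_move = (\<lambda>(y, n) (y', n'). \<Sum>k\<in>UNIV. \<Sum>l\<in>UNIV - {k}.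
     of_bool (y' = y \<and> 1 \<le> n k \<and> n' = transfer k l n) * task_rate gam beta theta eps k l y n)"

definition customer_rate :: "'a \<Rightarrow> 'a \<Rightarrow> ('a \<Rightarrow> nat) \<Rightarrow> ('a \<Rightarrow> nat) \<Rightarrow> real" where
  "customer_rate j j' y n = inverse (gam_bar gam j (n j) ^ y j) * tau j j' n y *
     inverse (gam_bar gam j' (n j') ^ y j')"

definition customer_move :: "'a config \<Rightarrow> 'a config \<Rightarrow> real" where
  "customer_move = (\<lambda>(y, n) (y', n'). \<Sum>j\<in>UNIV. \<Sum>j'\<in>UNIV - {j}.
     of_bool (n' = n \<and> 1 \<le> y j \<and> y' = transfer j j' y) * customer_rate j j' y n)"

lemma rate_split: "Rate x z = arrival x z + departure x z + task_move x z + customer_move x z"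
  by (cases x; cases z)
    (simp add: rate_def arrival_def departure_def task_move_def customer_move_def customer_rate_def)

lemma mu_pos: "1 \<le> n \<Longrightarrow> 0 < mu i n y"
  using mu_inf by (meson less_le_trans)

lemma gam_bar_nonneg: "0 \<le> gam_bar gam i n"
  unfolding gam_bar_def by (intro prod_nonneg) (simp add: gam_nonneg)

lemma task_rate_nonneg: "k \<noteq> l \<Longrightarrow> 0 \<le> task_rate gam beta theta eps k l y n"
  using beta_irred[of k l y "n k" "n l"] eps_irred[of k l y "n k" "n l"]
    theta_irred[of y k l "n k" "n l"] theta_irred[of y l k "n k" "n l"] gam_nonneg[of l "n l"]
  by (auto simp: task_rate_def not_le Suc_le_eq intro!: mult_nonneg_nonneg)

lemma customer_rate_nonneg: "1 \<le> y j \<Longrightarrow> j' \<noteq> j \<Longrightarrow> 0 \<le> customer_rate j j' y n"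
  using tau_irred[of y j j' n] gam_bar_nonneg by (auto simp: customer_rate_def)

lemma arrival_nonneg: "0 \<le> arrival x z"
  by (cases x; cases z) (auto simp: arrival_def intro!: sum_nonneg mult_nonneg_nonneg zero_le_power lam_nonneg gam_nonneg)

lemma departure_nonneg: "0 \<le> departure x z"
  by (cases x; cases z) (auto simp: departure_def intro!: sum_nonneg less_imp_le[OF mu_pos])

lemma task_move_nonneg: "0 \<le> task_move x z"
  by (cases x; cases z) (auto simp: task_move_def intro!: sum_nonneg task_rate_nonneg)

lemma customer_move_nonneg: "0 \<le> customer_move x z"
  by (cases x; cases z) (auto simp: customer_move_def intro!: sum_nonneg customer_rate_nonneg)

lemma rate_nonneg: "0 \<le> Rate x z"
  unfolding rate_split
  using arrival_nonneg[of x z] departure_nonneg[of x z] task_move_nonneg[of x z] customer_move_nonneg[of x z]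
  by simp

lemma arrival_nonzero:
  assumes "arrival (y, n) z \<noteq> 0"
  obtains p where "z = (y, incr p n)" "lam p (n p) y * gam p (n p) ^ y p \<noteq> 0"
proof -
  obtain y' n' where z: "z = (y', n')" by (cases z)
  with assms obtain p where "of_bool (y' = y \<and> n' = incr p n) * (lam p (n p) y * gam p (n p) ^ y p) \<noteq> 0"
    by (auto simp: arrival_def elim!: sum.not_neutral_contains_not_neutral)
  then show ?thesis using z by (intro that[of p]) (auto split: if_splits)
qed

lemma departure_nonzero:
  assumes "departure (y, n) z \<noteq> 0"
  obtains p where "1 \<le> n p" "z = (y, decr p n)"
proof -
  obtain y' n' where z: "z = (y', n')" by (cases z)
  with assms obtain p where "of_bool (y' = y \<and> 1 \<le> n p \<and> n' = decr p n) * mu p (n p) y \<noteq> 0"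
    by (auto simp: departure_def elim!: sum.not_neutral_contains_not_neutral)
  then show ?thesis using z by (intro that[of p]) (auto split: if_splits)
qed

lemma task_move_nonzero:
  assumes "task_move (y, n) z \<noteq> 0"
  obtains k l where "l \<noteq> k" "1 \<le> n k" "z = (y, transfer k l n)"
proof -
  obtain y' n' where z: "z = (y', n')" by (cases z)
  from assms[unfolded z task_move_def prod.case] show ?thesis
    by (rule transfer_sum_nonzero) (use that z in blast)
qed

lemma customer_move_nonzero:
  assumes "customer_move (y, n) z \<noteq> 0"
  obtains j j' where "j' \<noteq> j" "1 \<le> y j" "z = (transfer j j' y, n)"
proof -
  obtain y' n' where z: "z = (y', n')" by (cases z)
  from assms[unfolded z customer_move_def prod.case] show ?thesis
    by (rule transfer_sum_nonzero) (use that z in blast)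
qed

lemma rate_nonzero_cases [consumes 1, case_names arrival departure task customer]:
  assumes "Rate (y, n) z \<noteq> 0"
  obtains p where "z = (y, incr p n)" "lam p (n p) y * gam p (n p) ^ y p \<noteq> 0"
    | p where "1 \<le> n p" "z = (y, decr p n)"
    | k l where "l \<noteq> k" "1 \<le> n k" "z = (y, transfer k l n)"
    | j j' where "j' \<noteq> j" "1 \<le> y j" "z = (transfer j j' y, n)"
proof -
  have "arrival (y, n) z \<noteq> 0 \<or> departure (y, n) z \<noteq> 0 \<or> task_move (y, n) z \<noteq> 0 \<or> customer_move (y, n) z \<noteq> 0"
    using assms by (auto simp: rate_split)
  then show ?thesis
    using that arrival_nonzero[of y n z] departure_nonzero[of y n z]
      task_move_nonzero[of y n z] customer_move_nonzero[of y n z] by metis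
qed

lemma rate_closed: "x \<in> S \<Longrightarrow> Rate x z \<noteq> 0 \<Longrightarrow> z \<in> S"
proof (cases x)
  fix y n assume "x = (y, n)" "x \<in> S" "Rate x z \<noteq> 0"
  then show ?thesis
    by (auto simp: states_def sum_transfer elim!: rate_nonzero_cases)
qed

lemma finite_rate: "finite {z. Rate x z \<noteq> 0}"
proof (cases x)
  case (Pair y n)
  have "{z. Rate x z \<noteq> 0} \<subseteq> range (\<lambda>p. (y, incr p n)) \<union> range (\<lambda>p. (y, decr p n)) \<union>
      range (\<lambda>(k, l). (y, transfer k l n)) \<union> range (\<lambda>(j, j'). (transfer j j' y, n))"
    unfolding Pair by (auto elim!: rate_nonzero_cases)
  then show ?thesis by (rule finite_subset) auto
qed

lemma generator_offdiag: "z \<noteq> x \<Longrightarrow> Gen x z = Rate x z"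
  by (simp add: generator_def)

sublocale conservative_generator S Gen
proof
  fix x z :: "'a config" assume x: "x \<in> S"
  show "0 \<le> Gen x z" if "z \<noteq> x" using that rate_nonneg by (simp add: generator_offdiag)
  show "Gen x z = 0" if "z \<notin> S" using that x rate_closed[OF x] by (metis generator_offdiag)
  have "{z. Gen x z \<noteq> 0} \<subseteq> insert x {z. Rate x z \<noteq> 0}" by (auto simp: generator_def)
  then show "finite {z. Gen x z \<noteq> 0}" using finite_rate finite_subset by blast
  have "(\<Sum>\<^sub>\<infinity>u\<in>-{x}. Rate x u) = (\<Sum>\<^sub>\<infinity>u\<in>{z. Rate x z \<noteq> 0} - {x}. Rate x u)"
    by (rule infsum_cong_neutral) auto
  also have "\<dots> = (\<Sum>u\<in>{z. Rate x z \<noteq> 0} - {x}. Rate x u)"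
    using finite_rate by (intro infsum_finite) auto
  also have "\<dots> = (\<Sum>u\<in>{z. Gen x z \<noteq> 0} - {x}. Gen x u)"
    by (rule sum.cong) (auto simp: generator_offdiag)
  finally show "Gen x x = - (\<Sum>z\<in>{z. Gen x z \<noteq> 0} - {x}. Gen x z)"
    by (simp add: generator_def)
qed

section \<open>The product weight and detailed balance\<close>

definition site_weight :: "('a \<Rightarrow> nat) \<Rightarrow> 'a \<Rightarrow> nat \<Rightarrow> real" where
  "site_weight y p m = lam_bar lam p m y / mu_bar mu p m y * gam_bar gam p m ^ y p"

definition weight :: "'a config \<Rightarrow> real" where
  "weight = (\<lambda>(y, n). \<Prod>p\<in>UNIV. site_weight y p (n p))"

text \<open>The factor gained by the weight when a task joins the \<open>m\<close> tasks at
  \<open>p\<close>. It is the quotient occurring in the balance equation for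
  \<open>eps\<close>.\<close>

definition weight_ratio :: "('a \<Rightarrow> nat) \<Rightarrow> 'a \<Rightarrow> nat \<Rightarrow> real" where
  "weight_ratio y p m = lam p m y * gam p m ^ y p / mu p (m + 1) y"

lemma mu_bar_pos: "0 < mu_bar mu p m y"
  unfolding mu_bar_def by (intro prod_pos) (auto intro: mu_pos)

lemma lam_bar_nonneg: "0 \<le> lam_bar lam p m y"
  unfolding lam_bar_def by (intro prod_nonneg) (simp add: lam_nonneg)

lemma site_weight_nonneg: "0 \<le> site_weight y p m"
  unfolding site_weight_def using lam_bar_nonneg mu_bar_pos gam_bar_nonneg
  by (intro mult_nonneg_nonneg divide_nonneg_pos zero_le_power)

lemma site_weight_0 [simp]: "site_weight y p 0 = 1"
  by (simp add: site_weight_def lam_bar_def mu_bar_def gam_bar_def)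

lemma weight_nonneg: "0 \<le> weight x"
  by (cases x) (auto simp: weight_def intro!: prod_nonneg site_weight_nonneg)

lemma site_weight_Suc: "site_weight y p (Suc m) = site_weight y p m * weight_ratio y p m"
  by (simp add: site_weight_def weight_ratio_def lam_bar_def mu_bar_def gam_bar_def power_mult_distrib)

lemma weight_incr: "weight (y, incr p n) = weight (y, n) * weight_ratio y p (n p)"
proof -
  have "(\<Prod>q\<in>UNIV - {p}. site_weight y q (incr p n q)) = (\<Prod>q\<in>UNIV - {p}. site_weight y q (n q))"
    by (intro prod.cong) (auto simp: incr_def)
  then show ?thesis
    using prod.remove[of UNIV p "\<lambda>q. site_weight y q (incr p n q)"]
      prod.remove[of UNIV p "\<lambda>q. site_weight y q (n q)"]
    by (simp add: weight_def incr_def site_weight_Suc)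
qed

lemma weight_decr: "1 \<le> n p \<Longrightarrow> weight (y, n) = weight (y, decr p n) * weight_ratio y p (n p - 1)"
  using weight_incr[of y p "decr p n"] incr_decr[of n p] by (simp add: decr_def)

lemma arrival_balance: "weight x * arrival x z = weight z * departure z x"
proof -
  obtain y n y' n' where x: "x = (y, n)" and z: "z = (y', n')" by (cases x; cases z)
  have *: "weight (y, n) * (of_bool (y' = y \<and> n' = incr p n) * (lam p (n p) y * gam p (n p) ^ y p)) =
      weight (y', n') * (of_bool (y = y' \<and> 1 \<le> n' p \<and> n = decr p n') * mu p (n' p) y')" for p
  proof (cases "y' = y \<and> n' = incr p n")
    case True
    then have yy: "y' = y" and nn: "n' = incr p n" by auto
    have "y = y' \<and> 1 \<le> n' p \<and> n = decr p n'"
      using True incr_eq_iff[of n' p n] by blast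
    note e = of_bool_one[OF True] of_bool_one[OF this]
    have "incr p n p = n p + 1" by (simp add: incr_def)
    moreover have "weight (y, n) * (lam p (n p) y * gam p (n p) ^ y p) =
        weight (y, incr p n) * mu p (n p + 1) y"
      using mu_pos[of "n p + 1" p y] by (simp add: weight_incr weight_ratio_def)
    ultimately show ?thesis unfolding e mult_1 unfolding yy nn by (simp only:)
  next
    case False
    then have "\<not> (y = y' \<and> 1 \<le> n' p \<and> n = decr p n')"
      using incr_eq_iff[of n' p n] by blast
    then show ?thesis
      unfolding of_bool_zero[OF False] by (subst of_bool_zero) (assumption, simp)
  qed
  show ?thesis
    unfolding x z arrival_def departure_def prod.case sum_distrib_left by (intro sum.cong refl *)
qed

text \<open>With customers at both sites or at neither, this is the hypothesis on \<open>eps\<close>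
  or \<open>beta\<close>. In the mixed cases the equation for \<open>theta\<close> lacks a power of
  \<open>gam\<close>: one side gets it from \<open>weight_ratio\<close> at the site with customers,
  the other from the rate of moves into that site.\<close>

lemma task_rate_balance:
  assumes kl: "k \<noteq> l" and n: "1 \<le> n k"
  shows "weight_ratio y k (n k - 1) * task_rate gam beta theta eps k l y n =
    weight_ratio y l (n l) * task_rate gam beta theta eps l k y (transfer k l n)"
proof -
  have n': "transfer k l n k = n k - 1" "transfer k l n l = n l + 1"
    using kl by (simp_all add: transfer_apply)
  have nk: "n k - 1 + 1 = n k" using n by simp
  consider "y k = 0" "y l = 0" | "1 \<le> y k" "1 \<le> y l" | "1 \<le> y k" "y l = 0" | "y k = 0" "1 \<le> y l"
    by linarith
  then show ?thesis
  proof cases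
    case 1
    then show ?thesis
      using beta_balance[of k l y n, OF kl 1 n] nk by (simp add: weight_ratio_def task_rate_def n')
  next
    case 2
    then show ?thesis
      using eps_balance[of k l y n, OF kl 2 n] nk by (simp add: weight_ratio_def task_rate_def n')
  next
    case 3
    have "weight_ratio y k (n k - 1) * task_rate gam beta theta eps k l y n =
        (lam k (n k - 1) y / mu k (n k) y * theta k l (n k) (n l) y) * gam k (n k - 1) ^ y k"
      using 3 nk by (simp add: weight_ratio_def task_rate_def)
    also have "\<dots> = (lam l (n l) y / mu l (n l + 1) y * theta l k (n l + 1) (n k - 1) y) *
        gam k (n k - 1) ^ y k"
      by (simp only: theta_balance[of y k l n, OF 3 n])
    also have "\<dots> = weight_ratio y l (n l) * task_rate gam beta theta eps l k y (transfer k l n)"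
      using 3 by (simp add: weight_ratio_def task_rate_def n')
    finally show ?thesis .
  next
    case 4
    \<comment> \<open>Here the target \<open>l\<close> is the site with customers, so the equation
      for \<open>theta\<close> is applied to the configuration after the move.\<close>
    have n'l: "1 \<le> transfer k l n l" by (simp add: n')
    have bal: "lam l (n l) y / mu l (n l + 1) y * theta l k (n l + 1) (n k - 1) y =
        lam k (n k - 1) y / mu k (n k) y * theta k l (n k) (n l) y"
      using theta_balance[of y l k "transfer k l n", OF 4(2,1) n'l]
      by (simp only: n' nk add_diff_cancel_right')
    have "weight_ratio y k (n k - 1) * task_rate gam beta theta eps k l y n =
        (lam k (n k - 1) y / mu k (n k) y * theta k l (n k) (n l) y) * gam l (n l) ^ y l"
      using 4 nk by (simp add: weight_ratio_def task_rate_def)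
    also have "\<dots> = (lam l (n l) y / mu l (n l + 1) y * theta l k (n l + 1) (n k - 1) y) *
        gam l (n l) ^ y l"
      by (simp only: bal)
    also have "\<dots> = weight_ratio y l (n l) * task_rate gam beta theta eps l k y (transfer k l n)"
      using 4 by (simp add: weight_ratio_def task_rate_def n')
    finally show ?thesis .
  qed
qed

lemma task_move_balance: "weight x * task_move x z = weight z * task_move z x"
proof -
  obtain y n y' n' where x: "x = (y, n)" and z: "z = (y', n')" by (cases x; cases z)
  show ?thesis
    unfolding x z task_move_def prod.case
  proof (rule transfer_sum_balance)
    fix k l assume kl: "l \<noteq> k" and y': "y' = y" and nk: "1 \<le> n k" and n': "n' = transfer k l n"
    \<comment> \<open>Both configurations arise from \<open>decr k n\<close> by adding one task, at
      \<open>k\<close> or at \<open>l\<close>, and their weights are compared through it.\<close>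
    have "weight (y, n') = weight (y, decr k n) * weight_ratio y l (n l)"
      unfolding n' transfer_def using kl by (simp add: weight_incr) (simp add: decr_def)
    then show "weight (y, n) * task_rate gam beta theta eps k l y n =
        weight (y', n') * task_rate gam beta theta eps l k y' n'"
      using task_rate_balance[of k l n y, OF kl[symmetric] nk] n'
      by (simp add: y' weight_decr[of n k y, OF nk] mult.assoc)
  qed auto
qed

text \<open>The reciprocal powers in the customer rate cancel the \<open>gam_bar\<close> factors of
  the weight at exactly the two sites where \<open>y\<close> changes. The product over the other
  sites is the same before and after the move.\<close>

lemma weight_split:
  assumes "j \<noteq> j'" and "0 < gam_bar gam j (n j)" "0 < gam_bar gam j' (n j')"
  shows "weight (y, n) * customer_rate j j' y n =
    (\<Prod>q\<in>UNIV. lam_bar lam q (n q) y / mu_bar mu q (n q) y) * tau j j' n y *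
    (\<Prod>q\<in>UNIV - {j} - {j'}. gam_bar gam q (n q) ^ y q)"
proof -
  have "(\<Prod>q\<in>UNIV. gam_bar gam q (n q) ^ y q) = gam_bar gam j (n j) ^ y j *
      (gam_bar gam j' (n j') ^ y j' * (\<Prod>q\<in>UNIV - {j} - {j'}. gam_bar gam q (n q) ^ y q))"
    using assms(1) by (subst prod.remove[of _ j], simp, simp, subst prod.remove[of _ j'], auto)
  note G = this
  have cancel: "L * (a * (b * r)) * (inverse a * t * inverse b) = L * t * r"
    if "0 < a" "0 < b" for L a b r t :: real
    using that by (simp add: field_simps)
  show ?thesis
    unfolding weight_def prod.case site_weight_def prod.distrib G customer_rate_def
    using assms by (intro cancel) simp_all
qed

lemma customer_move_balance:
  assumes xS: "x \<in> S"
  shows "weight x * customer_move x z = weight z * customer_move z x"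
proof -
  obtain y n y' n' where x: "x = (y, n)" and z: "z = (y', n')" by (cases x; cases z)
  show ?thesis
    unfolding x z customer_move_def prod.case
  proof (rule transfer_sum_balance)
    fix k l assume kl: "l \<noteq> k" and n': "n' = n" and yk: "1 \<le> y k" and y': "y' = transfer k l y"
    have pos: "0 < gam_bar gam k (n k)" "0 < gam_bar gam l (n l)"
      using gam_bar_pos[of y k l n] yk kl xS x by (auto simp: states_def)
    have rest: "(\<Prod>q\<in>UNIV - {k} - {l}. gam_bar gam q (n q) ^ y q) =
        (\<Prod>q\<in>UNIV - {l} - {k}. gam_bar gam q (n q) ^ y' q)"
      unfolding y' by (rule prod.cong) (auto simp: transfer_apply)
    show "weight (y, n) * customer_rate k l y n = weight (y', n') * customer_rate l k y' n'"
      using weight_split[of k l n y] weight_split[of l k n y'] pos kl rest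
        tau_balance[of y k l n, OF yk] y' n' by (simp add: mult.commute)
  qed auto
qed

lemma weight_rate_balance: "x \<in> S \<Longrightarrow> weight x * Rate x z = weight z * Rate z x"
  using arrival_balance[of x z] arrival_balance[of z x] task_move_balance[of x z] customer_move_balance[of x z]
  by (simp add: rate_split distrib_left)

section \<open>Summability of the weight and the normalising constant\<close>

lemma finite_customer_configs: "finite {y :: 'a \<Rightarrow> nat. (\<Sum>s\<in>UNIV. y s) = M}"
  by (rule finite_subset[OF _ finite_bounded_configs[of M]]) auto

lemma summable_site_weight: "(\<Sum>s\<in>UNIV. y s) = M \<Longrightarrow> summable (site_weight y p)"
proof (cases "y p = 0")
  case True
  assume "(\<Sum>s\<in>UNIV. y s) = M"
  moreover have "site_weight y p = U_term lam mu y p"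
    using True by (auto simp: site_weight_def U_term_def)
  ultimately show ?thesis using U_finite True by simp
next
  case False
  assume "(\<Sum>s\<in>UNIV. y s) = M"
  moreover have "site_weight y p = C_term lam mu gam y p"
    by (auto simp: site_weight_def C_term_def)
  ultimately show ?thesis using C_finite[of y p] False by simp
qed

text \<open>At a site without customers the exponent of \<open>gam_bar\<close> is 0, so both kinds
  of site sums are sums of \<open>site_weight\<close>.\<close>

lemma Xi_eq: "Xi lam mu gam M = (\<Sum>y | (\<Sum>s\<in>UNIV. y s) = M. \<Prod>p\<in>UNIV. \<Sum>m. site_weight y p m)"
  unfolding Xi_def
proof (rule sum.cong)
  fix y :: "'a \<Rightarrow> nat"
  have "(\<Prod>p\<in>UNIV. \<Sum>m. site_weight y p m) =
      (\<Prod>p\<in>{r. 1 \<le> y r} \<union> {l. y l = 0}. \<Sum>m. site_weight y p m)"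
    by (rule prod.cong) auto
  also have "\<dots> = (\<Prod>p | 1 \<le> y p. \<Sum>m. site_weight y p m) * (\<Prod>p | y p = 0. \<Sum>m. site_weight y p m)"
    by (rule prod.union_disjoint) auto
  also have "(\<Prod>p | 1 \<le> y p. \<Sum>m. site_weight y p m) = (\<Prod>p | 1 \<le> y p. \<Sum>m. C_term lam mu gam y p m)"
    by (simp add: site_weight_def C_term_def)
  also have "(\<Prod>p | y p = 0. \<Sum>m. site_weight y p m) = (\<Prod>p | y p = 0. \<Sum>m. U_term lam mu y p m)"
    by (rule prod.cong) (auto simp: site_weight_def U_term_def)
  finally show "(\<Prod>r | 1 \<le> y r. \<Sum>n. C_term lam mu gam y r n) * (\<Prod>l | y l = 0. \<Sum>n. U_term lam mu y l n) =
      (\<Prod>p\<in>UNIV. \<Sum>m. site_weight y p m)" by simp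
qed simp

text \<open>The term without tasks equals 1 at each site, even where intensities vanish.\<close>

lemma Xi_pos: "0 < Xi lam mu gam M"
  unfolding Xi_eq
proof (rule sum_pos)
  obtain a :: 'a where True by blast
  have "(\<Sum>s\<in>UNIV. ((\<lambda>_. 0)(a := M)) s) = M"
    using sum_fun_upd[of "\<lambda>_. 0" a M] by simp
  then show "{y :: 'a \<Rightarrow> nat. (\<Sum>s\<in>UNIV. y s) = M} \<noteq> {}" by blast
  fix y assume y: "y \<in> {y :: 'a \<Rightarrow> nat. (\<Sum>s\<in>UNIV. y s) = M}"
  show "0 < (\<Prod>p\<in>UNIV. \<Sum>m. site_weight y p m)"
  proof (rule prod_pos)
    fix p
    have "(\<Sum>m\<in>{0}. site_weight y p m) \<le> (\<Sum>m. site_weight y p m)"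
      using y by (intro sum_le_suminf summable_site_weight) (auto intro: site_weight_nonneg)
    then show "0 < (\<Sum>m. site_weight y p m)" by simp
  qed
qed (rule finite_customer_configs)

lemma weight_has_sum: "(weight has_sum Xi lam mu gam M) S"
proof -
  have fixed: "(weight has_sum (\<Prod>p\<in>UNIV. \<Sum>m. site_weight y p m)) ({y} \<times> UNIV)"
    if y: "(\<Sum>s\<in>UNIV. y s) = M" for y
  proof -
    have site: "(site_weight y p has_sum (\<Sum>m. site_weight y p m)) UNIV" for p
      using summable_site_weight[OF y, of p] site_weight_nonneg
      by (intro norm_summable_imp_has_sum summable_sums) simp_all
    have summable: "(\<lambda>n. \<Prod>p\<in>UNIV. site_weight y p (n p)) summable_on (PiE UNIV (\<lambda>_. UNIV))"
    proof (rule nonneg_bounded_partial_sums_imp_summable_on)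
      show "0 \<le> (\<Prod>p\<in>UNIV. site_weight y p (n p))" for n
        by (intro prod_nonneg site_weight_nonneg)
      show "\<forall>\<^sub>F F in finite_subsets_at_top (PiE UNIV (\<lambda>_. UNIV)).
          (\<Sum>n\<in>F. \<Prod>p\<in>UNIV. site_weight y p (n p)) \<le> (\<Prod>p\<in>UNIV. \<Sum>m. site_weight y p m)"
      proof (rule eventually_finite_subsets_at_top_weakI)
        fix F :: "('a \<Rightarrow> nat) set" assume F: "finite F"
        \<comment> \<open>Finitely many task configurations lie in a box with all entries at most
          \<open>N\<close>, where the sum of products is a product of partial sums.\<close>
        define N where "N = Max (\<Union>n\<in>F. range n)"
        have "n p \<le> N" if "n \<in> F" for n p
          unfolding N_def using F that by (intro Max_ge) auto
        then have "(\<Sum>n\<in>F. \<Prod>p\<in>UNIV. site_weight y p (n p)) \<le>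
            (\<Sum>n\<in>PiE UNIV (\<lambda>_. {..N}). \<Prod>p\<in>UNIV. site_weight y p (n p))"
          by (intro sum_mono2 finite_PiE prod_nonneg site_weight_nonneg) auto
        also have "\<dots> = (\<Prod>p\<in>UNIV. \<Sum>m\<le>N. site_weight y p m)"
          by (rule prod_sum_PiE[symmetric]) auto
        also have "\<dots> \<le> (\<Prod>p\<in>UNIV. \<Sum>m. site_weight y p m)"
          using y by (intro prod_mono conjI sum_nonneg sum_le_suminf summable_site_weight)
            (auto intro: site_weight_nonneg)
        finally show "(\<Sum>n\<in>F. \<Prod>p\<in>UNIV. site_weight y p (n p)) \<le> (\<Prod>p\<in>UNIV. \<Sum>m. site_weight y p m)" .
      qed
    qed
    have "(\<Sum>\<^sub>\<infinity>n\<in>PiE UNIV (\<lambda>_. UNIV). \<Prod>p\<in>UNIV. site_weight y p (n p)) =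
        (\<Prod>p\<in>UNIV. \<Sum>\<^sub>\<infinity>m. site_weight y p m)"
      using has_sum_imp_summable[OF site] by (intro infsum_prod_PiE summable) auto
    then have "((\<lambda>n. weight (y, n)) has_sum (\<Prod>p\<in>UNIV. \<Sum>m. site_weight y p m)) UNIV"
      using has_sum_infsum[OF summable] infsumI[OF site] by (simp add: weight_def PiE_UNIV_domain)
    moreover have "{y} \<times> UNIV = Pair y ` (UNIV :: ('a \<Rightarrow> nat) set)" by auto
    ultimately show ?thesis
      by (simp add: has_sum_reindex inj_on_def comp_def)
  qed
  have "S = (\<Union>y\<in>{y. (\<Sum>s\<in>UNIV. y s) = M}. {y} \<times> UNIV)" by (auto simp: states_def)
  then show ?thesis
    unfolding Xi_eq using fixed finite_customer_configs by (simp only:) (rule sum_has_sum, auto)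
qed

lemma stat_prob_weight: "x \<in> S \<Longrightarrow> stat_prob lam mu gam M x = weight x / Xi lam mu gam M"
proof -
  obtain y n where x: "x = (y, n)" by (cases x)
  assume "x \<in> S"
  then have "of_bool ((\<Sum>s\<in>UNIV. y s) = M) = (1 :: real)" by (simp add: x states_def)
  then show ?thesis
    unfolding x stat_prob_def weight_def site_weight_def prod.case prod.distrib by simp
qed

lemma stat_prob_has_sum: "(stat_prob lam mu gam M has_sum 1) S"
proof -
  have "((\<lambda>x. weight x * inverse (Xi lam mu gam M)) has_sum Xi lam mu gam M * inverse (Xi lam mu gam M)) S"
    by (rule has_sum_cmult_left[OF weight_has_sum])
  moreover have "(stat_prob lam mu gam M has_sum 1) S \<longleftrightarrow>
      ((\<lambda>x. weight x * inverse (Xi lam mu gam M)) has_sum 1) S"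
    by (rule has_sum_cong) (simp add: stat_prob_weight divide_inverse)
  ultimately show ?thesis using less_imp_neq[OF Xi_pos, symmetric] by simp
qed

end


context task_network
begin

section \<open>Accessibility of the reference state\<close>

lemma R_pos_iff: "0 < R x z \<longleftrightarrow> x \<in> S \<and> z \<noteq> x \<and> 0 < Rate x z"
  using rate_closed[of x z] by (auto simp: R_def generator_offdiag)

lemma departure_pos:
  assumes n: "1 \<le> n p" shows "0 < Rate (y, n) (y, decr p n)"
proof -
  let ?f = "\<lambda>q. of_bool (y = y \<and> 1 \<le> n q \<and> decr p n = decr q n) * mu q (n q) y"
  have "0 < ?f p" using mu_pos[of "n p" p y, OF n] n by simp
  also have "?f p \<le> (\<Sum>q\<in>UNIV. ?f q)"
    by (rule member_le_sum) (auto intro: less_imp_le[OF mu_pos])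
  also have "\<dots> = departure (y, n) (y, decr p n)" by (simp add: departure_def)
  also have "\<dots> \<le> Rate (y, n) (y, decr p n)"
    unfolding rate_split
    using arrival_nonneg[of "(y, n)" "(y, decr p n)"] task_move_nonneg[of "(y, n)" "(y, decr p n)"]
      customer_move_nonneg[of "(y, n)" "(y, decr p n)"] by simp
  finally show ?thesis .
qed

lemma customer_move_pos:
  assumes y: "(\<Sum>s\<in>UNIV. y s) = M" "1 \<le> y j" and j: "j' \<noteq> j"
  shows "0 < Rate (y, n) (transfer j j' y, n)"
proof -
  let ?f = "\<lambda>k l. of_bool (n = n \<and> 1 \<le> y k \<and> transfer j j' y = transfer k l y) * customer_rate k l y n"
  have nonneg: "0 \<le> ?f k l" if "l \<in> UNIV - {k}" for k l
    using that customer_rate_nonneg[of y k l n] by (cases "1 \<le> y k") auto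
  have "0 < ?f j j'"
    using y gam_bar_pos[of y j j' n] tau_irred[of y j j' n] j
    by (simp add: customer_rate_def)
  also have "?f j j' \<le> (\<Sum>l\<in>UNIV - {j}. ?f j l)"
    using j nonneg by (intro member_le_sum) auto
  also have "\<dots> \<le> (\<Sum>k\<in>UNIV. \<Sum>l\<in>UNIV - {k}. ?f k l)"
    by (intro member_le_sum sum_nonneg nonneg) simp_all
  also have "\<dots> = customer_move (y, n) (transfer j j' y, n)" by (simp add: customer_move_def)
  also have "\<dots> \<le> Rate (y, n) (transfer j j' y, n)"
    unfolding rate_split
    using arrival_nonneg[of "(y, n)" "(transfer j j' y, n)"] task_move_nonneg[of "(y, n)" "(transfer j j' y, n)"]
      departure_nonneg[of "(y, n)" "(transfer j j' y, n)"] by simp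
  finally show ?thesis .
qed

lemma reaches_first: "0 < R x y \<Longrightarrow> reaches y z \<Longrightarrow> reaches x z"
  unfolding reaches_def by (rule converse_rtranclp_into_rtranclp)

lemma reaches_no_tasks: "(y, n) \<in> S \<Longrightarrow> reaches (y, n) (y, \<lambda>_. 0)"
proof (induction "\<Sum>s\<in>UNIV. n s" arbitrary: n)
  case 0
  then have "n = (\<lambda>_. 0)" by auto
  then show ?case by simp
next
  case (Suc N)
  then obtain p where p: "1 \<le> n p"
    by (metis Suc_le_eq One_nat_def gr0I nat.distinct(1) sum.neutral)
  have "N = (\<Sum>s\<in>UNIV. decr p n s)" using sum_decr[of n p, OF p] Suc.hyps(2) by simp
  moreover have "(y, decr p n) \<in> S" using Suc.prems by (simp add: states_def)
  ultimately have "reaches (y, decr p n) (y, \<lambda>_. 0)" by (rule Suc.hyps(1))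
  moreover have "decr p n p \<noteq> n p" using p by (simp add: decr_def)
  then have "(y, decr p n) \<noteq> (y, n)" by (metis prod.inject)
  then have "0 < R (y, n) (y, decr p n)"
    using departure_pos[of n p y, OF p] Suc.prems by (simp only: R_pos_iff simp_thms)
  ultimately show ?case using reaches_first by blast
qed

text \<open>Customer moves have positive rate under every task configuration, so the customers are
  brought to \<open>a\<close> one by one. \<open>M - y a\<close> counts those still
  elsewhere.\<close>

lemma reaches_gathered:
  assumes "(y, n) \<in> S" shows "reaches (y, n) ((\<lambda>_. 0)(a := M), n)"
  using assms
proof (induction "M - y a" arbitrary: y rule: less_induct)
  case less
  have sum: "(\<Sum>s\<in>UNIV. y s) = M" using less.prems by (simp add: states_def)
  show ?case
  proof (cases "\<exists>j. j \<noteq> a \<and> 1 \<le> y j")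
    case True
    then obtain j where j: "j \<noteq> a" "1 \<le> y j" by blast
    have "y j + y a \<le> (\<Sum>s\<in>UNIV. y s)"
      using sum_mono2[of UNIV "{j, a}" y] j by simp
    then have "M - transfer j a y a < M - y a"
      using j sum by (simp add: transfer_apply)
    moreover have "(transfer j a y, n) \<in> S" using sum j by (simp add: states_def sum_transfer)
    ultimately have "reaches (transfer j a y, n) ((\<lambda>_. 0)(a := M), n)" by (rule less.hyps)
    moreover have "transfer j a y a \<noteq> y a" using j by (simp add: transfer_apply)
    then have "(transfer j a y, n) \<noteq> (y, n)" by (metis prod.inject)
    then have "0 < R (y, n) (transfer j a y, n)"
      using customer_move_pos[of y j a n, OF sum j(2) j(1)[symmetric]] less.prems
      by (simp only: R_pos_iff simp_thms)
    ultimately show ?thesis using reaches_first by blast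
  next
    case False
    then have 0: "y j = 0" if "j \<noteq> a" for j using that by (auto simp: not_le)
    then have "(\<Sum>s\<in>UNIV. y s) = y a"
      by (subst sum.remove[of _ a]) auto
    then have "y = (\<lambda>_. 0)(a := M)" using 0 sum by auto
    then show ?thesis by simp
  qed
qed

text \<open>\<open>undefined\<close> serves as an arbitrary site. Without tasks the weight consists
  of empty products and is positive even if all arrival intensities vanish.\<close>

definition origin :: "'a config" where
  "origin = ((\<lambda>_. 0)(undefined := M), \<lambda>_. 0)"

lemma origin_in_S: "origin \<in> S"
  using sum_fun_upd[of "\<lambda>_. 0" undefined M] by (simp add: origin_def states_def)

lemma reaches_origin: "x \<in> S \<Longrightarrow> reaches x origin"
proof (cases x)
  case (Pair y n)
  assume x: "x \<in> S"
  then have "(y, \<lambda>_. 0) \<in> S" by (simp add: Pair states_def)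
  then show ?thesis
    using reaches_no_tasks[of y n] reaches_gathered[of y "\<lambda>_. 0" undefined] x
    unfolding Pair origin_def reaches_def by (meson rtranclp_trans)
qed

lemma weight_origin: "weight origin = 1"
  by (simp add: origin_def weight_def)

lemma finite_task_bound: "finite {z\<in>S. (\<Sum>s\<in>UNIV. snd z s) \<le> N}"
proof (rule finite_subset)
  show "{z\<in>S. (\<Sum>s\<in>UNIV. snd z s) \<le> N} \<subseteq>
      {y. (\<Sum>s\<in>UNIV. y s) \<le> M} \<times> {n. (\<Sum>s\<in>UNIV. n s) \<le> N}"
    by (auto simp: states_def)
  show "finite ({y. (\<Sum>s\<in>(UNIV :: 'a set). y s) \<le> M} \<times> {n. (\<Sum>s\<in>(UNIV :: 'a set). n s) \<le> N})"
    by (intro finite_cartesian_product finite_bounded_configs)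
qed

section \<open>Vanishing arrival intensities and states of weight zero\<close>

lemma lam_0_mono: "lam i m y = 0 \<Longrightarrow> m \<le> k \<Longrightarrow> lam i k y = 0"
proof (induction k)
  case (Suc k)
  show ?case
  proof (cases "m = Suc k")
    case False
    then have "lam i k y = 0" using Suc by simp
    then show ?thesis using lam_pos[of i k y] lam_nonneg[of i "Suc k" y] by (auto simp: less_le)
  qed (use Suc in simp)
qed simp

lemma gam_0_mono: "gam i m = 0 \<Longrightarrow> m \<le> k \<Longrightarrow> gam i k = 0"
proof (induction k)
  case (Suc k)
  show ?case
  proof (cases "m = Suc k")
    case False
    then have "gam i k = 0" using Suc by simp
    then show ?thesis using gam_pos[of i k] gam_nonneg[of i "Suc k"] by (auto simp: less_le)
  qed (use Suc in simp)
qed simp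

text \<open>
  With two or more sites, the balance equations for task moves tie all arrival intensities of
  a customer configuration together.
\<close>

lemma lam_0_other_site:
  assumes y: "(\<Sum>s\<in>UNIV. y s) = M" and kl: "k \<noteq> l" and k: "lam k a y = 0"
  shows "lam l b y = 0"
proof -
  \<comment> \<open>With \<open>a + 1\<close> tasks at \<open>k\<close> and \<open>b\<close> at
    \<open>l\<close>, the balance of a move from \<open>k\<close> to \<open>l\<close> involves
    exactly \<open>lam k a\<close> and \<open>lam l b\<close>.\<close>
  define n where "n = (\<lambda>_. 0)(k := a + 1, l := b)"
  have n: "n k = a + 1" "n l = b" "1 \<le> n k" using kl by (auto simp: n_def)
  \<comment> \<open>\<open>gam_bar\<close> at \<open>b + 1\<close> contains the factor
    \<open>gam l b\<close>. Its positivity ensures that a vanishing product with a power of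
    \<open>gam l b\<close> comes from \<open>lam l b\<close>.\<close>
  have gam: "0 < gam l b" if "1 \<le> y l \<or> 1 \<le> y k"
  proof -
    have "0 < gam_bar gam l (b + 1)"
      using that gam_bar_pos[OF y, of l k "\<lambda>_. b + 1"] gam_bar_pos[OF y, of k l "\<lambda>_. b + 1"] kl by auto
    then show ?thesis using gam_bar_nonneg[of l b] gam_nonneg[of l b]
      by (auto simp: gam_bar_def zero_less_mult_iff)
  qed
  have mu: "0 < mu l (b + 1) y" by (rule mu_pos) simp
  consider "y k = 0" "y l = 0" | "1 \<le> y k" "1 \<le> y l" | "1 \<le> y k" "y l = 0" | "y k = 0" "1 \<le> y l"
    by linarith
  then show ?thesis
  proof cases
    case 1
    then show ?thesis
      using beta_balance[of k l y n, OF kl 1 n(3)] beta_irred[of l k y "b + 1" a] kl k mu by (simp add: n)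
  next
    case 2
    then show ?thesis
      using eps_balance[of k l y n, OF kl 2 n(3)] eps_irred[of l k y "b + 1" a] kl k mu gam by (auto simp: n)
  next
    case 3
    then show ?thesis
      using theta_balance[of y k l n, OF 3 n(3)] theta_irred[of y k l "b + 1" a] k mu by (auto simp: n)
  next
    case 4
    \<comment> \<open>The equation for \<open>theta\<close> starts from the site with customers,
      here \<open>l\<close>, so the configuration after the move is used.\<close>
    define n' where "n' = (\<lambda>_. 0)(k := a, l := b + 1)"
    have n': "n' k = a" "n' l = b + 1" "1 \<le> n' l" using kl by (auto simp: n'_def)
    have mu': "0 < mu k (a + 1) y" by (rule mu_pos) simp
    show ?thesis
      using theta_balance[of y l k n', OF 4(2,1) n'(3)] theta_irred[of y l k "b + 1" a] 4 k mu by (auto simp: n')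
  qed
qed

text \<open>Passing to a second site and back also covers the levels of \<open>i\<close> below
  \<open>a\<close>.\<close>

lemma lam_0_all:
  assumes y: "(\<Sum>s\<in>UNIV. y s) = M" and kl: "k \<noteq> (l :: 'a)" and i: "lam i a y = 0"
  shows "lam j b y = 0"
proof -
  obtain i' where i': "i' \<noteq> i" using kl by metis
  have *: "lam i' c y = 0" for c using lam_0_other_site[OF y i'[symmetric] i] .
  show ?thesis
  proof (cases "j = i'")
    case False
    then show ?thesis using lam_0_other_site[OF y _ *, of j] by blast
  qed (simp add: *)
qed

lemma lam_0_transfer:
  assumes y: "(\<Sum>s\<in>UNIV. y s) = M" "1 \<le> y j" "j' \<noteq> j" and 0: "\<And>i m. lam i m y = 0"
  shows "lam i m (transfer j j' y) = 0"
proof -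
  \<comment> \<open>One task at \<open>j\<close> brings the factor \<open>lam j 0 y = 0\<close> into
    the product. The equation for \<open>tau\<close> then forces the product after the customer move
    to vanish, and with it some intensity there.\<close>
  define n where "n = (\<lambda>_::'a. 0::nat)(j := 1)"
  have y': "(\<Sum>s\<in>UNIV. transfer j j' y s) = M" "1 \<le> transfer j j' y j'"
    using y by (simp_all add: sum_transfer transfer_apply)
  have "(\<Prod>q\<in>UNIV. lam_bar lam q (n q) y / mu_bar mu q (n q) y) = 0"
    using 0 by (auto simp: n_def lam_bar_def intro!: exI[of _ j])
  then have "tau j' j n (transfer j j' y) *
      (\<Prod>q\<in>UNIV. lam_bar lam q (n q) (transfer j j' y) / mu_bar mu q (n q) (transfer j j' y)) = 0"
    using tau_balance[of y j j' n, OF y(2,3)] by (metis mult_zero_right)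
  then have "(\<Prod>q\<in>UNIV. lam_bar lam q (n q) (transfer j j' y) / mu_bar mu q (n q) (transfer j j' y)) = 0"
    using tau_irred[of "transfer j j' y" j' j n, OF y'(2) y(3)[symmetric]]
    by (metis mult_eq_0_iff less_numeral_extra(3))
  then obtain q m' where "lam q m' (transfer j j' y) = 0"
    using less_imp_neq[OF mu_bar_pos] by (fastforce simp: prod_zero_iff lam_bar_def)
  then show ?thesis by (rule lam_0_all[OF y'(1) y(3)])
qed

lemma site_weight_zero:
  assumes "site_weight y p m = 0"
  obtains k where "k < m" "lam p k y * gam p k ^ y p = 0"
proof -
  have "\<exists>k<m. lam p k y = 0 \<or> gam p k ^ y p = 0"
    using assms less_imp_neq[OF mu_bar_pos, of p m y]
    by (auto simp: site_weight_def lam_bar_def gam_bar_def prod_zero_iff)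
  then show ?thesis using that by auto
qed

text \<open>A vanishing weight exhibits a level \<open>k\<close> below the present number of tasks
  at which the arrival rate is 0. With several sites this stops all arrivals forever; with one site
  it stops arrivals from level \<open>k\<close> on. Either way the number of tasks never exceeds its
  initial value.\<close>

lemma finite_reaches:
  assumes x: "x \<in> S" and w: "weight x = 0"
  shows "finite {z. reaches x z}"
proof -
  obtain y n where xy: "x = (y, n)" by (cases x)
  have y: "(\<Sum>s\<in>UNIV. y s) = M" using x by (simp add: xy states_def)
  obtain p where "site_weight y p (n p) = 0"
    using w by (auto simp: xy weight_def prod_zero_iff)
  then obtain k where k: "k < n p" "lam p k y * gam p k ^ y p = 0" by (rule site_weight_zero)
  have "(\<Sum>s\<in>UNIV. snd z s) \<le> (\<Sum>s\<in>UNIV. n s)" if r: "reaches x z" for z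
  proof (cases "\<exists>i j :: 'a. i \<noteq> j")
    case True
    then obtain i j :: 'a where ij: "i \<noteq> j" by blast
    \<comment> \<open>With a second site, \<open>gam_bar_pos\<close> excludes a zero of
      \<open>gam\<close> at a site with customers; without customers the exponent is 0. Hence the
      zero comes from \<open>lam\<close>.\<close>
    have "gam p k ^ y p \<noteq> 0"
    proof (cases "y p = 0")
      case False
      obtain p' where p': "p' \<noteq> p" using ij by metis
      have "0 < gam_bar gam p (k + 1)"
        using gam_bar_pos[OF y, of p p' "\<lambda>_. k + 1"] False p' by simp
      then show ?thesis by (auto simp: gam_bar_def)
    qed simp
    then have lam0: "lam p k y = 0" using k by auto
    have "(\<Sum>s\<in>UNIV. snd z s) \<le> (\<Sum>s\<in>UNIV. n s) \<and> (\<forall>i m. lam i m (fst z) = 0)"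
      using r unfolding reaches_def
    proof (induction rule: rtranclp_induct)
      case base
      show ?case using lam_0_all[OF y ij lam0] by (simp add: xy)
    next
      case (step u v)
      obtain y' n' where u: "u = (y', n')" by (cases u)
      have "u \<in> S" "Rate u v \<noteq> 0" using step(2) by (auto simp: R_pos_iff)
      then have y': "(\<Sum>s\<in>UNIV. y' s) = M" and "Rate (y', n') v \<noteq> 0"
        by (simp_all add: u states_def)
      from this(2) show ?case
      proof (cases rule: rate_nonzero_cases)
        case (departure p)
        then show ?thesis using step.IH sum_decr[of n' p, OF departure(1)] by (simp add: u)
      next
        case (customer j j')
        then show ?thesis using step.IH lam_0_transfer[OF y', of j j'] by (simp add: u)
      qed (use step.IH in \<open>auto simp: u sum_transfer\<close>)
    qed
    then show ?thesis by simp
  next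
    case False
    then have single: "i = p" for i by blast
    have "(\<Sum>s\<in>UNIV. snd z s) \<le> (\<Sum>s\<in>UNIV. n s) \<and> fst z = y"
      using r unfolding reaches_def
    proof (induction rule: rtranclp_induct)
      case base
      show ?case by (simp add: xy)
    next
      case (step u v)
      obtain n' where u: "u = (y, n')" using step.IH by (cases u) auto
      have sum: "(\<Sum>s\<in>UNIV. f s) = f p" for f :: "'a \<Rightarrow> nat"
        by (subst sum.remove[of _ p]) (use single in auto)
      have le: "n' p \<le> n p" using step.IH by (simp add: u sum)
      have "Rate (y, n') v \<noteq> 0" using step(2) by (auto simp: R_pos_iff u)
      then show ?case
      proof (cases rule: rate_nonzero_cases)
        case (arrival q)
        have q: "q = p" by (rule single)
        \<comment> \<open>Zeros of \<open>lam\<close> and \<open>gam\<close> persist upwards, so an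
          arrival starts below level \<open>k\<close> and ends at most at \<open>k\<close>, which is
          less than \<open>n p\<close>.\<close>
        have "\<not> k \<le> n' p"
        proof
          assume "k \<le> n' p"
          then have "lam p (n' p) y * gam p (n' p) ^ y p = 0"
            using k(2) lam_0_mono[of p k y "n' p"] gam_0_mono[of p k "n' p"] by auto
          then show False using arrival q by simp
        qed
        then show ?thesis using arrival k(1) q by (simp add: sum incr_def)
      next
        case (departure q)
        moreover have "q = p" by (rule single)
        ultimately show ?thesis using le by (simp add: sum decr_def)
      next
        case (task k l)
        then show ?thesis using single by metis
      next
        case (customer j j')
        then show ?thesis using single by metis
      qed
    qed
    then show ?thesis by simp
  qed
  then have "{z. reaches x z} \<subseteq> {z\<in>S. (\<Sum>s\<in>UNIV. snd z s) \<le> (\<Sum>s\<in>UNIV. n s)}"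
    using reaches_in_S[OF _ x] by auto
  then show ?thesis by (rule finite_subset) (rule finite_task_bound)
qed

section \<open>Drift of the number of tasks\<close>

text \<open>Only arrivals change the number of tasks upwards, and their total rate is bounded.\<close>

lemma drift_bound:
  assumes gam_bounded: "\<exists>K. \<forall>i n. gam i n \<le> K"
  shows "\<exists>a>0. \<forall>x\<in>S. (\<Sum>z\<in>{z. Gen x z \<noteq> 0} - {x}. Gen x z * (1 + real (\<Sum>s\<in>UNIV. snd z s))) \<le>
    (a + q x) * (1 + real (\<Sum>s\<in>UNIV. snd x s))"
proof -
  obtain K where K: "\<And>i n y. lam i n y \<le> K" using lam_sup by blast
  obtain G where G: "\<And>i n. gam i n \<le> G" using gam_bounded by blast
  have K0: "0 \<le> K" using K[of undefined 0 undefined] lam_nonneg[of undefined 0 undefined] by linarith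
  \<comment> \<open>Powers \<open>gam i n ^ y i\<close> are dominated by \<open>max 1 G ^ M\<close>,
    because \<open>y i \<le> M\<close> on \<open>S\<close>.\<close>
  define B where "B = K * max 1 G ^ M"
  have B0: "0 \<le> B" using K0 by (simp add: B_def)
  \<comment> \<open>There is one arrival term per site, each at most \<open>B\<close>; the added 1
    makes \<open>a\<close> positive. Since \<open>?V\<close> is at least 1, this constant is also at
    most \<open>a * ?V x\<close>.\<close>
  define a where "a = real CARD('a) * B + 1"
  have a: "0 < a" using B0 by (simp add: a_def add_nonneg_pos)
  let ?V = "\<lambda>z :: 'a config. 1 + real (\<Sum>s\<in>UNIV. snd z s)"
  have "(\<Sum>z\<in>{z. Gen x z \<noteq> 0} - {x}. Gen x z * ?V z) \<le> (a + q x) * ?V x" if x: "x \<in> S" for x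
  proof -
    obtain y n where xy: "x = (y, n)" by (cases x)
    let ?N = "{z. Gen x z \<noteq> 0} - {x}"
    have finN: "finite ?N" using finite_row[OF x] by simp
    have rate: "lam p (n p) y * gam p (n p) ^ y p \<le> B" for p
    proof -
      have "y p \<le> M" using member_le_sum[of p UNIV y] x by (simp add: xy states_def)
      then have "gam p (n p) ^ y p \<le> max 1 G ^ M"
        using G[of p "n p"] gam_nonneg[of p "n p"]
        by (intro order_trans[OF power_mono[of _ "max 1 G"] power_increasing]) auto
      then show ?thesis unfolding B_def
        using K K0 lam_nonneg gam_nonneg by (intro mult_mono) auto
    qed
    \<comment> \<open>Measured relative to \<open>?V x\<close>, an arrival gains 1, a departure
      loses 1, and the other moves preserve the number of tasks.\<close>
    have each: "Gen x z * (?V z - ?V x) \<le> arrival x z" if z: "z \<in> ?N" for z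
    proof -
      have "arrival x z * (?V z - ?V x) = arrival x z"
      proof (cases "arrival x z = 0")
        case False
        then obtain p where "z = (y, incr p n)" unfolding xy by (rule arrival_nonzero)
        then show ?thesis by (simp add: xy sum_incr del: of_nat_sum)
      qed simp
      moreover have "departure x z * (?V z - ?V x) \<le> 0"
      proof (cases "departure x z = 0")
        case False
        then obtain p where "1 \<le> n p" "z = (y, decr p n)" unfolding xy by (rule departure_nonzero)
        then have "?V z - ?V x \<le> 0" using sum_decr[of n p] by (simp add: xy del: of_nat_sum)
        then show ?thesis using departure_nonneg[of x z] by (intro mult_nonneg_nonpos)
      qed simp
      moreover have "task_move x z * (?V z - ?V x) = 0"
      proof (cases "task_move x z = 0")
        case False
        then obtain k l where "1 \<le> n k" "z = (y, transfer k l n)" unfolding xy by (rule task_move_nonzero)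
        then show ?thesis by (simp add: xy sum_transfer del: of_nat_sum)
      qed simp
      moreover have "customer_move x z * (?V z - ?V x) = 0"
      proof (cases "customer_move x z = 0")
        case False
        then obtain j j' where "z = (transfer j j' y, n)" unfolding xy by (rule customer_move_nonzero)
        then show ?thesis by (simp add: xy)
      qed simp
      moreover have "Gen x z = arrival x z + departure x z + task_move x z + customer_move x z"
        using z by (simp add: generator_offdiag rate_split)
      then have "Gen x z * (?V z - ?V x) = arrival x z * (?V z - ?V x) + departure x z * (?V z - ?V x) +
          task_move x z * (?V z - ?V x) + customer_move x z * (?V z - ?V x)"
        by (simp only: distrib_right)
      ultimately show ?thesis by linarith
    qed
    have "(\<Sum>z\<in>?N. arrival x z) \<le> (\<Sum>p\<in>(UNIV :: 'a set). B)"
    proof -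
      have "(\<Sum>z\<in>?N. arrival x z) = (\<Sum>z\<in>?N. \<Sum>p\<in>UNIV. of_bool (z = (y, incr p n)) * (lam p (n p) y * gam p (n p) ^ y p))"
        by (intro sum.cong refl) (auto simp: arrival_def xy intro!: sum.cong)
      also have "\<dots> = (\<Sum>p\<in>UNIV. \<Sum>z\<in>?N. of_bool (z = (y, incr p n)) * (lam p (n p) y * gam p (n p) ^ y p))"
        by (rule sum.swap)
      also have "\<dots> \<le> (\<Sum>p\<in>(UNIV :: 'a set). B)"
      proof (rule sum_mono)
        fix p :: 'a
        have "(\<Sum>z\<in>?N. of_bool (z = (y, incr p n)) * (lam p (n p) y * gam p (n p) ^ y p)) =
          (if (y, incr p n) \<in> ?N then lam p (n p) y * gam p (n p) ^ y p else 0)"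
          using finN by (simp add: of_bool_def if_distrib[of "\<lambda>c. c * _"] sum.delta' cong: if_cong)
        also have "\<dots> \<le> B" using rate[of p] B0 by simp
        finally show "(\<Sum>z\<in>?N. of_bool (z = (y, incr p n)) * (lam p (n p) y * gam p (n p) ^ y p)) \<le> B" .
      qed
      finally show ?thesis .
    qed
    then have arr: "(\<Sum>z\<in>?N. arrival x z) \<le> a" by (simp add: a_def)
    have "(\<Sum>z\<in>?N. Gen x z * ?V z) = (\<Sum>z\<in>?N. Gen x z * (?V z - ?V x) + Gen x z * ?V x)"
      by (simp only: right_diff_distrib diff_add_cancel)
    also have "\<dots> = (\<Sum>z\<in>?N. Gen x z * (?V z - ?V x)) + q x * ?V x"
      unfolding sum.distrib q_eq[OF x] by (simp only: sum_distrib_right)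
    finally have "(\<Sum>z\<in>?N. Gen x z * ?V z) = (\<Sum>z\<in>?N. Gen x z * (?V z - ?V x)) + q x * ?V x" .
    moreover have "(\<Sum>z\<in>?N. Gen x z * (?V z - ?V x)) \<le> (\<Sum>z\<in>?N. arrival x z)"
      by (rule sum_mono) (rule each)
    moreover have "a * 1 \<le> a * ?V x" using a by (intro mult_left_mono) (auto intro: sum_nonneg)
    ultimately show ?thesis using arr unfolding distrib_right by linarith
  qed
  then show ?thesis using a by blast
qed

end

theorem theorem5p1:
  fixes M :: nat
    and lam mu :: "'a::finite intensity"
    and gam :: "'a \<Rightarrow> nat \<Rightarrow> real"
    and beta theta eps :: "'a array"
    and tau :: "'a \<Rightarrow> 'a \<Rightarrow> ('a \<Rightarrow> nat) \<Rightarrow> ('a \<Rightarrow> nat) \<Rightarrow> real"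
    and Pr :: "'a config \<Rightarrow> 'w measure"
    and Y :: "nat \<Rightarrow> 'w \<Rightarrow> 'a config"
    and H :: "nat \<Rightarrow> 'w \<Rightarrow> ennreal"
  assumes lam_nonneg: "\<And>i n y. 0 \<le> lam i n y"
    and lam_sup: "\<exists>K. \<forall>i n y. lam i n y \<le> K"
    and mu_inf: "\<exists>c>0. \<forall>i n y. 1 \<le> n \<longrightarrow> c \<le> mu i n y"
    and lam_pos: "\<And>i n y. 0 < lam i (n + 1) y \<Longrightarrow> 0 < lam i n y"
    and gam_nonneg: "\<And>i n. 0 \<le> gam i n"
    and gam_0: "\<And>i. gam i 0 = 1"
    and gam_pos: "\<And>i n. 0 < gam i (n + 1) \<Longrightarrow> 0 < gam i n"
    and gam_bar_pos:
      "\<And>y n j j'. (\<Sum>s\<in>UNIV. y s) = M \<Longrightarrow> 1 \<le> y j \<Longrightarrow> j' \<noteq> j \<Longrightarrow>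
         0 < gam_bar gam j (n j) \<and> 0 < gam_bar gam j' (n j')"
    and beta_irred:
      "\<And>k l a b y. k \<noteq> l \<Longrightarrow> y k = 0 \<Longrightarrow> y l = 0 \<Longrightarrow> 0 < beta k l a b y"
    and theta_irred:
      "\<And>j k a b y. 1 \<le> y j \<Longrightarrow> y k = 0 \<Longrightarrow> 0 < theta j k a b y \<and> 0 < theta k j a b y"
    and eps_irred:
      "\<And>i j a b y. i \<noteq> j \<Longrightarrow> 1 \<le> y i \<Longrightarrow> 1 \<le> y j \<Longrightarrow> 0 < eps i j a b y"
    and tau_irred:
      "\<And>j j' n y. 1 \<le> y j \<Longrightarrow> j' \<noteq> j \<Longrightarrow> 0 < tau j j' n y"
    and beta_balance:
      "\<And>k l n y. k \<noteq> l \<Longrightarrow> y k = 0 \<Longrightarrow> y l = 0 \<Longrightarrow> 1 \<le> n k \<Longrightarrow>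
         lam k (n k - 1) y / mu k (n k) y * beta k l (n k) (n l) y =
         lam l (n l) y / mu l (n l + 1) y * beta l k (n l + 1) (n k - 1) y"
    and theta_balance:
      "\<And>j k n y. 1 \<le> y j \<Longrightarrow> y k = 0 \<Longrightarrow> 1 \<le> n j \<Longrightarrow>
         lam j (n j - 1) y / mu j (n j) y * theta j k (n j) (n k) y =
         lam k (n k) y / mu k (n k + 1) y * theta k j (n k + 1) (n j - 1) y"
    and eps_balance:
      "\<And>i j n y. i \<noteq> j \<Longrightarrow> 1 \<le> y i \<Longrightarrow> 1 \<le> y j \<Longrightarrow> 1 \<le> n i \<Longrightarrow>
         lam i (n i - 1) y * gam i (n i - 1) ^ y i / mu i (n i) y * eps i j (n i) (n j) y =
         lam j (n j) y * gam j (n j) ^ y j / mu j (n j + 1) y * eps j i (n j + 1) (n i - 1) y"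
    and tau_balance:
      "\<And>j j' n y. 1 \<le> y j \<Longrightarrow> j' \<noteq> j \<Longrightarrow>
         tau j j' n y * (\<Prod>q\<in>UNIV. lam_bar lam q (n q) y / mu_bar mu q (n q) y) =
         tau j' j n (transfer j j' y) *
           (\<Prod>q\<in>UNIV. lam_bar lam q (n q) (transfer j j' y) / mu_bar mu q (n q) (transfer j j' y))"
    and U_finite:
      "\<And>y l. (\<Sum>s\<in>UNIV. y s) = M \<Longrightarrow> y l = 0 \<Longrightarrow> summable (U_term lam mu y l)"
    and C_finite:
      "\<And>y r. (\<Sum>s\<in>UNIV. y s) = M \<Longrightarrow> 1 \<le> y r \<Longrightarrow> summable (C_term lam mu gam y r)"
    and process:
      "markov_process (states M) (generator lam mu gam beta theta eps tau) Pr Y H"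
    and regular:
      "(\<exists>K. \<forall>i n. gam i n \<le> K) \<or> non_explosive (states M) Pr H"
  shows "non_explosive (states M) Pr H \<and>
    positive_recurrent (states M) (generator lam mu gam beta theta eps tau) Pr Y H \<and>
    reversible (states M) Pr Y H (stat_prob lam mu gam M) \<and>
    stationary_distribution (states M) Pr Y H (stat_prob lam mu gam M) \<and>
    (\<forall>p. stationary_distribution (states M) Pr Y H p \<longrightarrow>
       (\<forall>x\<in>states M. p x = stat_prob lam mu gam M x))"
proof -
  interpret task_network M lam mu gam beta theta eps tau
    by (rule task_network.intro) fact+
  interpret markov_family S Gen Pr Y H
    by unfold_locales (rule process)
  have non_expl: "non_explosive S Pr H"
    using regular
  proof
    assume "\<exists>K. \<forall>i n. gam i n \<le> K"
    from drift_bound[OF this] obtain a where a: "0 < a"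
      "\<And>x. x \<in> S \<Longrightarrow> (\<Sum>z\<in>{z. Gen x z \<noteq> 0} - {x}. Gen x z * (1 + real (\<Sum>s\<in>UNIV. snd z s))) \<le>
        (a + q x) * (1 + real (\<Sum>s\<in>UNIV. snd x s))" by blast
    show ?thesis
    proof (rule non_explosive_Lyapunov[OF _ _ a])
      fix c :: real
      have "{z\<in>S. 1 + real (\<Sum>s\<in>UNIV. snd z s) \<le> c} \<subseteq> {z\<in>S. (\<Sum>s\<in>UNIV. snd z s) \<le> nat \<lceil>c\<rceil>}"
      proof safe
        fix y n assume "1 + real (\<Sum>s\<in>UNIV. snd (y, n) s) \<le> c"
        then show "(\<Sum>s\<in>UNIV. snd (y, n) s) \<le> nat \<lceil>c\<rceil>" by linarith
      qed
      then show "finite {z\<in>S. 1 + real (\<Sum>s\<in>UNIV. snd z s) \<le> c}"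
        by (rule finite_subset) (rule finite_task_bound)
    qed (simp_all del: of_nat_sum)
  qed
  let ?w = "stat_prob lam mu gam M"
  interpret reversible_family S Gen Pr Y H ?w origin
  proof
    show "0 \<le> ?w x" if "x \<in> S" for x
      using that weight_nonneg Xi_pos by (simp add: stat_prob_weight)
    show "(?w has_sum 1) S" by (rule stat_prob_has_sum)
    show "?w x * Gen x z = ?w z * Gen z x" if "x \<in> S" "z \<in> S" "z \<noteq> x" for x z
      using that weight_rate_balance[of x z] by (simp add: stat_prob_weight generator_offdiag)
    show "0 < ?w origin" using Xi_pos by (simp add: stat_prob_weight origin_in_S weight_origin)
  qed (use origin_in_S reaches_origin non_expl in auto)
  have "positive_recurrent S Gen Pr Y H"
  proof (rule positive_recurrent_w)
    fix x assume "x \<in> S" "?w x = 0"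
    then show "finite {z. reaches x z}"
      using Xi_pos by (intro finite_reaches) (auto simp: stat_prob_weight)
  qed
  then show ?thesis
    using non_expl reversible_w stationary_w stationary_unique by blast
qed

end
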